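(* Let $X$ be a complex analytic space embedded in $\mathbb{C}^N$ with $\dim_{\mathbb{C}}X_{\mathrm{reg}}=n$, and let $\Omega\subseteq X$ be an open set with $k(\Omega)<\infty$. If $E\subseteq\Omega$ and $\mathcal{H}^{2n-2}(E)<+\infty$, then $C^{\Omega}_{1,2}(E)=0$.
   Context: $\mathcal{H}^s$ is the $s$-dimensional Hausdorff measure induced by the Euclidean distance of $\mathbb{C}^N$; $X_{\mathrm{reg}}$ is the set of regular points of $X$ and $\Omega_{\mathrm{reg}}=\Omega\cap X_{\mathrm{reg}}$. The condition $k(\Omega)<\infty$ (a standing assumption, satisfied for instance when $\Omega$ is relatively compact) means that there is a finite constant $k(\Omega)$ with $\mathcal{H}^{2n}(X\cap B(q,\rho))\le k(\Omega)\rho^{2n}$ for every ball $B(q,\rho)$ of $\Omega$. Sobolev space: $W^{1,2}(\Omega)$ is the space of functions $f\in L^2(\Omega,\mathcal{H}^{2n})$ which belong to $W^{1,2}(U)$ (in the usual sense on the manifold $X_{\mathrm{reg}}$ with the Riemannian metric induced by $\mathbb{C}^N$) for every open $U$ relatively compact in $\Omega_{\mathrm{reg}}$, and whose weak gradient $\nabla f$ on $\Omega_{\mathrm{reg}}$ satisfies $|\nabla f|\in L^2(\Omega,\mathcal{H}^{2n})$. Norms of $\nabla f$ are taken with respect to the metric induced by $\mathbb{C}^N$, and $\|\nabla f\|_2^2=\int_{\Omega_{\mathrm{reg}}}|\nabla f|^2\,d\mathcal{H}^{2n}$. Capacity: $C^{\Omega}_{1,2}(E)=\inf\{\|\nabla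 f\|_2^2:\ f\in W^{1,2}(\Omega),\ E\subset\mathrm{Int}\{f\ge1\}\}$, where $\mathrm{Int}$ is the topological interior relative to $\Omega$ and the inclusion is required for some representative of the equivalence class of $f$. *)

theory Defs
  imports "HOL-Analysis.Analysis"
begin

section \<open>Hausdorff measure\<close>

text \<open>
  The cost of a covering set is the volume of an \<open>s\<close>-dimensional ball of the same diameter, so
  that the \<open>d\<close>-dimensional measure is Lebesgue measure on \<open>d\<close>-dimensional Euclidean spaces.
  The case \<open>s = 0\<close> has to be separated because \<open>0 powr 0 = 0\<close>.
\<close>

definition hausdorff_cost :: "real \<Rightarrow> 'a::metric_space set \<Rightarrow> ennreal" where
  "hausdorff_cost s C =
     (if C = {} then 0 else if s = 0 then 1
      else ennreal (unit_ball_vol s * (diameter C / 2) powr s))"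

text \<open>Boundedness is required since \<open>diameter\<close> is unspecified on unbounded sets.\<close>

definition hausdorff_pre :: "real \<Rightarrow> real \<Rightarrow> 'a::metric_space set \<Rightarrow> ennreal" where
  "hausdorff_pre s \<delta> A =
     (INF C \<in> {C :: nat \<Rightarrow> 'a set. A \<subseteq> (\<Union>i. C i) \<and> (\<forall>i. bounded (C i) \<and> diameter (C i) \<le> \<delta>)}.
        \<Sum>i. hausdorff_cost s (C i))"

definition hausdorff_outer :: "real \<Rightarrow> 'a::metric_space set \<Rightarrow> ennreal" where
  "hausdorff_outer s A = (SUP \<delta> \<in> {0<..}. hausdorff_pre s \<delta> A)"

definition hausdorff_measure :: "real \<Rightarrow> 'a::metric_space measure" where
  "hausdorff_measure s = measure_of UNIV (sets borel) (hausdorff_outer s)"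

section \<open>Complex analytic sets and their regular points\<close>

text \<open>
  Holomorphy in several variables: continuously differentiable with complex linear differential
  \<open>dh = (\<Sum>i. (\<partial>h/\<partial>z\<^sub>i) dz\<^sub>i)\<close>; here \<open>g\<close> is the vector of the complex partial derivatives.
\<close>

definition holomorphic_fun :: "(complex ^ 'N) set \<Rightarrow> (complex ^ 'N \<Rightarrow> complex) \<Rightarrow> bool" where
  "holomorphic_fun U h \<longleftrightarrow>
     (\<exists>g :: complex ^ 'N \<Rightarrow> complex ^ 'N. continuous_on U g \<and>
        (\<forall>z\<in>U. (h has_derivative (\<lambda>v. \<Sum>i\<in>UNIV. g z $ i * v $ i)) (at z)))"

definition holomorphic_map :: "(complex ^ 'N) set \<Rightarrow> (complex ^ 'N \<Rightarrow> complex ^ 'M) \<Rightarrow> bool" where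
  "holomorphic_map U F \<longleftrightarrow> (\<forall>i. holomorphic_fun U (\<lambda>z. F z $ i))"

definition biholomorphic_on :: "(complex ^ 'N) set \<Rightarrow> (complex ^ 'N \<Rightarrow> complex ^ 'N) \<Rightarrow> bool" where
  "biholomorphic_on V \<Phi> \<longleftrightarrow>
     open V \<and> open (\<Phi> ` V) \<and> holomorphic_map V \<Phi> \<and>
     (\<exists>\<Psi>. holomorphic_map (\<Phi> ` V) \<Psi> \<and> (\<forall>y\<in>V. \<Psi> (\<Phi> y) = y))"

text \<open>
  Only points of \<open>X\<close> are considered, so \<open>X\<close> is locally closed in \<open>\<complex>\<^sup>N\<close> but need not be closed.
\<close>

definition analytic_set :: "(complex ^ 'N) set \<Rightarrow> bool" where
  "analytic_set X \<longleftrightarrow>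
     (\<forall>p\<in>X. \<exists>U F. open U \<and> p \<in> U \<and> finite F \<and> (\<forall>h\<in>F. holomorphic_fun U h) \<and>
        X \<inter> U = {z\<in>U. \<forall>h\<in>F. h z = 0})"

text \<open>
  A chart of dimension \<open>m\<close> is a biholomorphic map \<open>\<Phi>\<close> of an open set \<open>V\<close> of the ambient space
  that carries the part of an \<open>m\<close>-dimensional complex linear subspace \<open>L\<close> in \<open>V\<close> onto an open
  part of \<open>X\<close>. The subspace takes the place of \<open>\<complex>\<^sup>m\<close>; it is complex linear because \<open>vec.subspace\<close>
  refers to the scalar multiplication \<open>(*s)\<close>.
\<close>

definition chart ::
  "(complex ^ 'N) set \<Rightarrow> nat \<Rightarrow> (complex ^ 'N) set \<Rightarrow> (complex ^ 'N) set
     \<Rightarrow> (complex ^ 'N \<Rightarrow> complex ^ 'N) \<Rightarrow> bool" where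
  "chart X m L V \<Phi> \<longleftrightarrow>
     vec.subspace L \<and> vec.dim L = m \<and> biholomorphic_on V \<Phi> \<and> \<Phi> ` (V \<inter> L) = X \<inter> \<Phi> ` V"

definition regular_point :: "(complex ^ 'N) set \<Rightarrow> nat \<Rightarrow> complex ^ 'N \<Rightarrow> bool" where
  "regular_point X m p \<longleftrightarrow> p \<in> X \<and> (\<exists>L V \<Phi>. chart X m L V \<Phi> \<and> p \<in> \<Phi> ` V)"

definition reg :: "(complex ^ 'N) set \<Rightarrow> (complex ^ 'N) set" where
  "reg X = {p. \<exists>m. regular_point X m p}"

text \<open>The dimension of \<open>reg X\<close> is the maximum of the dimensions of its components.\<close>

definition reg_has_dim :: "(complex ^ 'N) set \<Rightarrow> nat \<Rightarrow> bool" where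
  "reg_has_dim X n \<longleftrightarrow> (\<exists>p. regular_point X n p) \<and> (\<forall>m p. regular_point X m p \<longrightarrow> m \<le> n)"

text \<open>Velocities of curves in \<open>X\<close>; at a regular point this is the tangent space of \<open>reg X\<close>.\<close>

definition tangent_space :: "(complex ^ 'N) set \<Rightarrow> complex ^ 'N \<Rightarrow> (complex ^ 'N) set" where
  "tangent_space X p =
     {v. \<exists>\<gamma> :: real \<Rightarrow> complex ^ 'N. \<gamma> 0 = p \<and> (\<forall>\<^sub>F t in at 0. \<gamma> t \<in> X) \<and>
           (\<gamma> has_vector_derivative v) (at 0)}"

section \<open>The volume growth condition\<close>

text \<open>The balls of \<open>\<Omega>\<close> are the balls of \<open>X\<close> that are centred in \<open>\<Omega>\<close> and contained in \<open>\<Omega>\<close>.\<close>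

definition volume_growth_bounded ::
  "(complex ^ 'N) set \<Rightarrow> nat \<Rightarrow> (complex ^ 'N) set \<Rightarrow> bool" where
  "volume_growth_bounded X n \<Omega> \<longleftrightarrow>
     (\<exists>k::real. \<forall>q\<in>\<Omega>. \<forall>\<rho>>0. X \<inter> ball q \<rho> \<subseteq> \<Omega> \<longrightarrow>
        hausdorff_outer (2 * real n) (X \<inter> ball q \<rho>) \<le> ennreal (k * \<rho> ^ (2 * n)))"

section \<open>Sobolev functions and capacity\<close>

definition L2_on ::
  "nat \<Rightarrow> (complex ^ 'N) set \<Rightarrow> (complex ^ 'N \<Rightarrow> 'b::{real_normed_vector, second_countable_topology})
     \<Rightarrow> bool" where
  "L2_on n W g \<longleftrightarrow>
     g \<in> borel_measurable (restrict_space (hausdorff_measure (2 * real n)) W) \<and>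
     integrable (restrict_space (hausdorff_measure (2 * real n)) W) (\<lambda>x. (norm (g x))\<^sup>2)"

text \<open>
  Compactly supported test functions in \<open>V\<close> with their gradient. By mollification, continuously
  differentiable test functions define the same weak derivatives as smooth ones.
\<close>

definition test_function ::
  "(complex ^ 'N) set \<Rightarrow> (complex ^ 'N \<Rightarrow> real) \<Rightarrow> (complex ^ 'N \<Rightarrow> complex ^ 'N) \<Rightarrow> bool" where
  "test_function V \<phi> g \<longleftrightarrow>
     (\<forall>x. GDERIV \<phi> x :> g x) \<and> continuous_on UNIV g \<and>
     (\<exists>K. compact K \<and> K \<subseteq> V \<and> (\<forall>x. x \<notin> K \<longrightarrow> \<phi> x = 0))"

text \<open>
  \<open>G\<close> is the weak gradient of \<open>f\<close> on the open subset \<open>W\<close> of \<open>reg X\<close>: it is tangential, and in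
  each chart the weak derivative of \<open>f \<circ> \<Phi>\<close> in the direction \<open>v\<close> is \<open>df (D\<Phi> v) = \<langle>G \<circ> \<Phi>, D\<Phi> v\<rangle>\<close>.
  The inner product of \<open>complex ^ 'N\<close> is the real Euclidean one, so \<open>G\<close> is the gradient for the
  induced Riemannian metric. The measure of dimension \<open>2n\<close> on \<open>L\<close> is Lebesgue measure of the
  chart domain. Only charts of dimension \<open>n\<close> occur: components of smaller dimension are null sets.
  The weak gradient is unique up to null sets.
\<close>

definition weak_gradient ::
  "(complex ^ 'N) set \<Rightarrow> nat \<Rightarrow> (complex ^ 'N) set \<Rightarrow> (complex ^ 'N \<Rightarrow> real)
     \<Rightarrow> (complex ^ 'N \<Rightarrow> complex ^ 'N) \<Rightarrow> bool" where
  "weak_gradient X n W f G \<longleftrightarrow>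
     f \<in> borel_measurable (restrict_space (hausdorff_measure (2 * real n)) W) \<and>
     G \<in> borel_measurable (restrict_space (hausdorff_measure (2 * real n)) W) \<and>
     (\<forall>K. compact K \<and> K \<subseteq> W \<longrightarrow>
        set_integrable (hausdorff_measure (2 * real n)) K f \<and>
        set_integrable (hausdorff_measure (2 * real n)) K G) \<and>
     (AE x in restrict_space (hausdorff_measure (2 * real n)) W. G x \<in> tangent_space X x) \<and>
     (\<forall>L V \<Phi>. chart X n L V \<Phi> \<and> \<Phi> ` (V \<inter> L) \<subseteq> W \<longrightarrow>
        (\<forall>\<phi> g v. test_function V \<phi> g \<and> v \<in> L \<longrightarrow>
           (LINT y:(V \<inter> L)|hausdorff_measure (2 * real n). f (\<Phi> y) * (g y \<bullet> v)) =
         - (LINT y:(V \<inter> L)|hausdorff_measure (2 * real n).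
              (G (\<Phi> y) \<bullet> frechet_derivative \<Phi> (at y) v) * \<phi> y)))"

text \<open>The space \<open>W\<^sup>1\<^sup>,\<^sup>2(U)\<close> for an open subset \<open>U\<close> of the manifold \<open>reg X\<close>.\<close>

definition W12_manifold ::
  "(complex ^ 'N) set \<Rightarrow> nat \<Rightarrow> (complex ^ 'N) set \<Rightarrow> (complex ^ 'N \<Rightarrow> real) \<Rightarrow> bool" where
  "W12_manifold X n U f \<longleftrightarrow> L2_on n U f \<and> (\<exists>G. weak_gradient X n U f G \<and> L2_on n U G)"

text \<open>
  Membership of \<open>f\<close> in \<open>W\<^sup>1\<^sup>,\<^sup>2(\<Omega>)\<close>, together with a representative \<open>G\<close> of its weak gradient.
\<close>

definition W12_with_gradient ::
  "(complex ^ 'N) set \<Rightarrow> nat \<Rightarrow> (complex ^ 'N) set \<Rightarrow> (complex ^ 'N \<Rightarrow> real)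
     \<Rightarrow> (complex ^ 'N \<Rightarrow> complex ^ 'N) \<Rightarrow> bool" where
  "W12_with_gradient X n \<Omega> f G \<longleftrightarrow>
     L2_on n \<Omega> f \<and>
     (\<forall>U K. openin (top_of_set (\<Omega> \<inter> reg X)) U \<and> compact K \<and> U \<subseteq> K \<and> K \<subseteq> \<Omega> \<inter> reg X \<longrightarrow>
        W12_manifold X n U f) \<and>
     weak_gradient X n (\<Omega> \<inter> reg X) f G \<and> L2_on n (\<Omega> \<inter> reg X) G"

definition gradient_energy ::
  "(complex ^ 'N) set \<Rightarrow> nat \<Rightarrow> (complex ^ 'N) set \<Rightarrow> (complex ^ 'N \<Rightarrow> complex ^ 'N) \<Rightarrow> ennreal" where
  "gradient_energy X n \<Omega> G =
     (\<integral>\<^sup>+x\<in>\<Omega> \<inter> reg X. ennreal ((norm (G x))\<^sup>2) \<partial>hausdorff_measure (2 * real n))"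

text \<open>
  The functions \<open>f\<close> are actual functions and not equivalence classes, hence the infimum runs over
  all representatives. It is \<open>\<infinity>\<close> if there is no admissible function.
\<close>

definition capacity12 ::
  "(complex ^ 'N) set \<Rightarrow> nat \<Rightarrow> (complex ^ 'N) set \<Rightarrow> (complex ^ 'N) set \<Rightarrow> ennreal" where
  "capacity12 X n \<Omega> E =
     (INF (f, G) \<in> {(f, G). W12_with_gradient X n \<Omega> f G \<and>
                      E \<subseteq> (top_of_set \<Omega>) interior_of {x\<in>\<Omega>. 1 \<le> f x}}.
        gradient_energy X n \<Omega> G)"

end

theory Submission
  imports Defs
begin

text \<open>
  Cover \<open>E\<close> by balls of \<open>\<Omega>\<close> with small radii \<open>r\<^sub>i\<close> and \<open>\<Sum>r\<^sub>i\<^bsup>2n-2\<^esup>\<close> bounded. Combining cutoffs of these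
  balls gives a function \<open>f \<ge> 1\<close> near \<open>E\<close> with \<open>\<bar>\<nabla>f\<bar>\<^sup>2\<close> at most a constant times
  \<open>\<Sum>r\<^sub>i\<^bsup>-2\<^esup>\<close> over the doubled balls containing the point, so by volume growth its energy is bounded
  independently of the cover, while the measure of its support tends to \<open>0\<close> with the radii.
  The functions of a sequence of ever finer covers therefore have almost orthogonal gradients:
  the energy of the sum of \<open>m\<close> of them is \<open>O(m)\<close>, and the energy of their mean is \<open>O(1/m)\<close>.

  All functions involved are dominated limits of continuously differentiable functions on the
  ambient space. For these the weak gradient on \<open>reg X\<close> is the tangential part of the ambient
  gradient; integration by parts in a chart reduces to the translation invariance of the Hausdorff
  measure on the linear space \<open>L\<close>.
\<close>

section \<open>Hausdorff measure\<close>

text \<open>The exponent is critical: a ball of radius \<open>r\<close> costs energy of order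
  \<open>r ^ (2 * n - 2)\<close>, which is exactly the cost that the measure of \<open>E\<close>
  counts. This measure is finite but possibly not zero, so refining the cover does not make the
  energy of a single cutoff small; only averaging over many scales does. Three features of the
  setting shape the rest. \<open>E\<close> is not assumed compact, so covers are infinite and the
  cutoffs converge only almost everywhere, while the lower bound 1 near \<open>E\<close> is a
  pointwise condition. Volume growth is given only for balls of \<open>\<Omega>\<close>, so the
  radii have to shrink near the boundary of \<open>\<Omega>\<close> in \<open>X\<close>. Near a
  singular point there is no chart; functions on the ambient space extend across the singular set,
  and the volume bound holds there as well. Hausdorff measure on \<open>X\<close> and on a chart
  domain are compared only up to constants on compact sets, by Lipschitz estimates for the inverse
  chart.\<close>

lemma hausdorff_cost_empty [simp]: "hausdorff_cost s {} = 0"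
  by (simp add: hausdorff_cost_def)

lemma hausdorff_pre_le:
  assumes "A \<subseteq> (\<Union>i. C i)" "\<And>i. bounded (C i)" "\<And>i. diameter (C i) \<le> \<delta>"
  shows "hausdorff_pre s \<delta> A \<le> (\<Sum>i. hausdorff_cost s (C (i::nat)))"
  unfolding hausdorff_pre_def using assms by (intro INF_lower) auto

lemma hausdorff_pre_less_cover:
  assumes "hausdorff_pre s \<delta> A < c"
  shows "\<exists>C. A \<subseteq> (\<Union>i. C i) \<and> (\<forall>i::nat. bounded (C i)) \<and> (\<forall>i. diameter (C i) \<le> \<delta>) \<and>
    (\<Sum>i. hausdorff_cost s (C i)) < c"
  using assms unfolding hausdorff_pre_def INF_less_iff by auto

lemma hausdorff_pre_antimono:
  assumes "\<delta> \<le> \<delta>'"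
  shows "hausdorff_pre s \<delta>' A \<le> hausdorff_pre s \<delta> A"
  unfolding hausdorff_pre_def using assms by (intro INF_superset_mono) (auto intro: order_trans)

lemma hausdorff_pre_mono:
  assumes "A \<subseteq> B"
  shows "hausdorff_pre s \<delta> A \<le> hausdorff_pre s \<delta> B"
  unfolding hausdorff_pre_def using assms by (intro INF_superset_mono) auto

lemma hausdorff_pre_le_outer:
  "0 < \<delta> \<Longrightarrow> hausdorff_pre s \<delta> A \<le> hausdorff_outer s A"
  unfolding hausdorff_outer_def by (intro SUP_upper) auto

lemma hausdorff_outer_mono:
  assumes "A \<subseteq> B"
  shows "hausdorff_outer s A \<le> hausdorff_outer s B"
  unfolding hausdorff_outer_def using assms by (intro SUP_mono') (rule hausdorff_pre_mono)

lemma hausdorff_outer_empty [simp]: "hausdorff_outer s {} = 0"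
proof -
  have "hausdorff_pre s \<delta> ({}::'a set) = 0" if "0 < \<delta>" for \<delta>
    using hausdorff_pre_le[of "{}" "\<lambda>_. {}" \<delta> s] that by simp
  then show ?thesis
    by (simp add: hausdorff_outer_def)
qed

lemma hausdorff_pre_UN:
  fixes A :: "nat \<Rightarrow> 'a::metric_space set"
  shows "hausdorff_pre s \<delta> (\<Union>i. A i) \<le> (\<Sum>i. hausdorff_pre s \<delta> (A i))"
proof (rule ennreal_le_epsilon)
  fix e :: real assume "0 < e" and fin: "(\<Sum>n. hausdorff_pre s \<delta> (A n)) < top"
  then have *: "\<And>n. hausdorff_pre s \<delta> (A n) < hausdorff_pre s \<delta> (A n) + e * (1/2)^Suc n"
    by (auto simp add: less_top dest!: ennreal_suminf_lessD)
  have "\<exists>C. A n \<subseteq> (\<Union>i. C i) \<and> (\<forall>i::nat. bounded (C i)) \<and> (\<forall>i. diameter (C i) \<le> \<delta>) \<and>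
      (\<Sum>i. hausdorff_cost s (C i)) < hausdorff_pre s \<delta> (A n) + e * (1/2)^Suc n" for n
    by (rule hausdorff_pre_less_cover[OF *])
  then obtain B where B: "\<And>n. A n \<subseteq> (\<Union>i. B n i)" "\<And>n i::nat. bounded (B n i)"
    "\<And>n i. diameter (B n i) \<le> \<delta>"
    "\<And>n. (\<Sum>i. hausdorff_cost s (B n i)) < hausdorff_pre s \<delta> (A n) + e * (1/2)^Suc n"
    by metis
  define C where "C = case_prod B o prod_decode"
  have A_C: "(\<Union>i. A i) \<subseteq> (\<Union>i. C i)"
    using B(1) by (auto simp add: C_def subset_eq) (metis prod.case prod_encode_inverse)
  have "hausdorff_pre s \<delta> (\<Union>i. A i) \<le> (\<Sum>i. hausdorff_cost s (C i))"
    using A_C B(2,3) by (intro hausdorff_pre_le) (auto simp: C_def split: prod.splits)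
  also have "\<dots> = (\<Sum>i. (\<lambda>(m,n). hausdorff_cost s (B m n)) (prod_decode i))"
    by (simp add: C_def split_def)
  also have "\<dots> = (\<Sum>n. \<Sum>i. hausdorff_cost s (B n i))"
    by (intro suminf_ennreal_2dimen) simp
  also have "\<dots> \<le> (\<Sum>n. hausdorff_pre s \<delta> (A n) + e * (1/2) ^ Suc n)"
    using B(4) by (intro suminf_le allI less_imp_le) auto
  also have "... = (\<Sum>n. hausdorff_pre s \<delta> (A n)) + (\<Sum>n. ennreal e * ennreal ((1/2) ^ Suc n))"
    using \<open>0 < e\<close> by (subst suminf_add[symmetric])
                     (auto simp del: ennreal_suminf_cmult simp add: ennreal_mult[symmetric])
  also have "\<dots> = (\<Sum>n. hausdorff_pre s \<delta> (A n)) + e"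
    unfolding ennreal_suminf_cmult
    by (subst suminf_ennreal_eq[OF zero_le_power power_half_series]) auto
  finally show "hausdorff_pre s \<delta> (\<Union>i. A i) \<le> (\<Sum>n. hausdorff_pre s \<delta> (A n)) + e" .
qed

lemma hausdorff_outer_UN:
  fixes A :: "nat \<Rightarrow> 'a::metric_space set"
  shows "hausdorff_outer s (\<Union>i. A i) \<le> (\<Sum>i. hausdorff_outer s (A i))"
proof -
  have "hausdorff_pre s \<delta> (\<Union>i. A i) \<le> (\<Sum>i. hausdorff_outer s (A i))" if "0 < \<delta>" for \<delta>
    using that by (intro order_trans[OF hausdorff_pre_UN] suminf_le hausdorff_pre_le_outer) auto
  then show ?thesis
    unfolding hausdorff_outer_def[of s "\<Union>i. A i"] by (intro SUP_least) auto
qed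

section \<open>Metric outer measures and measurability of Borel sets\<close>

lemma outer_measure_space_hausdorff: "outer_measure_space (Pow UNIV) (hausdorff_outer s)"
  by (auto simp: outer_measure_space_def positive_def increasing_def countably_subadditive_def
      intro: hausdorff_outer_mono hausdorff_outer_UN)

lemma hausdorff_outer_Un: "hausdorff_outer s (A \<union> B) \<le> hausdorff_outer s A + hausdorff_outer s B"
proof -
  have "hausdorff_outer s (A \<union> B) = hausdorff_outer s (\<Union>i. binaryset A B i)"
    by (simp add: UN_binaryset_eq)
  also have "\<dots> \<le> (\<Sum>i. hausdorff_outer s (binaryset A B i))"
    by (rule hausdorff_outer_UN)
  also have "\<dots> = hausdorff_outer s A + hausdorff_outer s B"
    by (simp add: suminf_binaryset_eq)
  finally show ?thesis .
qed

text \<open>A covering set of diameter less than \<open>d\<close> cannot meet both \<open>A\<close>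
  and \<open>B\<close>, so a fine cover of the union splits into covers of the two parts. The
  premeasure grows as \<open>\<delta>\<close> decreases, so restricting to
  \<open>\<delta> < d\<close> loses nothing in the supremum.\<close>

lemma hausdorff_outer_separated:
  fixes A B :: "'a::metric_space set"
  assumes "0 < d" and sep: "\<And>x y. x \<in> A \<Longrightarrow> y \<in> B \<Longrightarrow> d \<le> dist x y"
  shows "hausdorff_outer s A + hausdorff_outer s B \<le> hausdorff_outer s (A \<union> B)"
proof -
  have pre: "hausdorff_pre s \<delta> A + hausdorff_pre s \<delta> B \<le> hausdorff_pre s \<delta> (A \<union> B)"
    if \<delta>: "0 < \<delta>" "\<delta> < d" for \<delta>
    unfolding hausdorff_pre_def[of s \<delta> "A \<union> B"]
  proof (safe intro!: INF_greatest)
    fix C :: "nat \<Rightarrow> 'a set"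
    assume C: "A \<union> B \<subseteq> (\<Union>i. C i)" "\<forall>i. bounded (C i) \<and> diameter (C i) \<le> \<delta>"
    \<comment> \<open>Sets that miss the part in question become empty and cost 0; the cover stays
      indexed by \<open>nat\<close>.\<close>
    define C1 where "C1 i = (if C i \<inter> A = {} then {} else C i)" for i
    define C2 where "C2 i = (if C i \<inter> B = {} then {} else C i)" for i
    have "hausdorff_pre s \<delta> A \<le> (\<Sum>i. hausdorff_cost s (C1 i))"
      using C \<delta>(1) by (intro hausdorff_pre_le) (auto simp: C1_def split: if_splits; fast)+
    moreover have "hausdorff_pre s \<delta> B \<le> (\<Sum>i. hausdorff_cost s (C2 i))"
      using C \<delta>(1) by (intro hausdorff_pre_le) (auto simp: C2_def split: if_splits; fast)+
    moreover have "C i \<inter> A = {} \<or> C i \<inter> B = {}" for i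
    proof (rule ccontr)
      assume "\<not> ?thesis"
      then obtain x y where "x \<in> C i" "x \<in> A" "y \<in> C i" "y \<in> B" by auto
      then have "d \<le> dist x y" "dist x y \<le> diameter (C i)"
        using sep C(2) diameter_bounded_bound by blast+
      with C(2) \<delta> show False by (meson less_le_not_le order_trans)
    qed
    then have "hausdorff_cost s (C1 i) + hausdorff_cost s (C2 i) \<le> hausdorff_cost s (C i)" for i
      by (auto simp: C1_def C2_def)
    then have "(\<Sum>i. hausdorff_cost s (C1 i)) + (\<Sum>i. hausdorff_cost s (C2 i)) \<le> (\<Sum>i. hausdorff_cost s (C i))"
      by (subst suminf_add) (auto intro!: suminf_le)
    ultimately show "hausdorff_pre s \<delta> A + hausdorff_pre s \<delta> B \<le> (\<Sum>i. hausdorff_cost s (C i))"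
      by (meson add_mono order_trans)
  qed
  have "hausdorff_outer s A + hausdorff_outer s B =
      (SUP \<delta>\<in>{0<..}. hausdorff_pre s \<delta> A + hausdorff_pre s \<delta> B)"
    unfolding hausdorff_outer_def
  proof (rule SUP_add_directed_ennreal[symmetric])
    fix i j :: real assume ij: "i \<in> {0<..}" "j \<in> {0<..}"
    then show "\<exists>k\<in>{0<..}. hausdorff_pre s i A + hausdorff_pre s j B \<le> hausdorff_pre s k A + hausdorff_pre s k B"
      by (intro bexI[of _ "min i j"] add_mono hausdorff_pre_antimono) auto
  qed
  also have "\<dots> \<le> hausdorff_outer s (A \<union> B)"
  proof (rule SUP_least)
    fix \<delta> :: real assume \<delta>: "\<delta> \<in> {0<..}"
    let ?\<delta> = "min \<delta> (d/2)"
    have "hausdorff_pre s \<delta> A + hausdorff_pre s \<delta> B \<le> hausdorff_pre s ?\<delta> A + hausdorff_pre s ?\<delta> B"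
      by (intro add_mono hausdorff_pre_antimono) auto
    also have "\<dots> \<le> hausdorff_pre s ?\<delta> (A \<union> B)"
      using \<delta> \<open>0 < d\<close> by (intro pre) auto
    also have "\<dots> \<le> hausdorff_outer s (A \<union> B)"
      using \<delta> \<open>0 < d\<close> by (intro hausdorff_pre_le_outer) auto
    finally show "hausdorff_pre s \<delta> A + hausdorff_pre s \<delta> B \<le> hausdorff_outer s (A \<union> B)" .
  qed
  finally show ?thesis .
qed

text \<open>The gap \<open>d\<close> may depend on \<open>i\<close>, because the induction only
  separates the last set from the union of its predecessors. Shells around a closed set require this
  freedom: their gaps shrink to 0.\<close>

lemma hausdorff_outer_sum_separated:
  fixes D :: "nat \<Rightarrow> 'a::metric_space set"
  assumes sep: "\<And>i. \<exists>d>0. \<forall>j<i. \<forall>x\<in>D j. \<forall>y\<in>D i. d \<le> dist x y"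
  shows "(\<Sum>i<m. hausdorff_outer s (D i)) \<le> hausdorff_outer s (\<Union>i<m. D i)"
proof (induction m)
  case (Suc m)
  obtain d where d: "d > 0" "\<forall>j<m. \<forall>x\<in>D j. \<forall>y\<in>D m. d \<le> dist x y"
    using sep by blast
  have "(\<Sum>i<Suc m. hausdorff_outer s (D i)) \<le> hausdorff_outer s (\<Union>i<m. D i) + hausdorff_outer s (D m)"
    using Suc by (auto intro: add_mono)
  also have "\<dots> \<le> hausdorff_outer s ((\<Union>i<m. D i) \<union> D m)"
    using d by (intro hausdorff_outer_separated[of d]) auto
  also have "(\<Union>i<m. D i) \<union> D m = (\<Union>i<Suc m. D i)"
    by (auto simp: less_Suc_eq)
  finally show ?case .
qed simp

text \<open>
  Caratheodory's criterion for metric outer measures: the shells \<open>D k\<close> around \<open>F\<close> with indices of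
  the same parity are separated, so their measures are summable and the tails vanish.
\<close>

lemma closed_in_lambda_system_hausdorff:
  fixes F :: "'a::metric_space set"
  assumes "closed F"
  shows "F \<in> lambda_system UNIV (Pow UNIV) (hausdorff_outer s)"
proof -
  let ?H = "hausdorff_outer s"
  have main: "?H (A \<inter> F) + ?H (A - F) \<le> ?H A" if fin: "?H A < \<infinity>" for A :: "'a set"
  proof (rule ennreal_le_epsilon)
    fix e :: real assume "0 < e"
    \<comment> \<open>Quantifying over \<open>F\<close>, rather than using the distance to
      \<open>F\<close>, includes the case \<open>F = {}\<close>, where every \<open>P k\<close> is
      \<open>A\<close>.\<close>
    define P where "P k = {x\<in>A. \<forall>y\<in>F. 1 / real (Suc k) \<le> dist x y}" for k
    define D where "D k = P (Suc k) - P k" for k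
    have Pmono: "P k \<subseteq> P l" if "k \<le> l" for k l
    proof -
      have "1 / real (Suc l) \<le> 1 / real (Suc k)"
        using that by (simp add: frac_le)
      then show ?thesis
        by (auto simp: P_def intro: order_trans)
    qed
    have PA: "P k \<subseteq> A - F" for k
      by (force simp: P_def)
    have DA: "D k \<subseteq> A" for k
      using PA by (auto simp: D_def)
    have UP: "A - F \<subseteq> P N \<union> (\<Union>k. D (k + N))" for N
    proof
      fix x assume x: "x \<in> A - F"
      then have "\<exists>k. x \<in> P k"
      proof -
        obtain r where r: "r > 0" "ball x r \<subseteq> - F"
          using x \<open>closed F\<close> openE[of "- F" x] by (auto simp: closed_def)
        obtain k where "1 / real (Suc k) < r"
          using r(1) by (rule nat_approx_posE)
        then have "x \<in> P k"
          using r x by (force simp: P_def)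
        then show ?thesis ..
      qed
      then obtain k where k: "x \<in> P k" "\<forall>j<k. x \<notin> P j"
        using exists_least_iff[of "\<lambda>k. x \<in> P k"] by blast
      show "x \<in> P N \<union> (\<Union>k. D (k + N))"
      proof (cases "k \<le> N")
        case True
        then show ?thesis using k Pmono by auto
      next
        case False
        then obtain j where j: "k = Suc (j + N)"
          by (metis not_le less_imp_Suc_add add.commute)
        then have "x \<in> D (j + N)" using k by (auto simp: D_def)
        then show ?thesis by auto
      qed
    qed
    \<comment> \<open>Points of \<open>D k\<close> stay at distance at least 1/(k+2) from
      \<open>F\<close>, while every point of \<open>D l\<close> has a point of \<open>F\<close>
      closer than 1/(l+1) \<le> 1/(k+3). Neighbouring shells may touch, hence
      \<open>k + 2 \<le> l\<close>.\<close>
    have Dsep: "1 / real (k + 2) - 1 / real (k + 3) \<le> dist x y" if hyp: "x \<in> D k" "y \<in> D l" "k + 2 \<le> l" for k l x y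
    proof -
      obtain z where z: "z \<in> F" "dist y z < 1 / real (Suc l)"
        using hyp(2) by (auto simp: D_def P_def not_le)
      have "1 / real (k + 2) \<le> dist x z"
        using hyp(1) z(1) by (auto simp: D_def P_def)
      moreover have "1 / real (Suc l) \<le> 1 / real (k + 3)"
        using hyp(3) by (intro frac_le) auto
      ultimately show ?thesis
        using z(2) dist_triangle[of x z y] by linarith
    qed
    have Dsep': "\<exists>d>0. \<forall>j<i. \<forall>x\<in>D (2 * j + p). \<forall>y\<in>D (2 * i + p). d \<le> dist x y" for i p
    proof (intro exI conjI allI impI ballI)
      define m where "m = 2 * i + p"
      show "0 < 1 / real (m + 2) - 1 / real (m + 3)"
        by (simp add: frac_less2)
      fix j x y assume j: "j < i" and xy: "x \<in> D (2 * j + p)" "y \<in> D (2 * i + p)"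
      have "1 / real (2 * j + p + 2) - 1 / real (2 * j + p + 3) \<le> dist x y"
        using xy j by (intro Dsep) auto
      moreover have "1 / real (m + 2) - 1 / real (m + 3) \<le> 1 / real (2 * j + p + 2) - 1 / real (2 * j + p + 3)"
      proof -
        have eq: "1 / real (a + 2) - 1 / real (a + 3) = 1 / (real (a + 2) * real (a + 3))" for a
          by (simp add: field_simps)
        show ?thesis
          unfolding eq m_def using j by (intro frac_le mult_mono mult_pos_pos) auto
      qed
      ultimately show "1 / real (m + 2) - 1 / real (m + 3) \<le> dist x y"
        by linarith
    qed
    have parity: "(\<Sum>i<m. ?H (D (2 * i + p))) \<le> ?H A" for m p
    proof -
      have "(\<Sum>i<m. ?H (D (2 * i + p))) \<le> ?H (\<Union>i<m. D (2 * i + p))"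
        by (rule hausdorff_outer_sum_separated) (rule Dsep')
      also have "\<dots> \<le> ?H A"
        using DA by (intro hausdorff_outer_mono) auto
      finally show ?thesis .
    qed
    have "(\<Sum>k. ?H (D k)) \<le> ?H A + ?H A"
    proof (rule suminf_le_const)
      fix m
      have "(\<Sum>k<2*m. ?H (D k)) = (\<Sum>i<m. ?H (D (2 * i + 0))) + (\<Sum>i<m. ?H (D (2 * i + 1)))"
        by (induction m) (auto simp: algebra_simps)
      then have "(\<Sum>k<2*m. ?H (D k)) \<le> ?H A + ?H A"
        using add_mono[OF parity parity] by metis
      then show "(\<Sum>k<m. ?H (D k)) \<le> ?H A + ?H A"
        using sum_mono2[of "{..<2*m}" "{..<m}" "\<lambda>k. ?H (D k)"] by (auto intro: order_trans)
    qed simp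
    also have "\<dots> < \<infinity>"
      using fin by (auto simp: ennreal_add_less_top)
    finally have sumfin: "(\<Sum>k. ?H (D k)) < \<infinity>" .
    define d where "d k = enn2real (?H (D k))" for k
    have d: "?H (D k) = ennreal (d k)" "0 \<le> d k" for k
      using ennreal_suminf_lessD[OF sumfin, of k] by (auto simp: d_def less_top)
    have "summable d"
      using sumfin d(2) unfolding d(1) by (intro summable_suminf_not_top) auto
    then obtain N where N: "norm (\<Sum>k. d (k + N)) < e"
      using suminf_exist_split[OF \<open>0 < e\<close>] by blast
    have "(\<Sum>k. ?H (D (k + N))) = ennreal (\<Sum>k. d (k + N))"
      unfolding d(1) using d(2) \<open>summable d\<close> by (intro suminf_ennreal2) (auto simp: summable_iff_shift)
    also have "\<dots> \<le> e"
      using N by (intro ennreal_leI) auto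
    finally have tail: "(\<Sum>k. ?H (D (k + N))) \<le> e" .
    have "?H (A - F) \<le> ?H (P N \<union> (\<Union>k. D (k + N)))"
      by (rule hausdorff_outer_mono[OF UP])
    also have "\<dots> \<le> ?H (P N) + (\<Sum>k. ?H (D (k + N)))"
      by (intro order_trans[OF hausdorff_outer_Un] add_left_mono hausdorff_outer_UN)
    also have "\<dots> \<le> ?H (P N) + e"
      using tail by (rule add_left_mono)
    finally have "?H (A \<inter> F) + ?H (A - F) \<le> (?H (A \<inter> F) + ?H (P N)) + e"
      by (simp add: add.assoc add_left_mono)
    also have "?H (A \<inter> F) + ?H (P N) \<le> ?H (A \<inter> F \<union> P N)"
      by (rule hausdorff_outer_separated[of "1 / real (Suc N)"]) (auto simp: P_def dist_commute)
    also have "\<dots> \<le> ?H A"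
      using PA by (intro hausdorff_outer_mono) auto
    finally show "?H (A \<inter> F) + ?H (A - F) \<le> ?H A + e"
      by (simp add: add_right_mono)
  qed
  have eq: "?H (A \<inter> F) + ?H (A - F) = ?H A" for A
  proof (rule antisym)
    show "?H (A \<inter> F) + ?H (A - F) \<le> ?H A"
    proof (cases "?H A < \<infinity>")
      case False
      then have "?H A = top" by (metis infinity_ennreal_def top.not_eq_extremum)
      then show ?thesis by simp
    qed (rule main)
    show "?H A \<le> ?H (A \<inter> F) + ?H (A - F)"
      using hausdorff_outer_Un[of s "A \<inter> F" "A - F"] by (simp add: Int_Diff_Un)
  qed
  have "(UNIV - F) \<inter> A = A - F" for A
    by auto
  then show ?thesis
    using eq by (simp add: lambda_system_def Int_commute)
qed

lemma borel_subset_lambda_system_hausdorff: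
  "sets (borel :: 'a::metric_space measure) \<subseteq> lambda_system UNIV (Pow UNIV) (hausdorff_outer s)"
proof -
  interpret sigma_algebra UNIV "Pow UNIV :: 'a set set"
    by (rule sigma_algebra_Pow)
  have "measure_space UNIV (lambda_system UNIV (Pow UNIV) (hausdorff_outer s :: 'a set \<Rightarrow> ennreal)) (hausdorff_outer s)"
    by (rule caratheodory_lemma[OF outer_measure_space_hausdorff])
  then have "sigma_algebra UNIV (lambda_system UNIV (Pow UNIV) (hausdorff_outer s :: 'a set \<Rightarrow> ennreal))"
    by (simp add: measure_space_def)
  then have "sigma_sets UNIV (Collect closed) \<subseteq> lambda_system UNIV (Pow UNIV) (hausdorff_outer s :: 'a set \<Rightarrow> ennreal)"
    by (rule sigma_algebra.sigma_sets_subset) (use closed_in_lambda_system_hausdorff in blast)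
  then show ?thesis
    by (simp add: borel_eq_closed)
qed

lemma sets_hausdorff_measure [simp, measurable_cong]: "sets (hausdorff_measure s :: 'a::metric_space measure) = sets borel"
  unfolding hausdorff_measure_def using sets.sigma_sets_eq[of "borel :: 'a measure"] by (simp add: sets_measure_of)

lemma space_hausdorff_measure [simp]: "space (hausdorff_measure s) = UNIV"
  by (simp add: hausdorff_measure_def space_measure_of_conv)

text \<open>\<open>measure_of\<close> yields the zero measure unless the given function is countably
  additive on the sets; on Borel sets Caratheodory's theorem provides this.\<close>

lemma emeasure_hausdorff_measure:
  fixes A :: "'a::metric_space set"
  assumes "A \<in> sets borel"
  shows "emeasure (hausdorff_measure s) A = hausdorff_outer s A"
  unfolding hausdorff_measure_def
proof (rule emeasure_measure_of_sigma)
  interpret sigma_algebra UNIV "Pow UNIV :: 'a set set"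
    by (rule sigma_algebra_Pow)
  have "measure_space UNIV (lambda_system UNIV (Pow UNIV) (hausdorff_outer s :: 'a set \<Rightarrow> ennreal)) (hausdorff_outer s)"
    by (rule caratheodory_lemma[OF outer_measure_space_hausdorff])
  then show "countably_additive (sets borel) (hausdorff_outer s :: 'a set \<Rightarrow> ennreal)"
    using borel_subset_lambda_system_hausdorff[where s=s and 'a='a]
    by (auto simp: measure_space_def countably_additive_def subset_eq)
qed (use assms sets.sigma_algebra_axioms[of "borel :: 'a measure"] in \<open>auto simp: positive_def\<close>)

text \<open>\<open>E\<close> need not be measurable. The Borel sets \<open>B i\<close> still split
  it additively, since they satisfy Caratheodory's criterion against every set.\<close>

lemma hausdorff_outer_disjoint_Borel_pieces:
  fixes B :: "nat \<Rightarrow> 'a::metric_space set"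
  assumes "\<And>i. B i \<in> sets borel" "disjoint_family B"
  shows "(\<Sum>i. hausdorff_outer s (E \<inter> B i)) \<le> hausdorff_outer s E"
proof (rule suminf_le_const)
  fix n
  interpret algebra UNIV "Pow UNIV :: 'a set set"
    by (rule algebra_Pow)
  have "(\<Sum>i = 0..<n. hausdorff_outer s (E \<inter> B i)) = hausdorff_outer s (E \<inter> (\<Union>i\<in>{0..<n}. B i))"
    using assms borel_subset_lambda_system_hausdorff[of s, where 'a='a]
    by (intro lambda_system_strong_sum) (auto simp: positive_def)
  also have "\<dots> \<le> hausdorff_outer s E"
    by (rule hausdorff_outer_mono) auto
  finally show "(\<Sum>i<n. hausdorff_outer s (E \<inter> B i)) \<le> hausdorff_outer s E"
    by (simp add: atLeast0LessThan)
qed simp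

section \<open>Lipschitz maps and translations\<close>

lemma hausdorff_outer_lipschitz_image:
  fixes f :: "'a::metric_space \<Rightarrow> 'b::metric_space"
  assumes "0 < s" "0 < L" and lip: "L-lipschitz_on A f"
  shows "hausdorff_outer s (f ` A) \<le> ennreal (L powr s) * hausdorff_outer s A"
proof -
  have "hausdorff_pre s \<delta> (f ` A) \<le> ennreal (L powr s) * hausdorff_outer s A" if "0 < \<delta>" for \<delta>
  proof -
    have "hausdorff_pre s \<delta> (f ` A) \<le> ennreal (L powr s) * hausdorff_pre s (\<delta> / L) A"
    proof (rule ennreal_le_epsilon)
      fix e :: real assume "0 < e" and fin: "ennreal (L powr s) * hausdorff_pre s (\<delta> / L) A < top"
      have "hausdorff_pre s (\<delta> / L) A < top"
        using fin \<open>0 < L\<close> by (auto simp: ennreal_mult_less_top)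
      then have "hausdorff_pre s (\<delta> / L) A < hausdorff_pre s (\<delta> / L) A + ennreal (e / L powr s)"
        using \<open>0 < e\<close> \<open>0 < L\<close> by (auto simp: less_top)
      then obtain C where C: "A \<subseteq> (\<Union>i. C i)" "\<And>i. bounded (C i)" "\<And>i. diameter (C i) \<le> \<delta> / L"
        "(\<Sum>i. hausdorff_cost s (C i)) < hausdorff_pre s (\<delta> / L) A + ennreal (e / L powr s)"
        by (metis hausdorff_pre_less_cover)
      \<comment> \<open>The Lipschitz bound holds on \<open>A\<close> only, so the covering sets are
        cut down to \<open>A\<close> before they are mapped.\<close>
      define C' where "C' i = f ` (A \<inter> C i)" for i
      have diam: "bounded (C' i) \<and> diameter (C' i) \<le> L * diameter (C i)" for i
      proof -
        have *: "dist x y \<le> L * diameter (C i)" if xy: "x \<in> C' i" "y \<in> C' i" for x y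
        proof -
          obtain a b where ab: "a \<in> A \<inter> C i" "b \<in> A \<inter> C i" "x = f a" "y = f b"
            using xy by (auto simp: C'_def)
          have "dist x y \<le> L * dist a b"
            using lip ab by (auto intro: lipschitz_onD)
          also have "\<dots> \<le> L * diameter (C i)"
            using ab \<open>0 < L\<close> C(2) by (intro mult_left_mono diameter_bounded_bound) auto
          finally show ?thesis .
        qed
        have "bounded (C' i)"
          using * by (auto simp: bounded_two_points)
        moreover have "diameter (C' i) \<le> L * diameter (C i)"
        proof (cases "C' i = {}")
          case False
          then have "(SUP (x, y)\<in>C' i \<times> C' i. dist x y) \<le> L * diameter (C i)"
            using * by (intro cSUP_least) auto
          then show ?thesis
            using False by (simp add: diameter_def[of "C' i"])
        qed (use \<open>0 < L\<close> C(2) diameter_ge_0 in \<open>auto intro!: mult_nonneg_nonneg\<close>)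
        ultimately show ?thesis ..
      qed
      have cost: "hausdorff_cost s (C' i) \<le> ennreal (L powr s) * hausdorff_cost s (C i)" for i
      proof (cases "C' i = {}")
        case False
        then have "C i \<noteq> {}" by (auto simp: C'_def)
        have "(diameter (C' i) / 2) powr s \<le> (L * (diameter (C i) / 2)) powr s"
          using diam[of i] diameter_ge_0[of "C' i"] \<open>0 < s\<close> by (intro powr_mono2) auto
        also have "\<dots> = L powr s * (diameter (C i) / 2) powr s"
          using \<open>0 < L\<close> C(2) by (intro powr_mult)
        finally have "unit_ball_vol s * (diameter (C' i) / 2) powr s \<le> L powr s * (unit_ball_vol s * (diameter (C i) / 2) powr s)"
          using \<open>0 < s\<close> unit_ball_vol_nonneg[of s] by (metis less_imp_le mult.left_commute mult_left_mono)
        then show ?thesis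
          using False \<open>C i \<noteq> {}\<close> \<open>0 < s\<close> unit_ball_vol_nonneg[of s]
          by (auto simp: hausdorff_cost_def ennreal_mult[symmetric] intro!: ennreal_leI)
      qed simp
      have "hausdorff_pre s \<delta> (f ` A) \<le> (\<Sum>i. hausdorff_cost s (C' i))"
      proof (rule hausdorff_pre_le)
        show "f ` A \<subseteq> (\<Union>i. C' i)"
          using C(1) by (fastforce simp: C'_def)
        show "diameter (C' i) \<le> \<delta>" for i
        proof -
          have "diameter (C' i) \<le> L * diameter (C i)" using diam by auto
          also have "\<dots> \<le> L * (\<delta> / L)" using C(3) \<open>0 < L\<close> by (intro mult_left_mono) auto
          also have "\<dots> = \<delta>" using \<open>0 < L\<close> by simp
          finally show ?thesis .
        qed
      qed (use diam in auto)
      also have "\<dots> \<le> (\<Sum>i. ennreal (L powr s) * hausdorff_cost s (C i))"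
        by (intro suminf_le cost) auto
      also have "\<dots> \<le> ennreal (L powr s) * (hausdorff_pre s (\<delta> / L) A + ennreal (e / L powr s))"
        using C(4) by (auto intro!: mult_left_mono)
      also have "\<dots> = ennreal (L powr s) * hausdorff_pre s (\<delta> / L) A + e"
        using \<open>0 < e\<close> \<open>0 < L\<close> by (simp add: distrib_left ennreal_mult[symmetric])
      finally show "hausdorff_pre s \<delta> (f ` A) \<le> ennreal (L powr s) * hausdorff_pre s (\<delta> / L) A + e" .
    qed
    also have "\<dots> \<le> ennreal (L powr s) * hausdorff_outer s A"
      using that \<open>0 < L\<close> by (intro mult_left_mono hausdorff_pre_le_outer) auto
    finally show ?thesis .
  qed
  then show ?thesis
    unfolding hausdorff_outer_def[of s "f ` A"] by (intro SUP_least) auto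
qed

text \<open>Translations by \<open>v\<close> and by \<open>- v\<close> are both 1-Lipschitz, which
  gives the two inequalities.\<close>

lemma distr_hausdorff_measure_translation:
  fixes v :: "'a::real_normed_vector"
  assumes "0 < s"
  shows "distr (hausdorff_measure s) borel (\<lambda>y. y + v) = hausdorff_measure s"
proof (rule measure_eqI)
  fix A :: "'a set" assume "A \<in> sets (distr (hausdorff_measure s) borel (\<lambda>y. y + v))"
  then have A: "A \<in> sets borel" by simp
  have le: "hausdorff_outer s ((\<lambda>y. y + w) ` B) \<le> hausdorff_outer s B" for w :: 'a and B
    using hausdorff_outer_lipschitz_image[OF assms, of 1 B "\<lambda>y. y + w"]
    by (auto simp: lipschitz_on_def)
  have m: "(\<lambda>y. y + v) \<in> borel_measurable borel"
    by (intro borel_measurable_continuous_onI continuous_intros)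
  then have vim: "(\<lambda>y. y + v) -` A \<in> sets borel"
    using A by (rule measurable_sets_borel)
  have 1: "(\<lambda>y. y + v) -` A = (\<lambda>y. y + (- v)) ` A"
    by (force simp: image_iff)
  have 2: "A = (\<lambda>y. y + v) ` ((\<lambda>y. y + v) -` A)"
    unfolding 1 by (force simp: image_iff)
  have "hausdorff_outer s ((\<lambda>y. y + v) -` A) = hausdorff_outer s A"
    using le[of "-v" A] le[of v "(\<lambda>y. y + v) -` A"] 1 2 by (metis antisym)
  then show "emeasure (distr (hausdorff_measure s) borel (\<lambda>y. y + v)) A = emeasure (hausdorff_measure s) A"
    using A vim m by (simp add: emeasure_distr emeasure_hausdorff_measure measurable_cong_sets[OF sets_hausdorff_measure refl])
qed simp

text \<open>A covering set that meets \<open>A\<close> lies, within \<open>A\<close>, in a ball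
  around one of its own points of \<open>A\<close> with radius slightly above its diameter. Radius 0
  marks an index whose set misses \<open>A\<close>; its term is forced to be 0 because
  \<open>0 ^ 0 = 1\<close> would make the sum diverge for \<open>m = 0\<close>.\<close>

lemma hausdorff_outer_ball_cover:
  fixes A :: "'a::metric_space set"
  assumes fin: "hausdorff_outer (real m) A < \<infinity>" and "0 < \<delta>" "0 < e"
  shows "\<exists>q r. A \<subseteq> (\<Union>i::nat. ball (q i) (r i)) \<and>
    (\<forall>i. 0 \<le> r i \<and> r i \<le> \<delta> \<and> (0 < r i \<longrightarrow> q i \<in> A)) \<and>
    (\<Sum>i. if 0 < r i then ennreal (r i ^ m) else 0)
      \<le> ennreal (2 ^ m / unit_ball_vol (real m)) * hausdorff_outer (real m) A + ennreal e"
proof -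
  define M where "M = 2 ^ m / unit_ball_vol (real m)"
  have "0 < unit_ball_vol (real m)"
    by (simp add: unit_ball_vol_pos)
  then have "0 < M" and ne: "unit_ball_vol (real m) \<noteq> 0"
    unfolding M_def by (blast intro: divide_pos_pos zero_less_power zero_less_numeral, metis less_irrefl)
  \<comment> \<open>\<open>M\<close> undoes the normalisation of the cost, which uses half the
    diameter and the volume of the unit ball. For \<open>m = 0\<close> both sides are 1.\<close>
  have Mcost: "ennreal M * hausdorff_cost (real m) D = ennreal (diameter D ^ m)" if "D \<noteq> {}" "bounded D" for D :: "'a set"
  proof (cases "m = 0")
    case True
    then show ?thesis using that by (simp add: hausdorff_cost_def M_def)
  next
    case False
    have "M * (unit_ball_vol (real m) * (diameter D / 2) powr (real m)) = diameter D ^ m"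
      using diameter_ge_0[OF \<open>bounded D\<close>] False ne
      by (cases "diameter D = 0") (auto simp: M_def powr_realpow power_divide)
    then show ?thesis
      using False that \<open>0 < M\<close> by (simp add: hausdorff_cost_def ennreal_mult'[symmetric])
  qed
  \<comment> \<open>Diameters up to \<open>\<delta>/2\<close> leave room to enlarge the radii up to
    \<open>\<delta>\<close>. One half of the error \<open>e\<close> is spent here, the other half on
    the enlargement.\<close>
  have "hausdorff_pre (real m) (\<delta>/2) A < hausdorff_outer (real m) A + ennreal (e / 2 / M)"
  proof (rule le_less_trans)
    show "hausdorff_pre (real m) (\<delta>/2) A \<le> hausdorff_outer (real m) A"
      using \<open>0 < \<delta>\<close> by (intro hausdorff_pre_le_outer) auto
    show "hausdorff_outer (real m) A < hausdorff_outer (real m) A + ennreal (e / 2 / M)"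
      using fin \<open>0 < e\<close> \<open>0 < M\<close> by auto
  qed
  then obtain C where C: "A \<subseteq> (\<Union>i. C i)" "\<And>i. bounded (C i)" "\<And>i. diameter (C i) \<le> \<delta>/2"
    "(\<Sum>i. hausdorff_cost (real m) (C i)) < hausdorff_outer (real m) A + ennreal (e / 2 / M)"
    by (metis hausdorff_pre_less_cover)
  have "\<exists>q r. A \<inter> C i \<subseteq> ball q r \<and> 0 \<le> r \<and> r \<le> \<delta> \<and> (0 < r \<longrightarrow> q \<in> A) \<and>
     (if 0 < r then ennreal (r ^ m) else 0) \<le> ennreal M * hausdorff_cost (real m) (C i) + ennreal (e/2 * (1/2)^Suc i)" for i
  proof (cases "A \<inter> C i = {}")
    case True
    then show ?thesis using \<open>0 < \<delta>\<close> by (intro exI[of _ undefined] exI[of _ 0]) auto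
  next
    case False
    then obtain q where q: "q \<in> A" "q \<in> C i" by auto
    define d where "d = diameter (C i)"
    have d: "0 \<le> d" "d \<le> \<delta>/2"
      using C diameter_ge_0 by (auto simp: d_def)
    have "isCont (\<lambda>r. r ^ m) d" by (intro continuous_intros)
    moreover have "0 < e/2 * (1/2)^Suc i" using \<open>0 < e\<close> by auto
    ultimately obtain h where h: "h > 0" "\<And>r. \<bar>r - d\<bar> < h \<Longrightarrow> \<bar>r ^ m - d ^ m\<bar> < e/2 * (1/2)^Suc i"
      unfolding continuous_at_eps_delta dist_real_def by metis
    \<comment> \<open>Since \<open>d \<le> \<delta>/2 < \<delta>\<close>, the radius exceeds
      \<open>d\<close> strictly, so the open ball catches points at distance exactly
      \<open>d\<close>.\<close>
    define r where "r = min \<delta> (d + h/2)"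
    have r: "d < r" "r \<le> \<delta>" "\<bar>r - d\<bar> < h" using d h(1) \<open>0 < \<delta>\<close> by (auto simp: r_def)
    have "r ^ m \<le> d ^ m + e/2 * (1/2)^Suc i" using h(2)[OF r(3)] by linarith
    then have "ennreal (r ^ m) \<le> ennreal (d ^ m) + ennreal (e/2 * (1/2)^Suc i)"
      using d(1) \<open>0 < e\<close> by (subst ennreal_plus[symmetric]) (auto intro!: ennreal_leI simp del: ennreal_plus)
    also have "ennreal (d ^ m) = ennreal M * hausdorff_cost (real m) (C i)"
      unfolding d_def using q(2) C(2) by (subst Mcost) auto
    finally have "ennreal (r ^ m) \<le> ennreal M * hausdorff_cost (real m) (C i) + ennreal (e/2 * (1/2)^Suc i)" .
    moreover have "A \<inter> C i \<subseteq> ball q r"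
    proof
      fix x assume "x \<in> A \<inter> C i"
      then have "dist q x \<le> d" using q(2) C(2) by (auto simp: d_def intro: diameter_bounded_bound)
      then show "x \<in> ball q r" using r(1) by simp
    qed
    ultimately show ?thesis using q(1) r d(1) by (intro exI[of _ q] exI[of _ r]) auto
  qed
  then obtain q r where qr: "\<And>i. A \<inter> C i \<subseteq> ball (q i) (r i)" "\<And>i. 0 \<le> r i" "\<And>i. r i \<le> \<delta>"
    "\<And>i. 0 < r i \<Longrightarrow> q i \<in> A"
    "\<And>i. (if 0 < r i then ennreal (r i ^ m) else 0) \<le> ennreal M * hausdorff_cost (real m) (C i) + ennreal (e/2 * (1/2)^Suc i)"
    by metis
  have "(\<Sum>i. if 0 < r i then ennreal (r i ^ m) else 0) \<le>
      (\<Sum>i. ennreal M * hausdorff_cost (real m) (C i) + ennreal (e/2 * (1/2)^Suc i))"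
    by (intro suminf_le qr(5)) auto
  also have "\<dots> = ennreal M * (\<Sum>i. hausdorff_cost (real m) (C i)) + ennreal (e/2) * (\<Sum>i. ennreal ((1/2)^Suc i))"
    using \<open>0 < e\<close> by (subst suminf_add[symmetric]) (auto simp: ennreal_mult[symmetric] simp flip: ennreal_suminf_cmult)
  also have "(\<Sum>i. ennreal ((1/2)^Suc i)) = 1"
    by (subst suminf_ennreal_eq[OF zero_le_power power_half_series]) auto
  also have "ennreal M * (\<Sum>i. hausdorff_cost (real m) (C i)) + ennreal (e/2) * 1 \<le>
      ennreal M * (hausdorff_outer (real m) A + ennreal (e / 2 / M)) + ennreal (e/2)"
    using C(4) by (auto intro!: add_mono mult_left_mono)
  also have "\<dots> = ennreal M * hausdorff_outer (real m) A + (ennreal (e/2) + ennreal (e/2))"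
    using \<open>0 < M\<close> \<open>0 < e\<close> by (simp add: distrib_left ennreal_mult[symmetric] add.assoc)
  also have "ennreal (e/2) + ennreal (e/2) = ennreal e"
    using \<open>0 < e\<close> by (subst ennreal_plus[symmetric]) auto
  finally have "(\<Sum>i. if 0 < r i then ennreal (r i ^ m) else 0) \<le> ennreal M * hausdorff_outer (real m) A + ennreal e" .
  moreover have "A \<subseteq> (\<Union>i. ball (q i) (r i))"
  proof
    fix x assume "x \<in> A"
    with C(1) obtain i where "x \<in> A \<inter> C i" by auto
    then have "x \<in> ball (q i) (r i)" using qr(1)[of i] by (rule subsetD[rotated])
    then show "x \<in> (\<Union>i. ball (q i) (r i))" by (rule UN_I[OF UNIV_I])
  qed
  ultimately show ?thesis
    unfolding M_def using qr(2-4) by (intro exI[of _ q] exI[of _ r] conjI allI impI) assumption+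
qed

text \<open>The admissible radius depends on the centre: on the stratum \<open>B j\<close> it is at
  most \<open>h j\<close>, and infinitely many strata may be needed. \<open>E\<close> is cut along
  the disjointed strata, each piece is covered at its own scale, and the costs add up because the
  pieces are Borel traces; the errors sum to 1.\<close>

lemma hausdorff_outer_fine_ball_cover:
  fixes E :: "'a::metric_space set" and B :: "nat \<Rightarrow> 'a set"
  assumes fin: "hausdorff_outer (real m) E < \<infinity>" and B: "\<And>j. B j \<in> sets borel" "E \<subseteq> (\<Union>j. B j)"
    and h: "\<And>j. 0 < h j" and "0 < \<delta>"
  shows "\<exists>q r. E \<subseteq> (\<Union>i::nat. ball (q i) (r i)) \<and>
    (\<forall>i. 0 \<le> r i \<and> r i \<le> \<delta> \<and> (0 < r i \<longrightarrow> q i \<in> E \<and> (\<exists>j. q i \<in> B j \<and> r i \<le> h j))) \<and>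
    (\<Sum>i. if 0 < r i then ennreal (r i ^ m) else 0)
      \<le> ennreal (2 ^ m / unit_ball_vol (real m)) * hausdorff_outer (real m) E + 1"
proof -
  define M where "M = ennreal (2 ^ m / unit_ball_vol (real m))"
  define P where "P = disjointed B"
  have P: "P j \<in> sets borel" "P j \<subseteq> B j" for j
    using B(1) by (auto simp: P_def disjointed_def)
  have dP: "disjoint_family P" "(\<Union>j. P j) = (\<Union>j. B j)"
    by (auto simp: P_def disjoint_family_disjointed UN_disjointed_eq)
  have "hausdorff_outer (real m) (E \<inter> P j) < \<infinity>" for j
    using fin hausdorff_outer_mono[of "E \<inter> P j" E "real m"] by (auto intro: le_less_trans)
  moreover define Q where "Q j q r \<longleftrightarrow> E \<inter> P j \<subseteq> (\<Union>i::nat. ball (q i) (r i)) \<and>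
    (\<forall>i. 0 \<le> r i \<and> r i \<le> min \<delta> (h j) \<and> (0 < r i \<longrightarrow> q i \<in> E \<inter> P j)) \<and>
    (\<Sum>i. if 0 < r i then ennreal (r i ^ m) else 0)
      \<le> M * hausdorff_outer (real m) (E \<inter> P j) + ennreal ((1/2)^Suc j)" for j q r
  ultimately have "\<exists>q r. Q j q r" for j
    unfolding M_def Q_def using h \<open>0 < \<delta>\<close> by (intro hausdorff_outer_ball_cover) auto
  then obtain q r where "\<And>j. Q j (q j) (r j)"
    by metis
  then have qr: "\<And>j. E \<inter> P j \<subseteq> (\<Union>i::nat. ball (q j i) (r j i))"
    "\<And>j i. 0 \<le> r j i" "\<And>j i. r j i \<le> min \<delta> (h j)" "\<And>j i. 0 < r j i \<Longrightarrow> q j i \<in> E \<inter> P j"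
    "\<And>j. (\<Sum>i. if 0 < r j i then ennreal (r j i ^ m) else 0)
      \<le> M * hausdorff_outer (real m) (E \<inter> P j) + ennreal ((1/2)^Suc j)"
    unfolding Q_def by simp_all
  define q' r' where "q' k = case_prod q (prod_decode k)" and "r' k = case_prod r (prod_decode k)" for k
  have "(\<Sum>k. if 0 < r' k then ennreal (r' k ^ m) else 0) =
      (\<Sum>k. (\<lambda>(j, i). if 0 < r j i then ennreal (r j i ^ m) else 0) (prod_decode k))"
    unfolding r'_def split_def ..
  also have "\<dots> = (\<Sum>j. \<Sum>i. if 0 < r j i then ennreal (r j i ^ m) else 0)"
    by (intro suminf_ennreal_2dimen) simp
  also have "\<dots> \<le> (\<Sum>j. M * hausdorff_outer (real m) (E \<inter> P j) + ennreal ((1/2)^Suc j))"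
    by (intro suminf_le qr(5)) auto
  also have "\<dots> = M * (\<Sum>j. hausdorff_outer (real m) (E \<inter> P j)) + (\<Sum>j. ennreal ((1/2)^Suc j))"
    by (subst suminf_add[symmetric]) (auto simp flip: ennreal_suminf_cmult)
  also have "(\<Sum>j. ennreal ((1/2)^Suc j)) = 1"
    by (subst suminf_ennreal_eq[OF zero_le_power power_half_series]) auto
  also have "M * (\<Sum>j. hausdorff_outer (real m) (E \<inter> P j)) + 1 \<le> M * hausdorff_outer (real m) E + 1"
    using P(1) dP(1) by (intro add_right_mono mult_left_mono hausdorff_outer_disjoint_Borel_pieces) auto
  finally have sum: "(\<Sum>k. if 0 < r' k then ennreal (r' k ^ m) else 0) \<le> M * hausdorff_outer (real m) E + 1" .
  have "E \<subseteq> (\<Union>k. ball (q' k) (r' k))"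
  proof
    fix x assume "x \<in> E"
    then obtain j i where "x \<in> ball (q j i) (r j i)"
      using B(2) dP(2) qr(1) by blast
    then have "x \<in> ball (q' (prod_encode (j, i))) (r' (prod_encode (j, i)))"
      by (simp add: q'_def r'_def)
    then show "x \<in> (\<Union>k. ball (q' k) (r' k))" by blast
  qed
  moreover have "0 \<le> r' k \<and> r' k \<le> \<delta> \<and> (0 < r' k \<longrightarrow> q' k \<in> E \<and> (\<exists>j. q' k \<in> B j \<and> r' k \<le> h j))" for k
  proof -
    obtain j i where ji: "prod_decode k = (j, i)" by force
    show ?thesis
      using qr(2,3,4)[of j i] P(2)[of j] by (auto simp: q'_def r'_def ji)
  qed
  ultimately show ?thesis
    using sum unfolding M_def by blast
qed

section \<open>Cutoff functions\<close>

text \<open>For \<open>r = 0\<close> the division makes \<open>bump q r\<close> vanish; radius \<open>0\<close> marks an unused index of a cover.\<close>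

definition bump :: "'a::euclidean_space \<Rightarrow> real \<Rightarrow> 'a \<Rightarrow> real" where
  "bump q r x = max 0 (4 * r\<^sup>2 - (x - q) \<bullet> (x - q)) / (4 * r\<^sup>2)"

lemma bump_nonneg: "0 \<le> bump q r x"
  by (simp add: bump_def)

lemma bump_le_1: "bump q r x \<le> 1"
  by (auto simp: bump_def divide_le_eq_1 max_def)

lemma bump_eq_0:
  assumes "0 \<le> r" "x \<notin> ball q (2 * r)"
  shows "bump q r x = 0"
proof -
  have "(2 * r)\<^sup>2 \<le> (norm (x - q))\<^sup>2"
    using assms by (intro power_mono) (auto simp: dist_norm norm_minus_commute)
  then show ?thesis
    by (simp add: bump_def power_mult_distrib power2_norm_eq_inner)
qed

lemma bump_ge:
  assumes "x \<in> ball q r"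
  shows "3 / 4 \<le> bump q r x"
proof -
  have "0 < r" using assms by (metis ball_eq_empty empty_iff not_le)
  have "(norm (x - q))\<^sup>2 \<le> r\<^sup>2"
    using assms by (intro power_mono) (auto simp: dist_norm norm_minus_commute)
  then have "3 * r\<^sup>2 \<le> 4 * r\<^sup>2 - (x - q) \<bullet> (x - q)"
    by (simp add: power2_norm_eq_inner)
  then show ?thesis
    using \<open>0 < r\<close> by (simp add: bump_def pos_le_divide_eq)
qed

lemma continuous_bump: "continuous_on S (bump q r)"
  unfolding bump_def by (cases "r = 0") (auto intro!: continuous_intros)

text \<open>The positive part has a corner at 0 that squaring removes. This is why the cutoffs are
  built from squares of bumps.\<close>

lemma DERIV_max_0_power2: "((\<lambda>t::real. (max 0 t)\<^sup>2) has_field_derivative 2 * max 0 t) (at t)"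
proof -
  consider "t < 0" | "t = 0" | "0 < t" by linarith
  then show ?thesis
  proof cases
    case 1
    have "((\<lambda>t::real. 0) has_field_derivative 0) (at t)" by simp
    then have "((\<lambda>t::real. (max 0 t)\<^sup>2) has_field_derivative 0) (at t)"
      by (rule has_field_derivative_transform_within_open[where S = "{..<0}"]) (use 1 in auto)
    then show ?thesis using 1 by simp
  next
    case 2
    have "((\<lambda>h::real. (max 0 h)\<^sup>2 / h) \<longlongrightarrow> 0) (at 0)"
    proof (rule Lim_null_comparison)
      show "\<forall>\<^sub>F h::real in at 0. norm ((max 0 h)\<^sup>2 / h) \<le> \<bar>h\<bar>"
        by (intro always_eventually) (auto simp: max_def power2_eq_square)
      show "((\<lambda>h::real. \<bar>h\<bar>) \<longlongrightarrow> 0) (at 0)"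
        by (intro tendsto_eq_intros) auto
    qed
    then show ?thesis using 2 by (simp add: DERIV_def)
  next
    case 3
    have "((\<lambda>t::real. t\<^sup>2) has_field_derivative 2 * t) (at t)"
      by (auto intro!: derivative_eq_intros)
    then have "((\<lambda>t::real. (max 0 t)\<^sup>2) has_field_derivative 2 * t) (at t)"
      by (rule has_field_derivative_transform_within_open[where S = "{0<..}"]) (use 3 in auto)
    then show ?thesis using 3 by simp
  qed
qed

lemma GDERIV_bump_power2: "GDERIV (\<lambda>x. (bump q r x)\<^sup>2) x :> (- bump q r x / r\<^sup>2) *\<^sub>R (x - q)"
proof (cases "r = 0")
  case True
  then show ?thesis by (simp add: bump_def GDERIV_const)
next
  case False
  have "GDERIV (\<lambda>x. 4 * r\<^sup>2 - (x - q) \<bullet> (x - q)) x :> (-2) *\<^sub>R (x - q)"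
    unfolding gderiv_def by (auto intro!: derivative_eq_intros simp: inner_commute)
  then have "GDERIV (\<lambda>x. (max 0 (4 * r\<^sup>2 - (x - q) \<bullet> (x - q)))\<^sup>2) x :>
      (2 * max 0 (4 * r\<^sup>2 - (x - q) \<bullet> (x - q))) *\<^sub>R (-2) *\<^sub>R (x - q)"
    by (rule GDERIV_DERIV_compose) (rule DERIV_max_0_power2)
  then have "GDERIV (\<lambda>x. (max 0 (4 * r\<^sup>2 - (x - q) \<bullet> (x - q)))\<^sup>2 / (4 * r\<^sup>2)\<^sup>2) x :>
      (1 / (4 * r\<^sup>2)\<^sup>2) *\<^sub>R (2 * max 0 (4 * r\<^sup>2 - (x - q) \<bullet> (x - q))) *\<^sub>R (-2) *\<^sub>R (x - q)"
    by (rule GDERIV_DERIV_compose) (rule DERIV_cdivide[OF DERIV_ident])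
  moreover have "1 / (4 * c)\<^sup>2 * (2 * m * (-2)) = - (m / (4 * c)) / c" if "c \<noteq> 0" for m c :: real
    using that by (simp add: divide_simps power2_eq_square)
  then have "1 / (4 * r\<^sup>2)\<^sup>2 * (2 * m * (-2)) = - (m / (4 * r\<^sup>2)) / r\<^sup>2" for m
    using False by (metis power_not_zero)
  ultimately show ?thesis
    unfolding bump_def[abs_def] power_divide scaleR_scaleR by (metis (no_types, lifting) mult.assoc)
qed

text \<open>
  A smooth substitute for the supremum of the bumps: it stays continuously differentiable, and
  Cauchy-Schwarz still bounds the square of its gradient by the sum over the individual balls.
\<close>

definition cutoff :: "(nat \<Rightarrow> 'a::euclidean_space) \<Rightarrow> (nat \<Rightarrow> real) \<Rightarrow> nat \<Rightarrow> 'a \<Rightarrow> real" where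
  "cutoff q r k x = 4 * (sqrt (1 + (\<Sum>i<k. (bump (q i) (r i) x)\<^sup>2)) - 1)"

definition cutoff_grad :: "(nat \<Rightarrow> 'a::euclidean_space) \<Rightarrow> (nat \<Rightarrow> real) \<Rightarrow> nat \<Rightarrow> 'a \<Rightarrow> 'a" where
  "cutoff_grad q r k x = (2 / sqrt (1 + (\<Sum>i<k. (bump (q i) (r i) x)\<^sup>2))) *\<^sub>R
     (\<Sum>i<k. (- bump (q i) (r i) x / (r i)\<^sup>2) *\<^sub>R (x - q i))"

lemma bump_sum_nonneg: "0 \<le> (\<Sum>i<k. (bump (q i) (r i) x)\<^sup>2)"
  by (intro sum_nonneg) auto

text \<open>The summand 1 keeps the argument of the root away from 0, where the root is not
  differentiable.\<close>

lemma GDERIV_cutoff: "GDERIV (cutoff q r k) x :> cutoff_grad q r k x"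
proof -
  have "GDERIV (\<lambda>x. \<Sum>i<k. (bump (q i) (r i) x)\<^sup>2) x :> (\<Sum>i<k. (- bump (q i) (r i) x / (r i)\<^sup>2) *\<^sub>R (x - q i))"
  proof (induction k)
    case (Suc k)
    then show ?case by (simp only: sum.lessThan_Suc) (intro GDERIV_add GDERIV_bump_power2)
  qed (simp add: GDERIV_const)
  then have "GDERIV (\<lambda>x. 4 * (sqrt (1 + (\<Sum>i<k. (bump (q i) (r i) x)\<^sup>2)) - 1)) x :> cutoff_grad q r k x"
    unfolding cutoff_grad_def
  proof (rule GDERIV_DERIV_compose)
    show "((\<lambda>t. 4 * (sqrt (1 + t) - 1)) has_real_derivative 2 / sqrt (1 + (\<Sum>i<k. (bump (q i) (r i) x)\<^sup>2)))
       (at (\<Sum>i<k. (bump (q i) (r i) x)\<^sup>2))"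
      using bump_sum_nonneg[of q r x k]
      by (auto intro!: derivative_eq_intros simp: field_simps)
  qed
  then show ?thesis
    by (simp add: cutoff_def[abs_def])
qed

lemma continuous_cutoff_grad: "continuous_on S (cutoff_grad q r k)"
proof -
  have "1 + (\<Sum>i<k. (bump (q i) (r i) x)\<^sup>2) \<noteq> 0" for x
    using bump_sum_nonneg[of q r x k] by linarith
  then show ?thesis
    unfolding cutoff_grad_def divide_inverse
    by (intro continuous_intros continuous_bump) auto
qed

lemma cutoff_nonneg: "0 \<le> cutoff q r k x"
  using bump_sum_nonneg[of q r x k] by (simp add: cutoff_def)

text \<open>Here the constants fit together: doubling the radius makes the bump at least 3/4 on the
  ball itself, the root of 1 + 9/16 is 5/4, and the factor 4 in \<open>cutoff\<close> turns the
  excess 1/4 into 1.\<close>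

lemma cutoff_ge_1:
  assumes "x \<in> ball (q i) (r i)" "i < k"
  shows "1 \<le> cutoff q r k x"
proof -
  have "(3 / 4)\<^sup>2 \<le> (bump (q i) (r i) x)\<^sup>2"
    using bump_ge[OF assms(1)] by (intro power_mono) auto
  also have "\<dots> \<le> (\<Sum>i<k. (bump (q i) (r i) x)\<^sup>2)"
    using assms(2) by (intro member_le_sum) auto
  finally have "(5 / 4)\<^sup>2 \<le> 1 + (\<Sum>i<k. (bump (q i) (r i) x)\<^sup>2)"
    by (simp add: power2_eq_square)
  then have "5 / 4 \<le> sqrt (1 + (\<Sum>i<k. (bump (q i) (r i) x)\<^sup>2))"
    by (rule real_le_rsqrt)
  then show ?thesis
    by (simp add: cutoff_def)
qed

text \<open>The root of 1 + T exceeds 1 by at most the root of T. The bound is meant for the square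
  integrability of the function, next to that of its gradient.\<close>

lemma cutoff_power2_le:
  assumes "\<And>i. 0 \<le> r i"
  shows "(cutoff q r k x)\<^sup>2 \<le> (\<Sum>i<k. 16 * indicator (ball (q i) (2 * r i)) x)"
proof -
  define T where "T = (\<Sum>i<k. (bump (q i) (r i) x)\<^sup>2)"
  have "0 \<le> T" by (simp add: T_def bump_sum_nonneg)
  have "sqrt (1 + T) \<le> 1 + sqrt T"
    using sqrt_add_le_add_sqrt[of 1 T] \<open>0 \<le> T\<close> by simp
  then have "(cutoff q r k x)\<^sup>2 \<le> (4 * sqrt T)\<^sup>2"
    using cutoff_nonneg[of q r k x] by (intro power_mono) (auto simp: cutoff_def T_def)
  also have "\<dots> = 16 * T"
    using \<open>0 \<le> T\<close> by (simp add: power_mult_distrib)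
  also have "\<dots> = (\<Sum>i<k. 16 * (bump (q i) (r i) x)\<^sup>2)"
    by (simp add: T_def sum_distrib_left)
  also have "\<dots> \<le> (\<Sum>i<k. 16 * indicator (ball (q i) (2 * r i)) x)"
    using assms bump_eq_0[of "r _" x "q _"]
    by (intro sum_mono) (auto simp: indicator_def power_le_one bump_nonneg bump_le_1 split: if_splits)
  finally show ?thesis .
qed

text \<open>On the doubled ball \<open>norm (x - q i)\<close> is at most \<open>2 * r i\<close>, so
  the i-th summand has norm at most \<open>s i * c i\<close>. Cauchy-Schwarz produces the factor
  \<open>T\<close>, which the prefactor 4/(1+T) absorbs; thus the constant 16 = 4 * 4 does not
  depend on how many balls overlap.\<close>

lemma norm_cutoff_grad_power2_le:
  assumes "\<And>i. 0 \<le> r i"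
  shows "(norm (cutoff_grad q r k x))\<^sup>2 \<le> (\<Sum>i<k. 16 / (r i)\<^sup>2 * indicator (ball (q i) (2 * r i)) x)"
proof -
  define s where "s i = bump (q i) (r i) x" for i
  define c where "c i = 2 / r i * indicator (ball (q i) (2 * r i)) x" for i
  define T where "T = (\<Sum>i<k. (s i)\<^sup>2)"
  have "0 \<le> T" by (simp add: T_def s_def bump_sum_nonneg)
  have "norm (\<Sum>i<k. (- s i / (r i)\<^sup>2) *\<^sub>R (x - q i)) \<le> (\<Sum>i<k. s i * c i)"
  proof (rule sum_norm_le)
    fix i
    show "norm ((- s i / (r i)\<^sup>2) *\<^sub>R (x - q i)) \<le> s i * c i"
    proof (cases "x \<in> ball (q i) (2 * r i)")
      case True
      then have pos: "0 < r i" by (metis ball_eq_empty empty_iff not_le mult_le_0_iff zero_le_numeral)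
      have "norm (x - q i) \<le> 2 * r i"
        using True by (simp add: dist_norm norm_minus_commute)
      then have "s i / (r i)\<^sup>2 * norm (x - q i) \<le> s i / (r i)\<^sup>2 * (2 * r i)"
        by (intro mult_left_mono) (auto simp: s_def bump_nonneg)
      also have "\<dots> = s i * c i"
        using True pos by (simp add: c_def power2_eq_square)
      finally show ?thesis
        using bump_nonneg[of "q i" "r i" x] by (simp add: s_def)
    next
      case False
      then show ?thesis
        using bump_eq_0[OF assms False] by (simp add: s_def c_def)
    qed
  qed
  then have "(norm (\<Sum>i<k. (- s i / (r i)\<^sup>2) *\<^sub>R (x - q i)))\<^sup>2 \<le> (\<Sum>i<k. s i * c i)\<^sup>2"
    by (intro power_mono) auto
  also have "\<dots> \<le> T * (\<Sum>i<k. (c i)\<^sup>2)"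
    unfolding T_def by (rule Cauchy_Schwarz_ineq_sum)
  finally have "(norm (cutoff_grad q r k x))\<^sup>2 \<le> (2 / sqrt (1 + T))\<^sup>2 * (T * (\<Sum>i<k. (c i)\<^sup>2))"
    unfolding cutoff_grad_def norm_scaleR power_mult_distrib power2_abs s_def[symmetric] T_def[symmetric]
    by (rule mult_left_mono) auto
  also have "\<dots> = 4 * (T / (1 + T)) * (\<Sum>i<k. (c i)\<^sup>2)"
    using \<open>0 \<le> T\<close> by (simp add: power_divide)
  also have "\<dots> \<le> 4 * 1 * (\<Sum>i<k. (c i)\<^sup>2)"
    using \<open>0 \<le> T\<close> by (intro mult_right_mono mult_left_mono sum_nonneg) (auto simp: divide_le_eq_1)
  also have "\<dots> = (\<Sum>i<k. 16 / (r i)\<^sup>2 * indicator (ball (q i) (2 * r i)) x)"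
    unfolding sum_distrib_left mult_1_right
    by (intro sum.cong) (auto simp: c_def indicator_def power_divide)
  finally show ?thesis .
qed

section \<open>Limits of continuously differentiable functions\<close>

text \<open>
  Strong approximability by functions on the ambient space is all that is needed here of the
  Sobolev space; \<open>D\<close> is the limit of the ambient gradients, not yet projected to the tangent spaces.
\<close>

definition C1_approx :: "'a::euclidean_space measure \<Rightarrow> ('a \<Rightarrow> real) \<Rightarrow> ('a \<Rightarrow> 'a) \<Rightarrow>
    (nat \<Rightarrow> 'a \<Rightarrow> real) \<Rightarrow> (nat \<Rightarrow> 'a \<Rightarrow> 'a) \<Rightarrow> ('a \<Rightarrow> real) \<Rightarrow> bool" where
  "C1_approx M f D u g b \<longleftrightarrow> f \<in> borel_measurable borel \<and> D \<in> borel_measurable borel \<and>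
     (\<forall>k. continuous_on UNIV (g k)) \<and> (\<forall>k x. GDERIV (u k) x :> g k x) \<and>
     b \<in> borel_measurable borel \<and> (\<integral>\<^sup>+x. ennreal ((b x)\<^sup>2) \<partial>M) < \<infinity> \<and>
     (AE x in M. (\<forall>k. \<bar>u k x\<bar> \<le> b x \<and> norm (g k x) \<le> b x) \<and>
        (\<lambda>k. u k x) \<longlonglongrightarrow> f x \<and> (\<lambda>k. g k x) \<longlonglongrightarrow> D x)"

definition C1_limit :: "'a::euclidean_space measure \<Rightarrow> ('a \<Rightarrow> real) \<Rightarrow> ('a \<Rightarrow> 'a) \<Rightarrow> bool" where
  "C1_limit M f D \<longleftrightarrow> (\<exists>u g b. C1_approx M f D u g b)"

lemma C1_approxD:
  assumes "C1_approx M f D u g b"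
  shows "f \<in> borel_measurable borel" "D \<in> borel_measurable borel"
    "\<And>k. continuous_on UNIV (g k)" "\<And>k x. GDERIV (u k) x :> g k x"
    "b \<in> borel_measurable borel" "(\<integral>\<^sup>+x. ennreal ((b x)\<^sup>2) \<partial>M) < \<infinity>"
    "AE x in M. (\<forall>k. \<bar>u k x\<bar> \<le> b x \<and> norm (g k x) \<le> b x) \<and>
       (\<lambda>k. u k x) \<longlonglongrightarrow> f x \<and> (\<lambda>k. g k x) \<longlonglongrightarrow> D x"
  using assms unfolding C1_approx_def by auto

lemma C1_limit_zero: "C1_limit M (\<lambda>_. 0) (\<lambda>_. 0)"
proof -
  have "C1_approx M (\<lambda>_. 0) (\<lambda>_. 0) (\<lambda>_ _. 0) (\<lambda>_ _. 0) (\<lambda>_. 0)"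
    by (simp add: C1_approx_def GDERIV_const)
  then show ?thesis unfolding C1_limit_def by blast
qed

lemma nn_integral_power2_add_finite:
  fixes b b' :: "'a \<Rightarrow> real"
  assumes [measurable]: "b \<in> borel_measurable M" "b' \<in> borel_measurable M"
    and "(\<integral>\<^sup>+x. ennreal ((b x)\<^sup>2) \<partial>M) < \<infinity>" "(\<integral>\<^sup>+x. ennreal ((b' x)\<^sup>2) \<partial>M) < \<infinity>"
  shows "(\<integral>\<^sup>+x. ennreal ((b x + b' x)\<^sup>2) \<partial>M) < \<infinity>"
proof -
  have "(\<integral>\<^sup>+x. ennreal ((b x + b' x)\<^sup>2) \<partial>M) \<le> (\<integral>\<^sup>+x. 2 * ennreal ((b x)\<^sup>2) + 2 * ennreal ((b' x)\<^sup>2) \<partial>M)"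
  proof (rule nn_integral_mono)
    fix x
    have "(b x + b' x)\<^sup>2 \<le> 2 * (b x)\<^sup>2 + 2 * (b' x)\<^sup>2"
      using zero_le_power2[of "b x - b' x"] by (simp add: power2_sum power2_diff)
    then have "ennreal ((b x + b' x)\<^sup>2) \<le> ennreal (2 * (b x)\<^sup>2 + 2 * (b' x)\<^sup>2)"
      by (rule ennreal_leI)
    then show "ennreal ((b x + b' x)\<^sup>2) \<le> 2 * ennreal ((b x)\<^sup>2) + 2 * ennreal ((b' x)\<^sup>2)"
      by (simp add: ennreal_plus ennreal_mult)
  qed
  also have "\<dots> = 2 * (\<integral>\<^sup>+x. ennreal ((b x)\<^sup>2) \<partial>M) + 2 * (\<integral>\<^sup>+x. ennreal ((b' x)\<^sup>2) \<partial>M)"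
    by (simp add: nn_integral_add nn_integral_cmult)
  also have "\<dots> < \<infinity>"
    using assms(3,4) by (simp add: ennreal_mult_less_top)
  finally show ?thesis .
qed

lemma C1_limit_add:
  assumes M: "sets M = sets borel" and f: "C1_limit M f D" and f': "C1_limit M f' D'"
  shows "C1_limit M (\<lambda>x. f x + f' x) (\<lambda>x. D x + D' x)"
proof -
  have meas: "borel_measurable M = borel_measurable borel"
    by (rule measurable_cong_sets[OF M refl])
  obtain u g b where "C1_approx M f D u g b"
    using f unfolding C1_limit_def by blast
  note u = C1_approxD[OF this]
  obtain u' g' b' where "C1_approx M f' D' u' g' b'"
    using f' unfolding C1_limit_def by blast
  note u' = C1_approxD[OF this]
  have "AE x in M. (\<forall>k. \<bar>u k x + u' k x\<bar> \<le> b x + b' x \<and> norm (g k x + g' k x) \<le> b x + b' x) \<and>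
      (\<lambda>k. u k x + u' k x) \<longlonglongrightarrow> f x + f' x \<and> (\<lambda>k. g k x + g' k x) \<longlonglongrightarrow> D x + D' x"
    using u(7) u'(7)
  proof eventually_elim
    case (elim x)
    then show ?case
      by (auto intro!: tendsto_add intro: order_trans[OF abs_triangle_ineq add_mono] norm_triangle_mono)
  qed
  moreover have "(\<integral>\<^sup>+x. ennreal ((b x + b' x)\<^sup>2) \<partial>M) < \<infinity>"
    using u(5,6) u'(5,6) by (intro nn_integral_power2_add_finite) (auto simp: meas)
  ultimately show ?thesis
    unfolding C1_limit_def
    by (intro exI[of _ "\<lambda>k x. u k x + u' k x"] exI[of _ "\<lambda>k x. g k x + g' k x"] exI[of _ "\<lambda>x. b x + b' x"])
      (use u(1-5) u'(1-5) in \<open>auto simp: C1_approx_def intro!: continuous_on_add GDERIV_add\<close>)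
qed

lemma C1_limit_scale:
  assumes M: "sets M = sets borel" and f: "C1_limit M f D"
  shows "C1_limit M (\<lambda>x. c * f x) (\<lambda>x. c *\<^sub>R D x)"
proof -
  have meas: "borel_measurable M = borel_measurable borel"
    by (rule measurable_cong_sets[OF M refl])
  obtain u g b where "C1_approx M f D u g b"
    using f unfolding C1_limit_def by blast
  note u = C1_approxD[OF this]
  have "AE x in M. (\<forall>k. \<bar>c * u k x\<bar> \<le> \<bar>c\<bar> * b x \<and> norm (c *\<^sub>R g k x) \<le> \<bar>c\<bar> * b x) \<and>
      (\<lambda>k. c * u k x) \<longlonglongrightarrow> c * f x \<and> (\<lambda>k. c *\<^sub>R g k x) \<longlonglongrightarrow> c *\<^sub>R D x"
    using u(7)
  proof eventually_elim
    case (elim x)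
    then show ?case
      by (auto intro!: tendsto_intros mult_left_mono simp: abs_mult)
  qed
  moreover have "(\<integral>\<^sup>+x. ennreal ((\<bar>c\<bar> * b x)\<^sup>2) \<partial>M) < \<infinity>"
  proof -
    have "(\<integral>\<^sup>+x. ennreal ((\<bar>c\<bar> * b x)\<^sup>2) \<partial>M) = ennreal (c\<^sup>2) * (\<integral>\<^sup>+x. ennreal ((b x)\<^sup>2) \<partial>M)"
      using u(5) by (subst nn_integral_cmult[symmetric])
        (auto simp: meas power_mult_distrib ennreal_mult intro!: nn_integral_cong)
    also have "\<dots> < \<infinity>"
      using u(6) by (simp add: ennreal_mult_less_top)
    finally show ?thesis .
  qed
  moreover have "GDERIV (\<lambda>x. c * u k x) x :> c *\<^sub>R g k x" for k x
    by (rule GDERIV_DERIV_compose[OF u(4)]) (rule DERIV_cmult_Id)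
  ultimately show ?thesis
    unfolding C1_limit_def
    by (intro exI[of _ "\<lambda>k x. c * u k x"] exI[of _ "\<lambda>k x. c *\<^sub>R g k x"] exI[of _ "\<lambda>x. \<bar>c\<bar> * b x"])
      (use u(1-3,5) in \<open>auto simp: C1_approx_def intro!: continuous_on_scaleR continuous_on_const\<close>)
qed

section \<open>Cutoffs of infinite covers and their superposition\<close>

lemma ennreal_sum_le_suminf:
  fixes a :: "nat \<Rightarrow> real"
  assumes "\<And>i. 0 \<le> a i"
  shows "ennreal (\<Sum>i<k. a i) \<le> (\<Sum>i. ennreal (a i))"
proof -
  have "(\<Sum>i<k. ennreal (a i)) \<le> (\<Sum>i. ennreal (a i))"
    by (rule sum_le_suminf) (rule summableI, simp, rule zero_le)
  then show ?thesis
    by (subst sum_ennreal[symmetric]) (rule assms)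
qed

lemma sum_lessThan_stable:
  fixes h :: "nat \<Rightarrow> 'b::comm_monoid_add"
  assumes "K \<le> k" "\<And>i. K \<le> i \<Longrightarrow> h i = 0"
  shows "sum h {..<k} = sum h {..<K}"
  using assms by (intro sum.mono_neutral_right) auto

text \<open>A Borel-Cantelli argument: finiteness of the weighted sum implies that almost every
  point lies in only finitely many doubled balls. There the partial cutoffs and their gradients are
  eventually constant, and the root of the full sum of bounds dominates them all.\<close>

lemma C1_limit_cutoff:
  fixes q :: "nat \<Rightarrow> 'a::euclidean_space"
  assumes M: "sets M = sets borel" and r: "\<And>i. 0 \<le> r i" "\<And>i. r i \<le> 1"
    and fin: "(\<Sum>i. ennreal (1 / (r i)\<^sup>2) * emeasure M (ball (q i) (2 * r i))) < \<infinity>"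
  shows "\<exists>F D. C1_limit M F D \<and> (\<forall>x. 0 \<le> F x) \<and> (\<forall>x\<in>(\<Union>i. ball (q i) (r i)). 1 \<le> F x) \<and>
    (\<forall>x. x \<notin> (\<Union>i. ball (q i) (2 * r i)) \<longrightarrow> D x = 0) \<and>
    (\<integral>\<^sup>+x. ennreal ((norm (D x))\<^sup>2) \<partial>M) \<le> 16 * (\<Sum>i. ennreal (1 / (r i)\<^sup>2) * emeasure M (ball (q i) (2 * r i)))"
proof -
  have meas [simp]: "borel_measurable M = borel_measurable borel"
    by (rule measurable_cong_sets[OF M refl])
  note M [measurable_cong]
  have [measurable]: "ball (q i) (2 * r i) \<in> sets borel" for i
    by simp
  define a where "a i x = 16 / (r i)\<^sup>2 * indicator (ball (q i) (2 * r i)) x" for i x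
  \<comment> \<open>The first summand bounds the square of the cutoff, the second the square of its
    gradient, so one series controls both.\<close>
  define c where "c i x = 16 * indicator (ball (q i) (2 * r i)) x + a i x" for i x
  define \<beta> where "\<beta> x = (\<Sum>i. ennreal (c i x))" for x
  define b where "b x = sqrt (enn2real (\<beta> x))" for x
  have [measurable]: "a i \<in> borel_measurable borel" "c i \<in> borel_measurable borel" for i
    unfolding a_def[abs_def] c_def[abs_def] by measurable
  have [measurable]: "\<beta> \<in> borel_measurable borel" "b \<in> borel_measurable borel"
    unfolding \<beta>_def[abs_def] b_def[abs_def] by measurable
  have a0: "0 \<le> a i x" and ac: "a i x \<le> c i x" and c0: "0 \<le> c i x" for i x
    by (auto simp: a_def c_def)
  have int_a: "(\<integral>\<^sup>+x. (\<Sum>i. ennreal (a i x)) \<partial>M) = 16 * (\<Sum>i. ennreal (1 / (r i)\<^sup>2) * emeasure M (ball (q i) (2 * r i)))"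
  proof -
    have "(\<integral>\<^sup>+x. (\<Sum>i. ennreal (a i x)) \<partial>M) = (\<Sum>i. \<integral>\<^sup>+x. ennreal (a i x) \<partial>M)"
      by (intro nn_integral_suminf) simp
    also have "\<dots> = (\<Sum>i. 16 * (ennreal (1 / (r i)\<^sup>2) * emeasure M (ball (q i) (2 * r i))))"
    proof (rule suminf_cong)
      fix i
      have "(\<integral>\<^sup>+x. ennreal (a i x) \<partial>M) = (\<integral>\<^sup>+x. ennreal (16 / (r i)\<^sup>2) * indicator (ball (q i) (2 * r i)) x \<partial>M)"
        by (intro nn_integral_cong) (auto simp: a_def indicator_def)
      also have "\<dots> = ennreal (16 / (r i)\<^sup>2) * emeasure M (ball (q i) (2 * r i))"
        by (subst nn_integral_cmult_indicator) auto
      also have "ennreal (16 / (r i)\<^sup>2) = 16 * ennreal (1 / (r i)\<^sup>2)"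
        using ennreal_mult[of 16 "1 / (r i)\<^sup>2"] by simp
      finally show "(\<integral>\<^sup>+x. ennreal (a i x) \<partial>M) = 16 * (ennreal (1 / (r i)\<^sup>2) * emeasure M (ball (q i) (2 * r i)))"
        by (simp add: mult.assoc)
    qed
    finally show ?thesis by simp
  qed
  \<comment> \<open>Radii at most 1 give 16 \<le> 16/\<open>(r i)\<^sup>2\<close> on the ball, so
    the bound for the gradient also pays for the function. For radius 0 both sides vanish.\<close>
  have c2: "c i x \<le> 2 * a i x" for i x
  proof (cases "x \<in> ball (q i) (2 * r i)")
    case True
    then have "0 < r i" by (metis ball_eq_empty empty_iff not_le mult_le_0_iff zero_le_numeral)
    then have "(r i)\<^sup>2 \<le> 1" "0 < (r i)\<^sup>2" using r(2) by (auto simp: power_le_one)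
    then have "1 \<le> 1 / (r i)\<^sup>2" by simp
    then show ?thesis using True by (simp add: c_def a_def)
  qed (simp add: c_def a_def)
  have "(\<integral>\<^sup>+x. \<beta> x \<partial>M) \<le> (\<integral>\<^sup>+x. 2 * (\<Sum>i. ennreal (a i x)) \<partial>M)"
  proof (intro nn_integral_mono)
    fix x
    have "\<beta> x \<le> (\<Sum>i. 2 * ennreal (a i x))"
      unfolding \<beta>_def
    proof (intro suminf_le)
      fix i
      have "ennreal (c i x) \<le> ennreal (2 * a i x)" by (intro ennreal_leI c2)
      also have "\<dots> = 2 * ennreal (a i x)" using a0 by (simp add: ennreal_mult)
      finally show "ennreal (c i x) \<le> 2 * ennreal (a i x)" .
    qed auto
    then show "\<beta> x \<le> 2 * (\<Sum>i. ennreal (a i x))" by simp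
  qed
  also have "\<dots> = 2 * (16 * (\<Sum>i. ennreal (1 / (r i)\<^sup>2) * emeasure M (ball (q i) (2 * r i))))"
    by (subst nn_integral_cmult) (simp_all add: int_a)
  also have "\<dots> < \<infinity>"
    using fin by (simp add: ennreal_mult_less_top)
  finally have \<beta>fin: "(\<integral>\<^sup>+x. \<beta> x \<partial>M) < \<infinity>" .
  have b\<beta>: "ennreal ((b x)\<^sup>2) = \<beta> x" if "\<beta> x \<noteq> \<infinity>" for x
    using that by (simp add: b_def less_top)
  have AE\<beta>: "AE x in M. \<beta> x \<noteq> \<infinity>"
    using \<beta>fin by (intro nn_integral_PInf_AE) auto
  have bound: "s \<le> b x" if "\<beta> x \<noteq> \<infinity>" "s\<^sup>2 \<le> (\<Sum>i<k. c i x)" for s x k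
  proof -
    have "ennreal (s\<^sup>2) \<le> ennreal (\<Sum>i<k. c i x)" using that by (intro ennreal_leI)
    also have "\<dots> \<le> \<beta> x" unfolding \<beta>_def by (intro ennreal_sum_le_suminf c0)
    also have "\<dots> = ennreal ((b x)\<^sup>2)" using b\<beta>[OF that(1)] by simp
    finally have "s\<^sup>2 \<le> (b x)\<^sup>2" by simp
    moreover have "0 \<le> b x" by (simp add: b_def)
    ultimately show ?thesis by (rule power2_le_imp_le)
  qed
  have u_le: "\<bar>cutoff q r k x\<bar> \<le> b x" if "\<beta> x \<noteq> \<infinity>" for k x
  proof (rule bound[OF that])
    have "(cutoff q r k x)\<^sup>2 \<le> (\<Sum>i<k. 16 * indicator (ball (q i) (2 * r i)) x)"
      by (rule cutoff_power2_le[OF r(1)])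
    also have "\<dots> \<le> (\<Sum>i<k. c i x)" by (intro sum_mono) (simp add: c_def a0)
    finally show "\<bar>cutoff q r k x\<bar>\<^sup>2 \<le> (\<Sum>i<k. c i x)" by simp
  qed
  have g_a: "(norm (cutoff_grad q r k x))\<^sup>2 \<le> (\<Sum>i<k. a i x)" for k x
    unfolding a_def by (rule norm_cutoff_grad_power2_le[OF r(1)])
  have g_le: "norm (cutoff_grad q r k x) \<le> b x" if "\<beta> x \<noteq> \<infinity>" for k x
    using that by (rule bound) (rule order_trans[OF g_a sum_mono[OF ac]])
  \<comment> \<open>Each \<open>c i x\<close> is either 0 or at least 16, so where the series
    converges only finitely many terms are nonzero.\<close>
  have ev: "\<exists>K. \<forall>k\<ge>K. cutoff q r k x = cutoff q r K x \<and> cutoff_grad q r k x = cutoff_grad q r K x"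
    if "\<beta> x \<noteq> \<infinity>" for x
  proof -
    have "summable (\<lambda>i. c i x)"
      using that c0 unfolding \<beta>_def by (intro summable_suminf_not_top) auto
    then have "(\<lambda>i. c i x) \<longlonglongrightarrow> 0" by (rule summable_LIMSEQ_zero)
    then have "\<forall>\<^sub>F i in sequentially. c i x < 1" by (rule order_tendstoD) simp
    then obtain K where K: "\<And>i. i \<ge> K \<Longrightarrow> c i x < 1" by (auto simp: eventually_sequentially)
    have z: "bump (q i) (r i) x = 0" if "i \<ge> K" for i
    proof (rule bump_eq_0[OF r(1)])
      show "x \<notin> ball (q i) (2 * r i)"
        using K[OF that] a0[of i x] by (auto simp: c_def indicator_def split: if_splits)
    qed
    have "cutoff q r k x = cutoff q r K x \<and> cutoff_grad q r k x = cutoff_grad q r K x" if "k \<ge> K" for k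
    proof -
      have eq: "(\<Sum>i<k. (bump (q i) (r i) x)\<^sup>2) = (\<Sum>i<K. (bump (q i) (r i) x)\<^sup>2)"
        "(\<Sum>i<k. (- bump (q i) (r i) x / (r i)\<^sup>2) *\<^sub>R (x - q i)) = (\<Sum>i<K. (- bump (q i) (r i) x / (r i)\<^sup>2) *\<^sub>R (x - q i))"
        by (rule sum_lessThan_stable[OF that], simp add: z)+
      show ?thesis
        unfolding cutoff_def cutoff_grad_def eq by simp
    qed
    then show ?thesis by blast
  qed
  \<comment> \<open>On the exceptional null set the value 1 is prescribed, because the lower bound
    on the balls is required at every point and not just almost everywhere.\<close>
  define F where "F x = (if \<beta> x < \<infinity> then lim (\<lambda>k. cutoff q r k x) else 1)" for x
  define D where "D x = lim (\<lambda>k. cutoff_grad q r k x)" for x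
  have limF: "(\<lambda>k. cutoff q r k x) \<longlonglongrightarrow> F x" if fin: "\<beta> x \<noteq> \<infinity>" for x
  proof -
    obtain K where "\<forall>k\<ge>K. cutoff q r k x = cutoff q r K x" using ev[OF fin] by blast
    then have "(\<lambda>k. cutoff q r k x) \<longlonglongrightarrow> cutoff q r K x"
      by (intro tendsto_eventually) (unfold eventually_sequentially, blast)
    then show ?thesis using fin by (simp add: F_def limI less_top)
  qed
  have limD: "(\<lambda>k. cutoff_grad q r k x) \<longlonglongrightarrow> D x" if fin: "\<beta> x \<noteq> \<infinity>" for x
  proof -
    obtain K where "\<forall>k\<ge>K. cutoff_grad q r k x = cutoff_grad q r K x" using ev[OF fin] by blast
    then have "(\<lambda>k. cutoff_grad q r k x) \<longlonglongrightarrow> cutoff_grad q r K x"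
      by (intro tendsto_eventually) (unfold eventually_sequentially, blast)
    then show ?thesis by (simp add: D_def limI)
  qed
  have cont: "continuous_on UNIV (cutoff q r k)" for k
    unfolding cutoff_def[abs_def] by (intro continuous_intros continuous_bump)
  have mF: "F \<in> borel_measurable borel"
  proof -
    have [measurable]: "cutoff q r k \<in> borel_measurable borel" for k
      by (rule borel_measurable_continuous_onI[OF cont])
    show ?thesis unfolding F_def[abs_def] by measurable
  qed
  have mD: "D \<in> borel_measurable borel"
  proof -
    have [measurable]: "cutoff_grad q r k \<in> borel_measurable borel" for k
      by (rule borel_measurable_continuous_onI[OF continuous_cutoff_grad])
    show ?thesis unfolding D_def[abs_def] by measurable
  qed
  have "C1_limit M F D"
    unfolding C1_limit_def C1_approx_def
  proof (intro conjI mF mD exI[of _ "cutoff q r"] exI[of _ "cutoff_grad q r"] exI[of _ b] allI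
      continuous_cutoff_grad GDERIV_cutoff)
    have "(\<integral>\<^sup>+x. ennreal ((b x)\<^sup>2) \<partial>M) = (\<integral>\<^sup>+x. \<beta> x \<partial>M)"
      using AE\<beta> by (intro nn_integral_cong_AE) (auto elim!: AE_mp simp: b\<beta>)
    then show "(\<integral>\<^sup>+x. ennreal ((b x)\<^sup>2) \<partial>M) < \<infinity>" using \<beta>fin by simp
    show "AE x in M. (\<forall>k. \<bar>cutoff q r k x\<bar> \<le> b x \<and> norm (cutoff_grad q r k x) \<le> b x) \<and>
         (\<lambda>k. cutoff q r k x) \<longlonglongrightarrow> F x \<and> (\<lambda>k. cutoff_grad q r k x) \<longlonglongrightarrow> D x"
      using AE\<beta> by eventually_elim (auto intro: u_le g_le limF limD)
  qed simp
  moreover have "0 \<le> F x" for x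
  proof (cases "\<beta> x \<noteq> \<infinity>")
    case True
    show ?thesis by (rule LIMSEQ_le_const[OF limF[OF True]]) (auto intro: cutoff_nonneg)
  qed (simp add: F_def)
  moreover have "1 \<le> F x" if x: "x \<in> (\<Union>i. ball (q i) (r i))" for x
  proof (cases "\<beta> x \<noteq> \<infinity>")
    case True
    obtain i where i: "x \<in> ball (q i) (r i)" using x by blast
    show ?thesis
      by (rule LIMSEQ_le_const[OF limF[OF True]]) (use cutoff_ge_1[where q=q and r=r and i=i and x=x] i in \<open>auto intro!: exI[of _ "Suc i"]\<close>)
  qed (simp add: F_def)
  moreover have "D x = 0" if x: "x \<notin> (\<Union>i. ball (q i) (2 * r i))" for x
  proof -
    have "cutoff_grad q r k x = 0" for k
      using g_a[of k x] x by (simp add: a_def)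
    then show ?thesis by (simp add: D_def limI)
  qed
  moreover have "(\<integral>\<^sup>+x. ennreal ((norm (D x))\<^sup>2) \<partial>M) \<le> 16 * (\<Sum>i. ennreal (1 / (r i)\<^sup>2) * emeasure M (ball (q i) (2 * r i)))"
    unfolding int_a[symmetric]
  proof (intro nn_integral_mono_AE)
    show "AE x in M. ennreal ((norm (D x))\<^sup>2) \<le> (\<Sum>i. ennreal (a i x))"
      using AE\<beta>
    proof eventually_elim
      case (elim x)
      have "(\<lambda>k. ennreal ((norm (cutoff_grad q r k x))\<^sup>2)) \<longlonglongrightarrow> ennreal ((norm (D x))\<^sup>2)"
        by (intro tendsto_intros limD elim tendsto_ennrealI)
      then show ?case
      proof (rule LIMSEQ_le_const2)
        have "ennreal ((norm (cutoff_grad q r k x))\<^sup>2) \<le> (\<Sum>i. ennreal (a i x))" for k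
          using ennreal_leI[OF g_a[of k x]] ennreal_sum_le_suminf[of "\<lambda>i. a i x" k] a0
          by (meson order_trans)
        then show "\<exists>N. \<forall>k\<ge>N. ennreal ((norm (cutoff_grad q r k x))\<^sup>2) \<le> (\<Sum>i. ennreal (a i x))" by blast
      qed
    qed
  qed
  ultimately show ?thesis by (intro exI[of _ F] exI[of _ D]) blast
qed

text \<open>Truncation at height \<open>N\<close>: for large \<open>N\<close> the part of
  \<open>h\<close> above \<open>N\<close> has integral below 1/2 by dominated convergence, and the
  part below contributes at most \<open>N * \<eta>\<close> \<le> 1/2 on a set of measure at most
  \<open>\<eta>\<close>.\<close>

lemma nn_integral_absolutely_continuous:
  fixes h :: "'a \<Rightarrow> real"
  assumes [measurable]: "h \<in> borel_measurable M" and h0: "\<And>x. 0 \<le> h x"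
    and fin: "(\<integral>\<^sup>+x. ennreal (h x) \<partial>M) < \<infinity>"
  shows "\<exists>\<eta>>0. \<forall>A\<in>sets M. emeasure M A \<le> ennreal \<eta> \<longrightarrow> (\<integral>\<^sup>+x. ennreal (h x) * indicator A x \<partial>M) \<le> 1"
proof -
  have "(\<lambda>N. \<integral>\<^sup>+x. ennreal (h x - min (h x) (real N)) \<partial>M) \<longlonglongrightarrow> (\<integral>\<^sup>+x. 0 \<partial>M)"
  proof (rule nn_integral_dominated_convergence[where w = "\<lambda>x. ennreal (h x)"])
    show "AE x in M. (\<lambda>N. ennreal (h x - min (h x) (real N))) \<longlonglongrightarrow> 0"
    proof (intro AE_I2 tendsto_eventually)
      fix x
      obtain N0 where "h x \<le> real N0" using real_arch_simple by blast
      then show "\<forall>\<^sub>F N in sequentially. ennreal (h x - min (h x) (real N)) = 0"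
        unfolding eventually_sequentially by (intro exI[of _ N0]) auto
    qed
  qed (use fin h0 in \<open>auto intro!: ennreal_leI\<close>)
  then have "(\<lambda>N. \<integral>\<^sup>+x. ennreal (h x - min (h x) (real N)) \<partial>M) \<longlonglongrightarrow> 0" by simp
  then have "\<forall>\<^sub>F N in sequentially. (\<integral>\<^sup>+x. ennreal (h x - min (h x) (real N)) \<partial>M) < ennreal (1/2)"
    by (rule order_tendstoD) (subst ennreal_less_zero_iff, simp)
  then obtain N where N: "(\<integral>\<^sup>+x. ennreal (h x - min (h x) (real N)) \<partial>M) < ennreal (1/2)"
    by (metis (mono_tags, lifting) eventually_sequentially order_refl)
  define \<eta> where "\<eta> = 1 / (2 * (real N + 1))"
  have "0 < \<eta>" by (simp add: \<eta>_def)
  have "(\<integral>\<^sup>+x. ennreal (h x) * indicator A x \<partial>M) \<le> 1" if [measurable]: "A \<in> sets M" and A: "emeasure M A \<le> ennreal \<eta>" for A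
  proof -
    have "(\<integral>\<^sup>+x. ennreal (h x) * indicator A x \<partial>M) \<le>
        (\<integral>\<^sup>+x. ennreal (h x - min (h x) (real N)) + ennreal (real N) * indicator A x \<partial>M)"
    proof (rule nn_integral_mono)
      fix x
      have "h x \<le> (h x - min (h x) (real N)) + real N" by auto
      then have "ennreal (h x) \<le> ennreal (h x - min (h x) (real N)) + ennreal (real N)"
        by (subst ennreal_plus[symmetric]) (auto intro!: ennreal_leI simp del: ennreal_plus ennreal_of_nat_eq_real_of_nat)
      then show "ennreal (h x) * indicator A x \<le> ennreal (h x - min (h x) (real N)) + ennreal (real N) * indicator A x"
        by (auto simp: indicator_def)
    qed
    also have "\<dots> = (\<integral>\<^sup>+x. ennreal (h x - min (h x) (real N)) \<partial>M) + ennreal (real N) * emeasure M A"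
      by (simp add: nn_integral_add nn_integral_cmult_indicator)
    also have "\<dots> \<le> ennreal (1/2) + ennreal (real N) * ennreal \<eta>"
      using N A by (intro add_mono mult_left_mono) auto
    also have "\<dots> \<le> ennreal (1/2) + ennreal (1/2)"
    proof (rule add_left_mono)
      have "real N * \<eta> \<le> 1/2"
        by (simp add: \<eta>_def field_simps)
      then show "ennreal (real N) * ennreal \<eta> \<le> ennreal (1/2)"
        by (subst ennreal_mult'[symmetric], simp, intro ennreal_leI)
    qed
    also have "\<dots> = 1" by (subst ennreal_plus[symmetric]) auto
    finally show ?thesis .
  qed
  then show ?thesis using \<open>0 < \<eta>\<close> by blast
qed

text \<open>
  Each new cutoff is so concentrated that its cross term with the sum of the previous ones is
  negligible; hence the energy of a sum of \<open>m\<close> cutoffs grows only linearly in \<open>m\<close>.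
\<close>

lemma C1_limit_multiple:
  fixes E :: "'a::euclidean_space set"
  assumes M: "sets M = sets borel" and C: "C < \<infinity>"
    and cover: "\<And>\<eta>::real. 0 < \<eta> \<Longrightarrow> \<exists>q r. E \<subseteq> (\<Union>i::nat. ball (q i) (r i)) \<and> (\<forall>i. 0 \<le> r i \<and> r i \<le> 1) \<and>
      (\<Sum>i. ennreal (1 / (r i)\<^sup>2) * emeasure M (ball (q i) (2 * r i))) \<le> C \<and>
      emeasure M (\<Union>i. ball (q i) (2 * r i)) \<le> ennreal \<eta>"
  shows "\<exists>f D U. C1_limit M f D \<and> open U \<and> E \<subseteq> U \<and> (\<forall>x\<in>U. real m \<le> f x) \<and>
    (\<integral>\<^sup>+x. ennreal ((norm (D x))\<^sup>2) \<partial>M) \<le> of_nat m * (1 + 32 * C)"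
proof (induction m)
  case 0
  show ?case
    by (intro exI[of _ "\<lambda>_. 0"] exI[of _ UNIV]) (simp add: C1_limit_zero)
next
  case (Suc m)
  then obtain f D U where f: "C1_limit M f D" "open U" "E \<subseteq> U" "\<And>x. x \<in> U \<Longrightarrow> real m \<le> f x"
    "(\<integral>\<^sup>+x. ennreal ((norm (D x))\<^sup>2) \<partial>M) \<le> of_nat m * (1 + 32 * C)"
    by blast
  note M [measurable_cong]
  have [measurable]: "D \<in> borel_measurable borel"
    using f(1) by (auto simp: C1_limit_def C1_approx_def)
  have "of_nat m * (1 + 32 * C) < \<infinity>"
    using C by (auto simp: ennreal_mult_less_top of_nat_less_top)
  with f(5) have fin: "(\<integral>\<^sup>+x. ennreal ((norm (D x))\<^sup>2) \<partial>M) < \<infinity>"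
    by (rule le_less_trans)
  obtain \<eta> where \<eta>: "0 < \<eta>"
    "\<And>A. A \<in> sets M \<Longrightarrow> emeasure M A \<le> ennreal \<eta> \<Longrightarrow> (\<integral>\<^sup>+x. ennreal ((norm (D x))\<^sup>2) * indicator A x \<partial>M) \<le> 1"
    using nn_integral_absolutely_continuous[of "\<lambda>x. (norm (D x))\<^sup>2" M] fin by auto
  obtain q r where qr: "E \<subseteq> (\<Union>i::nat. ball (q i) (r i))" "\<And>i. 0 \<le> r i" "\<And>i. r i \<le> 1"
      "(\<Sum>i. ennreal (1 / (r i)\<^sup>2) * emeasure M (ball (q i) (2 * r i))) \<le> C"
      "emeasure M (\<Union>i. ball (q i) (2 * r i)) \<le> ennreal \<eta>"
    using cover[OF \<eta>(1)] by (elim exE conjE) (rule that, auto)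
  define A where "A = (\<Union>i. ball (q i) (2 * r i))"
  have [measurable]: "A \<in> sets borel" by (auto simp: A_def)
  have "(\<Sum>i. ennreal (1 / (r i)\<^sup>2) * emeasure M (ball (q i) (2 * r i))) < \<infinity>"
    using qr(4) C by (rule le_less_trans)
  from C1_limit_cutoff[OF M qr(2,3) this] obtain F D'
    where F: "C1_limit M F D'" "\<And>x. 0 \<le> F x" "\<And>x. x \<in> (\<Union>i. ball (q i) (r i)) \<Longrightarrow> 1 \<le> F x"
      "\<And>x. x \<notin> A \<Longrightarrow> D' x = 0"
      "(\<integral>\<^sup>+x. ennreal ((norm (D' x))\<^sup>2) \<partial>M) \<le> 16 * (\<Sum>i. ennreal (1 / (r i)\<^sup>2) * emeasure M (ball (q i) (2 * r i)))"
    unfolding A_def by (elim exE conjE) (rule that, assumption, simp_all only: simp_thms Ball_def A_def)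
  have [measurable]: "D' \<in> borel_measurable borel"
    using F(1) by (auto simp: C1_limit_def C1_approx_def)
  have "(\<integral>\<^sup>+x. ennreal ((norm (D x + D' x))\<^sup>2) \<partial>M) \<le>
      (\<integral>\<^sup>+x. ennreal ((norm (D x))\<^sup>2) + ennreal ((norm (D x))\<^sup>2) * indicator A x + 2 * ennreal ((norm (D' x))\<^sup>2) \<partial>M)"
  proof (rule nn_integral_mono)
    fix x
    \<comment> \<open>Off \<open>A\<close> the new gradient vanishes. On \<open>A\<close> the
      doubled square costs one extra copy of the old energy, and \<open>\<eta>\<close> was chosen so
      that this copy integrates to at most 1.\<close>
    have "(norm (D x + D' x))\<^sup>2 \<le> (norm (D x))\<^sup>2 + (norm (D x))\<^sup>2 * indicator A x + 2 * (norm (D' x))\<^sup>2"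
    proof (cases "x \<in> A")
      case True
      have "(norm (D x + D' x))\<^sup>2 \<le> (norm (D x) + norm (D' x))\<^sup>2"
        by (intro power_mono norm_triangle_ineq) auto
      also have "\<dots> \<le> 2 * (norm (D x))\<^sup>2 + 2 * (norm (D' x))\<^sup>2"
        using zero_le_power2[of "norm (D x) - norm (D' x)"] by (simp add: power2_sum power2_diff)
      finally show ?thesis using True by simp
    qed (simp add: F(4))
    then have "ennreal ((norm (D x + D' x))\<^sup>2) \<le>
        ennreal ((norm (D x))\<^sup>2 + (norm (D x))\<^sup>2 * indicator A x + 2 * (norm (D' x))\<^sup>2)"
      by (rule ennreal_leI)
    also have "\<dots> = ennreal ((norm (D x))\<^sup>2) + ennreal ((norm (D x))\<^sup>2 * indicator A x) + ennreal (2 * (norm (D' x))\<^sup>2)"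
      by (simp only: ennreal_plus add_nonneg_nonneg mult_nonneg_nonneg zero_le_power2 indicator_pos_le zero_le_numeral)
    also have "ennreal ((norm (D x))\<^sup>2 * indicator A x) = ennreal ((norm (D x))\<^sup>2) * indicator A x"
      by (cases "x \<in> A") simp_all
    also have "ennreal (2 * (norm (D' x))\<^sup>2) = 2 * ennreal ((norm (D' x))\<^sup>2)"
      by (simp add: ennreal_mult)
    finally show "ennreal ((norm (D x + D' x))\<^sup>2) \<le>
        ennreal ((norm (D x))\<^sup>2) + ennreal ((norm (D x))\<^sup>2) * indicator A x + 2 * ennreal ((norm (D' x))\<^sup>2)" .
  qed
  also have "\<dots> = (\<integral>\<^sup>+x. ennreal ((norm (D x))\<^sup>2) \<partial>M) + (\<integral>\<^sup>+x. ennreal ((norm (D x))\<^sup>2) * indicator A x \<partial>M)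
      + 2 * (\<integral>\<^sup>+x. ennreal ((norm (D' x))\<^sup>2) \<partial>M)"
    by (simp add: nn_integral_add nn_integral_cmult)
  \<comment> \<open>The summand 1 comes from the overlap on \<open>A\<close>, and
    \<open>2 * (16 * C)\<close> is twice the energy of the new cutoff; together they are the
    increment 1 + 32 C.\<close>
  also have "\<dots> \<le> of_nat m * (1 + 32 * C) + 1 + 2 * (16 * C)"
  proof (intro add_mono mult_left_mono)
    show "(\<integral>\<^sup>+x. ennreal ((norm (D x))\<^sup>2) * indicator A x \<partial>M) \<le> 1"
      using qr(5) by (intro \<eta>(2)) (auto simp: A_def M)
    show "(\<integral>\<^sup>+x. ennreal ((norm (D' x))\<^sup>2) \<partial>M) \<le> 16 * C"
      using qr(4) by (intro order_trans[OF F(5)] mult_left_mono) auto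
  qed (use f(5) in auto)
  also have "\<dots> = of_nat (Suc m) * (1 + 32 * C)"
    by (simp add: distrib_right algebra_simps)
  finally have "(\<integral>\<^sup>+x. ennreal ((norm (D x + D' x))\<^sup>2) \<partial>M) \<le> of_nat (Suc m) * (1 + 32 * C)" .
  moreover have "real (Suc m) \<le> f x + F x" if "x \<in> U \<inter> (\<Union>i. ball (q i) (r i))" for x
    using f(4)[of x] F(3)[of x] that by auto
  ultimately show ?case
    using C1_limit_add[OF M f(1) F(1)] f(2,3) qr(1)
    by (intro exI[of _ "\<lambda>x. f x + F x"] exI[of _ "\<lambda>x. D x + D' x"] exI[of _ "U \<inter> (\<Union>i. ball (q i) (r i))"]) auto
qed

section \<open>Charts and tangential projection\<close>

text \<open>\<open>K\<close> is not convex, so the mean value inequality is applied on small closed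
  balls, where compactness of ball times unit sphere bounds the operator norm. Compactness of
  \<open>K\<close> then turns the local Lipschitz property into a global one.\<close>

lemma C1_imp_lipschitz_on_compact:
  fixes f :: "'a::euclidean_space \<Rightarrow> 'b::euclidean_space"
  assumes "open U" and der: "\<And>y. y \<in> U \<Longrightarrow> (f has_derivative f' y) (at y)"
    and cont: "continuous_on (U \<times> UNIV) (\<lambda>(y, v). f' y v)"
    and "compact K" "K \<subseteq> U"
  shows "\<exists>B>0. B-lipschitz_on K f"
proof -
  \<comment> \<open>Local Lipschitz continuity is formulated for time-dependent maps; the time set
    \<open>{0}\<close> makes the map constant in time.\<close>
  have "local_lipschitz {0::real} U (\<lambda>_. f)"
  proof (rule local_lipschitzI)
    fix t :: real and x assume "x \<in> U"
    then obtain u where u: "u > 0" "cball x u \<subseteq> U"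
      using \<open>open U\<close> open_contains_cball by blast
    have "continuous_on (cball x u \<times> sphere 0 1) (\<lambda>(y, v). f' y v)"
      by (rule continuous_on_subset[OF cont]) (use u in auto)
    moreover have "compact (cball x u \<times> sphere (0::'a) 1)"
      by (intro compact_Times) auto
    ultimately have "compact ((\<lambda>(y, v). f' y v) ` (cball x u \<times> sphere 0 1))"
      by (rule compact_continuous_image)
    then have "bounded ((\<lambda>(y, v). f' y v) ` (cball x u \<times> sphere 0 1))"
      by (rule compact_imp_bounded)
    then obtain B where "\<forall>z\<in>(\<lambda>(y, v). f' y v) ` (cball x u \<times> sphere 0 1). norm z \<le> B"
      unfolding bounded_iff by blast
    then have B: "norm (f' y v) \<le> B" if "y \<in> cball x u" "norm v = 1" for y v
      using that by force
    have "norm (f a - f b) \<le> \<bar>B\<bar> * norm (a - b)" if "a \<in> cball x u" "b \<in> cball x u" for a b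
    proof (rule differentiable_bound[OF convex_cball _ _ that])
      fix y assume y: "y \<in> cball x u"
      then have d: "(f has_derivative f' y) (at y)" using u der by blast
      then show "(f has_derivative f' y) (at y within cball x u)" by (rule has_derivative_at_withinI)
      have lin: "linear (f' y)" using d has_derivative_linear by blast
      show "onorm (f' y) \<le> \<bar>B\<bar>"
      proof (rule onorm_le)
        fix v
        show "norm (f' y v) \<le> \<bar>B\<bar> * norm v"
        proof (cases "v = 0")
          case False
          have "norm (f' y (v /\<^sub>R norm v)) \<le> \<bar>B\<bar>"
            using B[OF y, of "v /\<^sub>R norm v"] False by auto
          then show ?thesis
            using False by (simp add: linear_scale[OF lin] field_simps)
        qed (simp add: linear_0[OF lin])
      qed
    qed
    then have "\<bar>B\<bar>-lipschitz_on (cball x u \<inter> U) f"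
      by (intro lipschitz_onI) (auto simp: dist_norm)
    then show "\<exists>u>0. \<exists>L. \<forall>t\<in>cball t u \<inter> {0}. L-lipschitz_on (cball x u \<inter> U) f"
      using u(1) by blast
  qed
  then have loc: "local_lipschitz {0::real} K (\<lambda>_. f)"
    by (rule local_lipschitz_subset) (use \<open>K \<subseteq> U\<close> in auto)
  obtain B where "B-lipschitz_on K f"
    by (rule local_lipschitz_compact_implies_lipschitz[OF loc \<open>compact K\<close> compact_sing]) auto
  then have "(\<bar>B\<bar> + 1)-lipschitz_on K f"
    by (rule lipschitz_on_le) auto
  then show ?thesis
    by (intro exI[of _ "\<bar>B\<bar> + 1"]) auto
qed

text \<open>\<open>closest_point\<close> serves as the orthogonal projection. It depends on the set
  \<open>T\<close> alone, so it can be applied to a varying tangent space without a choice of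
  bases.\<close>

lemma closest_point_subspace:
  fixes T :: "'a::euclidean_space set"
  assumes "subspace T"
  shows closest_point_subspace_unique:
      "\<And>u. u \<in> T \<Longrightarrow> (\<And>t. t \<in> T \<Longrightarrow> (w - u) \<bullet> t = 0) \<Longrightarrow> closest_point T w = u"
    and closest_point_subspace_in: "closest_point T w \<in> T"
    and closest_point_subspace_orthogonal: "\<And>t. t \<in> T \<Longrightarrow> (w - closest_point T w) \<bullet> t = 0"
    and norm_closest_point_subspace_le: "norm (closest_point T w) \<le> norm w"
proof -
  have T: "closed T" "convex T" "0 \<in> T"
    using assms by (auto intro: closed_subspace subspace_imp_convex subspace_0)
  show uniq: "closest_point T w = u" if u: "u \<in> T" "\<And>t. t \<in> T \<Longrightarrow> (w - u) \<bullet> t = 0" for u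
  proof -
    have "dist w u \<le> dist w z" if "z \<in> T" for z
    proof -
      have "(w - u) \<bullet> (u - z) = 0"
        using that u assms by (simp add: subspace_diff)
      then have "(norm (w - u))\<^sup>2 + (norm (u - z))\<^sup>2 = (norm (w - u + (u - z)))\<^sup>2"
        by (simp add: power2_norm_eq_inner algebra_simps inner_commute)
      then have "(norm (w - u))\<^sup>2 \<le> (norm (w - z))\<^sup>2"
        using zero_le_power2[of "norm (u - z)"] by (simp only: diff_add_cancel diff_add_eq add_diff_eq)
      then show ?thesis
        unfolding dist_norm by (rule power2_le_imp_le) simp
    qed
    then show ?thesis
      using closest_point_unique[OF T(2,1) u(1)] by metis
  qed
  obtain u v where "u \<in> span T" "\<And>t. t \<in> span T \<Longrightarrow> orthogonal v t" "w = u + v"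
    by (rule orthogonal_subspace_decomp_exists) blast
  then have uv: "u \<in> T" "\<And>t. t \<in> T \<Longrightarrow> (w - u) \<bullet> t = 0"
    using assms by (auto simp: orthogonal_def span_eq_iff[THEN iffD2])
  then have eq: "closest_point T w = u" by (rule uniq)
  show "(w - closest_point T w) \<bullet> t = 0" if "t \<in> T" for t
    using uv that by (auto simp: eq)
  show "closest_point T w \<in> T" using uv eq by simp
  show "norm (closest_point T w) \<le> norm w"
  proof -
    have "(w - u) \<bullet> u = 0" using uv by blast
    then have "(norm w)\<^sup>2 = (norm u)\<^sup>2 + (norm (w - u))\<^sup>2"
      by (simp add: power2_norm_eq_inner algebra_simps inner_commute)
    then have "(norm u)\<^sup>2 \<le> (norm w)\<^sup>2" by simp
    then show ?thesis unfolding eq by (rule power2_le_imp_le) simp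
  qed
qed

text \<open>Linearity in \<open>w\<close> reduces the projection of a variable vector to the
  projections of the fixed basis vectors, whose dependence on the subspace can be studied
  separately.\<close>

lemma closest_point_subspace_sum_Basis:
  fixes T :: "'a::euclidean_space set"
  assumes "subspace T"
  shows "closest_point T w = (\<Sum>b\<in>Basis. (w \<bullet> b) *\<^sub>R closest_point T b)"
proof (rule closest_point_subspace_unique[OF assms])
  show "(\<Sum>b\<in>Basis. (w \<bullet> b) *\<^sub>R closest_point T b) \<in> T"
    using assms by (intro subspace_sum subspace_scale closest_point_subspace_in)
  fix t assume t: "t \<in> T"
  have "(w - (\<Sum>b\<in>Basis. (w \<bullet> b) *\<^sub>R closest_point T b)) \<bullet> t
      = ((\<Sum>b\<in>Basis. (w \<bullet> b) *\<^sub>R b) - (\<Sum>b\<in>Basis. (w \<bullet> b) *\<^sub>R closest_point T b)) \<bullet> t"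
    by (simp add: euclidean_representation)
  also have "\<dots> = (\<Sum>b\<in>Basis. (w \<bullet> b) * ((b - closest_point T b) \<bullet> t))"
    by (simp add: sum_subtractf[symmetric] scaleR_diff_right[symmetric] inner_sum_left)
  also have "\<dots> = 0"
    using closest_point_subspace_orthogonal[OF assms t] by simp
  finally show "(w - (\<Sum>b\<in>Basis. (w \<bullet> b) *\<^sub>R closest_point T b)) \<bullet> t = 0" .
qed

text \<open>Extracts the real differentiable structure of a holomorphic map. Continuity jointly in
  point and direction is the form in which the derivative can be bounded on compact sets of
  pairs.\<close>

lemma holomorphic_map_imp_C1:
  fixes F :: "complex ^ 'N \<Rightarrow> complex ^ 'M"
  assumes "holomorphic_map U F"
  shows "\<exists>F'. (\<forall>z\<in>U. (F has_derivative F' z) (at z)) \<and> continuous_on (U \<times> UNIV) (\<lambda>(z, v). F' z v)"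
proof -
  have "\<forall>i. \<exists>g :: complex ^ 'N \<Rightarrow> complex ^ 'N. continuous_on U g \<and>
        (\<forall>z\<in>U. ((\<lambda>z. F z $ i) has_derivative (\<lambda>v. \<Sum>j\<in>UNIV. g z $ j * v $ j)) (at z))"
    using assms by (simp add: holomorphic_map_def holomorphic_fun_def)
  then obtain g :: "'M \<Rightarrow> complex ^ 'N \<Rightarrow> complex ^ 'N" where "\<forall>i. continuous_on U (g i) \<and>
        (\<forall>z\<in>U. ((\<lambda>z. F z $ i) has_derivative (\<lambda>v. \<Sum>j\<in>UNIV. g i z $ j * v $ j)) (at z))"
    by (elim exE[OF choice])
  then have g: "\<And>i. continuous_on U (g i)"
    "\<And>i z. z \<in> U \<Longrightarrow> ((\<lambda>z. F z $ i) has_derivative (\<lambda>v. \<Sum>j\<in>UNIV. g i z $ j * v $ j)) (at z)"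
    by auto
  define F' where "F' z v = (\<chi> i. \<Sum>j\<in>UNIV. g i z $ j * v $ j)" for z v
  have "(F has_derivative F' z) (at z)" if "z \<in> U" for z
  proof (subst has_derivative_componentwise_within, intro ballI)
    fix b :: "complex ^ 'M" assume "b \<in> Basis"
    then obtain i c where b: "b = axis i c" by (auto simp: Basis_vec_def)
    have "((\<lambda>z. F z $ i \<bullet> c) has_derivative (\<lambda>v. F' z v $ i \<bullet> c)) (at z)"
      unfolding F'_def vec_lambda_beta by (rule has_derivative_inner_left[OF g(2)[OF that]])
    then show "((\<lambda>z. F z \<bullet> b) has_derivative (\<lambda>v. F' z v \<bullet> b)) (at z)"
      by (simp add: b inner_axis)
  qed
  moreover have "continuous_on (U \<times> UNIV) (\<lambda>(z, v). F' z v)"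
  proof -
    have "continuous_on (U \<times> UNIV) (\<lambda>p. g i (fst p))" for i
      by (rule continuous_on_compose2[OF g(1)]) (auto intro!: continuous_intros)
    then show ?thesis
      unfolding F'_def split_def
      by (intro continuous_on_vec_lambda continuous_intros)
  qed
  ultimately show ?thesis by blast
qed

section \<open>Charts as real parametrisations and their tangent spaces\<close>

lemma has_vector_derivative_imp_quotient_tendsto:
  assumes "(h has_vector_derivative D) (at 0)"
  shows "((\<lambda>t::real. (h t - h 0) /\<^sub>R t) \<longlongrightarrow> D) (at 0)"
proof (subst LIM_zero_iff[symmetric], rule tendsto_norm_zero_cancel)
  have "((\<lambda>t. norm (h t - h 0 - t *\<^sub>R D) / norm t) \<longlongrightarrow> 0) (at 0)"
    using assms by (simp add: has_vector_derivative_def has_derivative_iff_norm)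
  then show "((\<lambda>t. norm ((h t - h 0) /\<^sub>R t - D)) \<longlongrightarrow> 0) (at 0)"
  proof (rule Lim_transform_eventually)
    show "\<forall>\<^sub>F t in at 0. norm (h t - h 0 - t *\<^sub>R D) / norm t = norm ((h t - h 0) /\<^sub>R t - D)"
    proof (rule eventually_at_ball'[THEN eventually_mono, of 1])
      fix t :: real assume "t \<in> ball 0 1 \<and> t \<noteq> 0 \<and> t \<in> UNIV"
      then have "(h t - h 0) /\<^sub>R t - D = (h t - h 0 - t *\<^sub>R D) /\<^sub>R t"
        by (simp add: scaleR_diff_right)
      then show "norm (h t - h 0 - t *\<^sub>R D) / norm t = norm ((h t - h 0) /\<^sub>R t - D)"
        by (simp add: divide_inverse_commute)
    qed simp
  qed
qed

text \<open>A chart with a fixed inverse and fixed derivatives, stripped of its complex structure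
  and of its dimension. All analysis in charts takes place here.\<close>

locale C1_chart =
  fixes X L V :: "(complex ^ 'N) set" and \<Phi> \<Psi> :: "complex ^ 'N \<Rightarrow> complex ^ 'N"
    and \<Phi>' \<Psi>' :: "complex ^ 'N \<Rightarrow> complex ^ 'N \<Rightarrow> complex ^ 'N"
  assumes subspace_L: "subspace L" and open_V: "open V" and open_image: "open (\<Phi> ` V)"
    and image_eq: "\<Phi> ` (V \<inter> L) = X \<inter> \<Phi> ` V"
    and inverse: "\<And>y. y \<in> V \<Longrightarrow> \<Psi> (\<Phi> y) = y"
    and deriv: "\<And>y. y \<in> V \<Longrightarrow> (\<Phi> has_derivative \<Phi>' y) (at y)"
    and deriv_inv: "\<And>x. x \<in> \<Phi> ` V \<Longrightarrow> (\<Psi> has_derivative \<Psi>' x) (at x)"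
    and cont: "continuous_on (V \<times> UNIV) (\<lambda>(y, v). \<Phi>' y v)"
    and cont_inv: "continuous_on (\<Phi> ` V \<times> UNIV) (\<lambda>(x, v). \<Psi>' x v)"
begin

lemma deriv_inv_deriv:
  assumes "y \<in> V"
  shows "\<Psi>' (\<Phi> y) (\<Phi>' y v) = v"
proof -
  have "((\<lambda>z. \<Psi> (\<Phi> z)) has_derivative (\<lambda>v. \<Psi>' (\<Phi> y) (\<Phi>' y v))) (at y)"
    by (rule has_derivative_compose[OF deriv deriv_inv]) (use assms in auto)
  moreover have "((\<lambda>z. \<Psi> (\<Phi> z)) has_derivative (\<lambda>v. v)) (at y)"
    by (rule has_derivative_transform_within_open[OF has_derivative_ident open_V assms]) (simp add: inverse)
  ultimately have "(\<lambda>v. \<Psi>' (\<Phi> y) (\<Phi>' y v)) = (\<lambda>v. v)"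
    by (rule has_derivative_unique)
  then show ?thesis by (rule fun_cong)
qed

lemma deriv_deriv_inv:
  assumes "y \<in> V"
  shows "\<Phi>' y (\<Psi>' (\<Phi> y) v) = v"
proof -
  have "((\<lambda>x. \<Phi> (\<Psi> x)) has_derivative (\<lambda>v. \<Phi>' y (\<Psi>' (\<Phi> y) v))) (at (\<Phi> y))"
  proof (rule has_derivative_compose[OF deriv_inv])
    show "(\<Phi> has_derivative \<Phi>' y) (at (\<Psi> (\<Phi> y)))"
      unfolding inverse[OF assms] by (rule deriv[OF assms])
  qed (use assms in blast)
  moreover have "((\<lambda>x. \<Phi> (\<Psi> x)) has_derivative (\<lambda>v. v)) (at (\<Phi> y))"
    by (rule has_derivative_transform_within_open[OF has_derivative_ident open_image]) (use assms in \<open>auto simp: inverse\<close>)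
  ultimately have "(\<lambda>v. \<Phi>' y (\<Psi>' (\<Phi> y) v)) = (\<lambda>v. v)"
    by (rule has_derivative_unique)
  then show ?thesis by (rule fun_cong)
qed

lemma continuous_on_chart: "continuous_on V \<Phi>"
  by (intro continuous_at_imp_continuous_on ballI has_derivative_continuous[OF deriv])

lemma continuous_on_inv: "continuous_on (\<Phi> ` V) \<Psi>"
  by (intro continuous_at_imp_continuous_on ballI has_derivative_continuous[OF deriv_inv])

lemma continuous_on_deriv: "continuous_on V (\<lambda>y. \<Phi>' y v)"
proof -
  have "continuous_on V (\<lambda>y. (y, v))"
    by (intro continuous_intros)
  from continuous_on_compose2[OF cont this] show ?thesis by auto
qed

lemma linear_deriv: "y \<in> V \<Longrightarrow> linear (\<Phi>' y)"
  using deriv has_derivative_linear by blast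

lemma inv_in: "x \<in> \<Phi> ` V \<Longrightarrow> \<Psi> x \<in> V"
  by (auto simp: inverse)

lemma chart_inv: "x \<in> \<Phi> ` V \<Longrightarrow> \<Phi> (\<Psi> x) = x"
  by (auto simp: inverse)

lemma inv_in_L: "x \<in> X \<Longrightarrow> x \<in> \<Phi> ` V \<Longrightarrow> \<Psi> x \<in> L"
proof -
  assume "x \<in> X" "x \<in> \<Phi> ` V"
  then have "x \<in> \<Phi> ` (V \<inter> L)" unfolding image_eq by (rule IntI)
  then show ?thesis by (auto simp: inverse)
qed

text \<open>Lines in \<open>L\<close> are carried to curves in \<open>X\<close>. Conversely the
  inverse chart carries a curve in \<open>X\<close> into \<open>L\<close>, and the limit of its
  difference quotients stays in \<open>L\<close> because a subspace is closed.\<close>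

lemma tangent_space_eq:
  assumes y: "y \<in> V \<inter> L"
  shows "tangent_space X (\<Phi> y) = \<Phi>' y ` L"
proof
  show "\<Phi>' y ` L \<subseteq> tangent_space X (\<Phi> y)"
  proof
    fix w assume "w \<in> \<Phi>' y ` L"
    then obtain v where v: "v \<in> L" "w = \<Phi>' y v" by blast
    define \<gamma> where "\<gamma> t = \<Phi> (y + t *\<^sub>R v)" for t :: real
    have "((\<lambda>t::real. y + t *\<^sub>R v) \<longlongrightarrow> y) (at 0)"
      by (auto intro!: tendsto_eq_intros)
    then have "\<forall>\<^sub>F t in at (0::real). y + t *\<^sub>R v \<in> V"
      using open_V y by (auto elim!: topological_tendstoD)
    then have "\<forall>\<^sub>F t in at 0. \<gamma> t \<in> X"
    proof eventually_elim
      case (elim t)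
      have "y + t *\<^sub>R v \<in> L" using y v subspace_L by (auto intro: subspace_add subspace_scale)
      then show ?case using elim image_eq by (auto simp: \<gamma>_def)
    qed
    moreover have "(\<gamma> has_vector_derivative w) (at 0)"
    proof -
      have "((\<lambda>t::real. y + t *\<^sub>R v) has_derivative (\<lambda>t. t *\<^sub>R v)) (at 0)"
        by (auto intro!: derivative_eq_intros)
      moreover have "(\<Phi> has_derivative \<Phi>' y) (at (y + 0 *\<^sub>R v))"
        using deriv y by simp
      ultimately have "(\<gamma> has_derivative (\<lambda>t. \<Phi>' y (t *\<^sub>R v))) (at 0)"
        unfolding \<gamma>_def by (rule has_derivative_compose)
      then show ?thesis
        using linear_deriv y v by (simp add: has_vector_derivative_def linear_scale)
    qed
    ultimately show "w \<in> tangent_space X (\<Phi> y)"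
      by (auto simp: tangent_space_def \<gamma>_def intro!: exI[of _ \<gamma>])
  qed
  show "tangent_space X (\<Phi> y) \<subseteq> \<Phi>' y ` L"
  proof
    fix w assume "w \<in> tangent_space X (\<Phi> y)"
    then obtain \<gamma> :: "real \<Rightarrow> complex ^ 'N" where \<gamma>: "\<gamma> 0 = \<Phi> y" "\<forall>\<^sub>F t in at 0. \<gamma> t \<in> X"
      "(\<gamma> has_vector_derivative w) (at 0)"
      by (auto simp: tangent_space_def)
    have "isCont \<gamma> 0" using \<gamma>(3) by (rule has_vector_derivative_continuous)
    then have "(\<gamma> \<longlongrightarrow> \<Phi> y) (at 0)" using \<gamma>(1) by (simp add: isCont_def)
    then have "\<forall>\<^sub>F t in at 0. \<gamma> t \<in> \<Phi> ` V"
      using open_image y by (auto elim!: topological_tendstoD)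
    with \<gamma>(2) have evL: "\<forall>\<^sub>F t in at 0. \<Psi> (\<gamma> t) \<in> L"
      by eventually_elim (rule inv_in_L)
    have "(\<Psi> has_derivative \<Psi>' (\<Phi> y)) (at (\<gamma> 0))"
      using deriv_inv y \<gamma>(1) by auto
    then have "((\<lambda>t. \<Psi> (\<gamma> t)) has_derivative (\<lambda>t. \<Psi>' (\<Phi> y) (t *\<^sub>R w))) (at 0)"
      using has_derivative_compose[OF \<gamma>(3)[unfolded has_vector_derivative_def]] by blast
    moreover have "linear (\<Psi>' (\<Phi> y))"
      using deriv_inv y has_derivative_linear by blast
    ultimately have "((\<lambda>t. \<Psi> (\<gamma> t)) has_vector_derivative \<Psi>' (\<Phi> y) w) (at 0)"
      by (simp add: has_vector_derivative_def linear_scale)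
    then have lim: "((\<lambda>t. (\<Psi> (\<gamma> t) - y) /\<^sub>R t) \<longlongrightarrow> \<Psi>' (\<Phi> y) w) (at 0)"
      using y has_vector_derivative_imp_quotient_tendsto[of "\<lambda>t. \<Psi> (\<gamma> t)"] by (simp add: \<gamma>(1) inverse)
    have "\<Psi>' (\<Phi> y) w \<in> L"
    proof (rule Lim_in_closed_set[OF closed_subspace[OF subspace_L] _ _ lim])
      show "\<forall>\<^sub>F t in at 0. (\<Psi> (\<gamma> t) - y) /\<^sub>R t \<in> L"
        using evL by eventually_elim (use y subspace_L in \<open>auto intro: subspace_diff subspace_scale\<close>)
    qed simp
    moreover have "w = \<Phi>' y (\<Psi>' (\<Phi> y) w)"
      using deriv_deriv_inv y by simp
    ultimately show "w \<in> \<Phi>' y ` L" by blast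
  qed
qed

lemma subspace_tangent_space:
  assumes "x \<in> X" "x \<in> \<Phi> ` V"
  shows "subspace (tangent_space X x)"
proof -
  obtain y where y: "y \<in> V \<inter> L" "x = \<Phi> y" using assms image_eq by blast
  then show ?thesis
    using linear_deriv subspace_L by (auto simp: tangent_space_eq intro: linear_subspace_image)
qed

text \<open>The graph of the projection is closed, and its values stay in a compact ball.\<close>

lemma continuous_on_tangential:
  "continuous_on (X \<inter> \<Phi> ` V) (\<lambda>x. closest_point (tangent_space X x) w)"
proof -
  define S where "S = X \<inter> \<Phi> ` V"
  define T where "T = cball (0 :: complex ^ 'N) (norm w)"
  define P where "P x = closest_point (tangent_space X x) w" for x
  have sub: "subspace (tangent_space X x)" if "x \<in> S" for x
    using that subspace_tangent_space by (auto simp: S_def)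
  have tan: "tangent_space X x = \<Phi>' (\<Psi> x) ` L" if "x \<in> S" for x
    using that tangent_space_eq[of "\<Psi> x"] by (auto simp: S_def inv_in inv_in_L chart_inv)
  have in_tan: "u \<in> tangent_space X x \<longleftrightarrow> \<Psi>' x u \<in> L" if "x \<in> S" for x u
  proof -
    have x: "\<Psi> x \<in> V" "\<Phi> (\<Psi> x) = x" using that by (auto simp: S_def inv_in chart_inv)
    show ?thesis
      unfolding tan[OF that] using deriv_inv_deriv[OF x(1)] deriv_deriv_inv[OF x(1)] x(2)
      by (metis imageE imageI)
  qed
  have PT: "P \<in> S \<rightarrow> T"
    using sub by (auto simp: P_def T_def norm_closest_point_subspace_le)
  \<comment> \<open>\<open>u\<close> is the projection of \<open>w\<close> iff
    \<open>\<Psi>' x u\<close> lies in \<open>L\<close>, which says that \<open>u\<close> is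
    tangent, and \<open>w - u\<close> is orthogonal to the image of every \<open>l\<close> in
    \<open>L\<close>. Each of these conditions is closed in the pair of \<open>x\<close> and
    \<open>u\<close>.\<close>
  have graph: "(\<lambda>x. (x, P x)) ` S = (S \<times> T \<inter> (\<lambda>z. \<Psi>' (fst z) (snd z)) -` L) \<inter>
      (\<Inter>l\<in>L. S \<times> T \<inter> (\<lambda>z. (w - snd z) \<bullet> \<Phi>' (\<Psi> (fst z)) l) -` {0})" (is "?G = ?R")
  proof
    show "?G \<subseteq> ?R"
    proof
      fix z assume "z \<in> ?G"
      then obtain x where x: "x \<in> S" "z = (x, P x)" by blast
      have "P x \<in> tangent_space X x" "\<And>t. t \<in> tangent_space X x \<Longrightarrow> (w - P x) \<bullet> t = 0"
        using closest_point_subspace_in[OF sub[OF x(1)]] closest_point_subspace_orthogonal[OF sub[OF x(1)]]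
        by (auto simp: P_def)
      then show "z \<in> ?R"
        using x PT in_tan[OF x(1)] tan[OF x(1)] by auto
    qed
    show "?R \<subseteq> ?G"
    proof
      fix z assume z: "z \<in> ?R"
      obtain x u where xu: "z = (x, u)" by force
      have x: "x \<in> S" using z xu by auto
      have "P x = u"
        unfolding P_def
      proof (rule closest_point_subspace_unique[OF sub[OF x]])
        show "u \<in> tangent_space X x" using z xu in_tan[OF x] by auto
        show "(w - u) \<bullet> t = 0" if t: "t \<in> tangent_space X x" for t
        proof -
          obtain l where l: "l \<in> L" "t = \<Phi>' (\<Psi> x) l" using t tan[OF x] by auto
          have "z \<in> S \<times> T \<inter> (\<lambda>z. (w - snd z) \<bullet> \<Phi>' (\<Psi> (fst z)) l) -` {0}"
            using IntD2[OF z] l(1) by (rule INT_D)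
          then show ?thesis using l(2) xu by simp
        qed
      qed
      then show "z \<in> ?G" using x xu by auto
    qed
  qed
  have cl1: "closedin (top_of_set (S \<times> T)) (S \<times> T \<inter> (\<lambda>z. \<Psi>' (fst z) (snd z)) -` L)"
  proof (rule continuous_closedin_preimage)
    show "continuous_on (S \<times> T) (\<lambda>z. \<Psi>' (fst z) (snd z))"
      by (rule continuous_on_subset[OF cont_inv[unfolded split_def]]) (auto simp: S_def)
  qed (rule closed_subspace[OF subspace_L])
  have cl2: "closedin (top_of_set (S \<times> T)) (S \<times> T \<inter> (\<lambda>z. (w - snd z) \<bullet> \<Phi>' (\<Psi> (fst z)) l) -` {0})" for l
  proof (rule continuous_closedin_preimage)
    have "continuous_on (S \<times> T) (\<lambda>z. \<Phi>' (\<Psi> (fst z)) l)"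
    proof (rule continuous_on_compose2[OF continuous_on_deriv])
      show "continuous_on (S \<times> T) (\<lambda>z. \<Psi> (fst z))"
        by (rule continuous_on_compose2[OF continuous_on_inv]) (auto intro!: continuous_intros simp: S_def)
    qed (auto simp: S_def inv_in)
    then show "continuous_on (S \<times> T) (\<lambda>z. (w - snd z) \<bullet> \<Phi>' (\<Psi> (fst z)) l)"
      by (intro continuous_intros)
  qed simp
  have "L \<noteq> {}" using subspace_0[OF subspace_L] by auto
  then have "closedin (top_of_set (S \<times> T)) ((\<lambda>x. (x, P x)) ` S)"
    unfolding graph using cl2 by (intro closedin_Int[OF cl1 closedin_INT])
  then have "continuous_on S P"
    using continuous_closed_graph_eq[OF _ PT] by (simp add: T_def)
  then show ?thesis
    unfolding S_def P_def .
qed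

end

lemma chart_imp_C1_chart:
  assumes "chart X m L V \<Phi>"
  shows "\<exists>\<Psi> \<Phi>' \<Psi>'. C1_chart X L V \<Phi> \<Psi> \<Phi>' \<Psi>'"
proof -
  have L: "vec.subspace L" and V: "open V" "open (\<Phi> ` V)" and hol: "holomorphic_map V \<Phi>"
    and im: "\<Phi> ` (V \<inter> L) = X \<inter> \<Phi> ` V"
    using assms by (auto simp: chart_def biholomorphic_on_def)
  obtain \<Psi> where \<Psi>: "holomorphic_map (\<Phi> ` V) \<Psi>" "\<And>y. y \<in> V \<Longrightarrow> \<Psi> (\<Phi> y) = y"
    using assms by (auto simp: chart_def biholomorphic_on_def)
  obtain \<Phi>' where 1: "\<forall>z\<in>V. (\<Phi> has_derivative \<Phi>' z) (at z)" "continuous_on (V \<times> UNIV) (\<lambda>(z, v). \<Phi>' z v)"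
    using holomorphic_map_imp_C1[OF hol] by blast
  obtain \<Psi>' where 2: "\<forall>z\<in>\<Phi> ` V. (\<Psi> has_derivative \<Psi>' z) (at z)" "continuous_on (\<Phi> ` V \<times> UNIV) (\<lambda>(z, v). \<Psi>' z v)"
    using holomorphic_map_imp_C1[OF \<Psi>(1)] by blast
  have "c *\<^sub>R x = complex_of_real c *s x" for c and x :: "complex ^ 'a"
  proof (intro vec_eq_iff[THEN iffD2] allI)
    show "(c *\<^sub>R x) $ i = (complex_of_real c *s x) $ i" for i
      unfolding vector_scaleR_component vector_smult_component by (rule scaleR_conv_of_real)
  qed
  then have "subspace L"
    using L by (auto simp: subspace_def vec.subspace_def)
  then have "C1_chart X L V \<Phi> \<Psi> \<Phi>' \<Psi>'"
    using V im \<Psi>(2) 1 2 by unfold_locales auto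
  then show ?thesis by blast
qed

lemma reg_imp_C1_chart:
  assumes "x \<in> reg X"
  shows "x \<in> X \<and> (\<exists>L V \<Phi> \<Psi> \<Phi>' \<Psi>'. C1_chart X L V \<Phi> \<Psi> \<Phi>' \<Psi>' \<and> x \<in> \<Phi> ` V \<and> X \<inter> \<Phi> ` V \<subseteq> reg X)"
proof -
  obtain m L V \<Phi> where c: "x \<in> X" "chart X m L V \<Phi>" "x \<in> \<Phi> ` V"
    using assms by (auto simp: reg_def regular_point_def)
  then have "X \<inter> \<Phi> ` V \<subseteq> reg X"
    unfolding reg_def regular_point_def by blast
  then show ?thesis using c chart_imp_C1_chart[OF c(2)] by blast
qed

section \<open>Continuity on the regular part and Borel sets\<close>

lemma subspace_tangent_space_reg: "x \<in> reg X \<Longrightarrow> subspace (tangent_space X x)"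
  using reg_imp_C1_chart C1_chart.subspace_tangent_space by blast

text \<open>Continuity is local, and within the range of a chart all points of \<open>X\<close> are
  regular, so near a regular point the chart range cuts out the same set from \<open>X\<close> and
  from \<open>reg X\<close>. Charts of different dimensions may occur at different points.\<close>

lemma continuous_on_tangential_reg:
  "continuous_on (reg X) (\<lambda>x. closest_point (tangent_space X x) w)"
  unfolding continuous_on_eq_continuous_within
proof
  fix x assume x: "x \<in> reg X"
  then obtain L V \<Phi> \<Psi> \<Phi>' \<Psi>' where c: "C1_chart X L V \<Phi> \<Psi> \<Phi>' \<Psi>'" "x \<in> X" "x \<in> \<Phi> ` V" "X \<inter> \<Phi> ` V \<subseteq> reg X"
    using reg_imp_C1_chart by blast
  interpret C1_chart X L V \<Phi> \<Psi> \<Phi>' \<Psi>' by fact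
  have "continuous (at x within X \<inter> \<Phi> ` V) (\<lambda>x. closest_point (tangent_space X x) w)"
    using continuous_on_tangential c by (auto simp: continuous_on_eq_continuous_within)
  moreover have "at x within X \<inter> \<Phi> ` V = at x within reg X"
    by (rule at_within_nhd[OF c(3) open_image]) (use c(4) reg_imp_C1_chart in blast)
  ultimately show "continuous (at x within reg X) (\<lambda>x. closest_point (tangent_space X x) w)"
    by simp
qed

lemma openin_reg: "openin (top_of_set X) (reg X)"
proof (subst openin_subopen, intro ballI)
  fix x assume "x \<in> reg X"
  then obtain L V \<Phi> \<Psi> \<Phi>' \<Psi>' where c: "C1_chart X L V \<Phi> \<Psi> \<Phi>' \<Psi>'" "x \<in> X" "x \<in> \<Phi> ` V" "X \<inter> \<Phi> ` V \<subseteq> reg X"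
    using reg_imp_C1_chart by blast
  then show "\<exists>T. openin (top_of_set X) T \<and> x \<in> T \<and> T \<subseteq> reg X"
    using C1_chart.open_image[OF c(1)] by (intro exI[of _ "X \<inter> \<Phi> ` V"]) (auto intro: openin_open_Int)
qed

text \<open>\<open>X\<close> is locally closed: near each of its points it is the zero set of
  continuous functions, so limits of \<open>X\<close> in that neighbourhood belong to
  \<open>X\<close>. Hence \<open>X\<close> is the trace of an open set on its closure.\<close>

lemma analytic_set_borel:
  assumes "analytic_set X"
  shows "X \<in> sets borel"
proof -
  have "\<forall>p\<in>X. \<exists>U. open U \<and> p \<in> U \<and> (\<forall>z\<in>U. z \<in> closure X \<longrightarrow> z \<in> X)"
  proof
    fix p assume "p \<in> X"
    then obtain U F where U: "open U" "p \<in> U" and F: "\<forall>h\<in>F. holomorphic_fun U h"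
      and eq: "X \<inter> U = {z\<in>U. \<forall>h\<in>F. h z = 0}"
      using assms[unfolded analytic_set_def, rule_format, OF \<open>p \<in> X\<close>]
      by (elim exE conjE) (rule that)
    have "z \<in> X" if z: "z \<in> U" "z \<in> closure X" for z
    proof -
      obtain s where s: "\<And>n::nat. s n \<in> X" "s \<longlonglongrightarrow> z"
        using z(2) by (auto simp: closure_sequential)
      have "\<forall>\<^sub>F n in sequentially. s n \<in> U" using s(2) U(1) z(1) by (rule topological_tendstoD)
      then have ev: "\<forall>\<^sub>F n in sequentially. s n \<in> X \<inter> U" by eventually_elim (simp add: s)
      have "h z = 0" if h: "h \<in> F" for h
      proof -
        obtain g where "\<forall>z\<in>U. (h has_derivative (\<lambda>v. \<Sum>i\<in>UNIV. g z $ i * v $ i)) (at z)"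
          using F h unfolding holomorphic_fun_def by blast
        then have "isCont h z" using z(1) has_derivative_continuous by blast
        then have "(\<lambda>n. h (s n)) \<longlonglongrightarrow> h z" using s(2) by (rule isCont_tendsto_compose)
        moreover have "(\<lambda>n. h (s n)) \<longlonglongrightarrow> 0"
          by (rule tendsto_eventually) (use ev in \<open>eventually_elim, use eq h in blast\<close>)
        ultimately show ?thesis by (rule LIMSEQ_unique)
      qed
      then have "z \<in> X \<inter> U" unfolding eq using z(1) by blast
      then show ?thesis by blast
    qed
    then show "\<exists>U. open U \<and> p \<in> U \<and> (\<forall>z\<in>U. z \<in> closure X \<longrightarrow> z \<in> X)" using U by blast
  qed
  then obtain U where U: "\<And>p. p \<in> X \<Longrightarrow> open (U p) \<and> p \<in> U p \<and> (\<forall>z\<in>U p. z \<in> closure X \<longrightarrow> z \<in> X)"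
    by metis
  have "X = (\<Union>p\<in>X. U p) \<inter> closure X"
    using U closure_subset by blast
  moreover have "open (\<Union>p\<in>X. U p)" using U by blast
  ultimately show ?thesis
    by (metis borel_closed borel_open closed_closure sets.Int)
qed

lemma openin_borel:
  assumes "X \<in> sets borel" "openin (top_of_set X) S"
  shows "S \<in> sets borel"
  using assms by (auto simp: openin_open)

section \<open>Integration by parts in charts\<close>

lemma continuous_on_UNIV_compact_support:
  fixes f :: "'a::t2_space \<Rightarrow> 'b::topological_space"
  assumes "open V" "compact K" "K \<subseteq> V" "continuous_on V f" "\<And>y. y \<notin> K \<Longrightarrow> f y = c"
  shows "continuous_on UNIV f"
proof -
  have "continuous_on (- K) f"
    by (rule continuous_on_cong[THEN iffD2, OF refl _ continuous_on_const[of _ c]]) (use assms in auto)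
  then have "continuous_on (V \<union> - K) f"
    using assms by (intro continuous_on_open_Un) (auto simp: compact_imp_closed open_Compl)
  moreover have "V \<union> - K = UNIV" using assms(3) by auto
  ultimately show ?thesis by simp
qed

lemma continuous_compact_support_bounded:
  fixes f :: "'a::topological_space \<Rightarrow> 'b::real_normed_vector"
  assumes "compact K" "continuous_on K f" "\<And>y. y \<notin> K \<Longrightarrow> f y = 0"
  shows "\<exists>B\<ge>0. \<forall>y. norm (f y) \<le> B"
proof -
  have "bounded (f ` K)"
    using assms by (intro compact_imp_bounded compact_continuous_image)
  then obtain B where "\<forall>z\<in>f ` K. norm z \<le> B" by (auto simp: bounded_iff)
  then have "norm (f y) \<le> \<bar>B\<bar>" for y
    using assms(3)[of y] by (cases "y \<in> K") (auto intro: order_trans)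
  then show ?thesis by (intro exI[of _ "\<bar>B\<bar>"]) auto
qed

text \<open>
  Translation invariance makes the integral of every difference quotient along \<open>v\<close> vanish.
\<close>

lemma integral_directional_derivative_eq_0:
  fixes w :: "'a::euclidean_space \<Rightarrow> real"
  assumes M: "sets M = sets borel" and inv: "\<And>v. distr M borel (\<lambda>y. y + v) = M"
    and L: "subspace L" "v \<in> L"
    and der: "\<And>y. (w has_derivative w' y) (at y)" and cont: "continuous_on UNIV (\<lambda>y. w' y v)"
    and K: "compact K" "K \<subseteq> V" "open V" and zero: "\<And>y. y \<notin> K \<Longrightarrow> w y = 0"
    and fin: "\<And>C. compact C \<Longrightarrow> C \<subseteq> V \<Longrightarrow> emeasure M (C \<inter> L) < \<infinity>"
  shows "integral\<^sup>L M (\<lambda>y. indicator L y * w' y v) = 0"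
proof -
  note M [measurable_cong]
  have [measurable]: "L \<in> sets borel" using closed_subspace[OF L(1)] by simp
  have contw: "continuous_on UNIV w"
    using der has_derivative_continuous by (fastforce simp: continuous_on_eq_continuous_within)
  have [measurable]: "w \<in> borel_measurable borel" "(\<lambda>y. w' y v) \<in> borel_measurable borel"
    using contw cont by (auto intro: borel_measurable_continuous_onI)
  have zero': "w' y v = 0" if "y \<notin> K" for y
  proof -
    have "(w has_derivative (\<lambda>_. 0)) (at y)"
      by (rule has_derivative_transform_within_open[OF has_derivative_const, of "- K"])
        (use that K zero in \<open>auto simp: compact_imp_closed open_Compl\<close>)
    then have "w' y = (\<lambda>_. 0)" using der has_derivative_unique by blast
    then show ?thesis by simp
  qed
  obtain B where B: "0 \<le> B" "\<And>y. norm (w' y v) \<le> B"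
    using continuous_compact_support_bounded[OF K(1) continuous_on_subset[OF cont], of] zero' by blast
  obtain B' where B': "0 \<le> B'" "\<And>y. norm (w y) \<le> B'"
    using continuous_compact_support_bounded[OF K(1) continuous_on_subset[OF contw], of] zero by blast
  obtain e where e: "e > 0" "(\<Union>x\<in>K. cball x e) \<subseteq> V"
    using compact_subset_open_imp_cball_epsilon_subset[OF K(1,3,2)] by blast
  \<comment> \<open>Shifts by at most \<open>t0\<close> along \<open>v\<close> move points by at
    most \<open>e\<close>; the summand 1 in the denominator covers \<open>v = 0\<close>.\<close>
  define t0 where "t0 = e / (norm v + 1)"
  have t0: "0 < t0" "t0 * norm v \<le> e"
  proof -
    have "0 < norm v + 1" using norm_ge_zero[of v] by linarith
    then show "0 < t0" "t0 * norm v \<le> e"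
      using e(1) by (auto simp: t0_def pos_divide_le_eq)
  qed
  \<comment> \<open>\<open>K1\<close> is swept out by shifting \<open>K\<close> back along
    \<open>v\<close>. It contains the supports of all difference quotients used below, and it stays
    in \<open>V\<close>.\<close>
  define K1 where "K1 = (\<lambda>(y, t). y - t *\<^sub>R v) ` (K \<times> {0..t0})"
  have cK1: "compact K1"
    unfolding K1_def using K(1)
    by (intro compact_continuous_image compact_Times) (auto intro!: continuous_intros simp: split_def)
  have K1V: "K1 \<subseteq> V"
  proof
    fix z assume "z \<in> K1"
    then obtain y t where z: "y \<in> K" "t \<in> {0..t0}" "z = y - t *\<^sub>R v" by (auto simp: K1_def)
    have "t * norm v \<le> t0 * norm v" using z(2) by (intro mult_right_mono) auto
    then have "dist y z \<le> e" using z t0(2) by (simp add: dist_norm)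
    then have "z \<in> (\<Union>x\<in>K. cball x e)" using z(1) by (intro UN_I) auto
    then show "z \<in> V" using e(2) by (rule subsetD[rotated])
  qed
  have [measurable]: "K1 \<in> sets borel" "K \<in> sets borel"
    using cK1 K(1) by (auto intro: borel_compact)
  define \<tau> where "\<tau> n = t0 / real (Suc n)" for n
  have \<tau>: "0 < \<tau> n" "\<tau> n \<le> t0" for n
    using t0(1) by (auto simp: \<tau>_def field_simps)
  have \<tau>lim: "filterlim \<tau> (at 0) sequentially"
  proof (rule filterlim_atI)
    show "\<tau> \<longlonglongrightarrow> 0"
      unfolding \<tau>_def by (intro LIMSEQ_Suc lim_const_over_n)
    show "\<forall>\<^sub>F n in sequentially. \<tau> n \<noteq> 0" using \<tau>(1) by (auto intro!: always_eventually less_imp_neq[symmetric])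
  qed
  define d where "d n y = (w (y + \<tau> n *\<^sub>R v) - w y) / \<tau> n" for n y
  have hder: "((\<lambda>t. w (y + t *\<^sub>R v)) has_real_derivative w' (y + t *\<^sub>R v) v) (at t)" for y and t :: real
  proof -
    have "((\<lambda>t::real. y + t *\<^sub>R v) has_derivative (\<lambda>t. t *\<^sub>R v)) (at t)"
      by (auto intro!: derivative_eq_intros)
    from has_derivative_compose[OF this der]
    have "((\<lambda>t. w (y + t *\<^sub>R v)) has_derivative (\<lambda>s. w' (y + t *\<^sub>R v) (s *\<^sub>R v))) (at t)" .
    moreover have "linear (w' (y + t *\<^sub>R v))" using der has_derivative_linear by blast
    then have "(\<lambda>s. w' (y + t *\<^sub>R v) (s *\<^sub>R v)) = (*) (w' (y + t *\<^sub>R v) v)"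
      by (intro ext) (simp add: linear_scale)
    ultimately show ?thesis
      unfolding has_field_derivative_def by simp
  qed
  have d_lim: "(\<lambda>n. d n y) \<longlonglongrightarrow> w' y v" for y
  proof -
    have "((\<lambda>t. w (y + t *\<^sub>R v)) has_vector_derivative w' y v) (at 0)"
      using hder[of y 0] by (simp add: has_real_derivative_iff_has_vector_derivative)
    from filterlim_compose[OF has_vector_derivative_imp_quotient_tendsto[OF this] \<tau>lim]
    show ?thesis by (simp add: d_def divide_inverse_commute)
  qed
  have d_bound: "norm (d n y) \<le> B * indicator K1 y" for n y
  proof -
    obtain z where z: "0 < z" "z < \<tau> n" "w (y + \<tau> n *\<^sub>R v) - w (y + 0 *\<^sub>R v) = (\<tau> n - 0) * w' (y + z *\<^sub>R v) v"
      using MVT2[OF \<tau>(1)[of n], of "\<lambda>t. w (y + t *\<^sub>R v)" "\<lambda>t. w' (y + t *\<^sub>R v) v"] hder by blast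
    then have d: "d n y = w' (y + z *\<^sub>R v) v" using \<tau>(1)[of n] by (simp add: d_def)
    show ?thesis
    proof (cases "y \<in> K1")
      case True
      then show ?thesis using B d by simp
    next
      case False
      have "y + z *\<^sub>R v \<notin> K"
      proof
        assume "y + z *\<^sub>R v \<in> K"
        then have "(\<lambda>(y, t). y - t *\<^sub>R v) (y + z *\<^sub>R v, z) \<in> K1"
          unfolding K1_def using z \<tau>(2)[of n] by (intro imageI) auto
        then show False using False by simp
      qed
      then show ?thesis using zero' d False by simp
    qed
  qed
  have int_w: "integrable M (\<lambda>y. indicator L y * w y)"
    by (rule integrableI_bounded_set[where A = "K \<inter> L" and B = B'])
      (use fin[OF K(1,2)] zero B' in \<open>auto simp: indicator_def\<close>)
  have int_d0: "integral\<^sup>L M (\<lambda>y. indicator L y * d n y) = 0" for n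
  proof -
    \<comment> \<open>Since \<open>v\<close> lies in \<open>L\<close>, the translation maps
      \<open>L\<close> onto itself, so invariance of \<open>M\<close> passes to the part of
      \<open>M\<close> on \<open>L\<close>.\<close>
    have shift: "indicator L (y + \<tau> n *\<^sub>R v) = (indicator L y :: real)" for y
    proof -
      have "y + \<tau> n *\<^sub>R v \<in> L \<longleftrightarrow> y \<in> L"
        using L by (metis add_diff_cancel_right' subspace_add subspace_diff subspace_scale)
      then show ?thesis by (simp add: indicator_def)
    qed
    have m: "(\<lambda>y. y + \<tau> n *\<^sub>R v) \<in> measurable M borel" by measurable
    have "integrable (distr M borel (\<lambda>y. y + \<tau> n *\<^sub>R v)) (\<lambda>y. indicator L y * w y)"
      unfolding inv by (rule int_w)
    then have i: "integrable M (\<lambda>y. indicator L y * w (y + \<tau> n *\<^sub>R v))"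
      by (rule integrable_distr[OF m, of "\<lambda>y. indicator L y * w y", unfolded shift])
    have "integral\<^sup>L M (\<lambda>y. indicator L y * w y) = integral\<^sup>L (distr M borel (\<lambda>y. y + \<tau> n *\<^sub>R v)) (\<lambda>y. indicator L y * w y)"
      unfolding inv ..
    also have "\<dots> = integral\<^sup>L M (\<lambda>y. indicator L (y + \<tau> n *\<^sub>R v) * w (y + \<tau> n *\<^sub>R v))"
      by (rule integral_distr[OF m]) measurable
    also have "\<dots> = integral\<^sup>L M (\<lambda>y. indicator L y * w (y + \<tau> n *\<^sub>R v))"
      by (simp add: shift)
    finally have eq: "integral\<^sup>L M (\<lambda>y. indicator L y * w y) = integral\<^sup>L M (\<lambda>y. indicator L y * w (y + \<tau> n *\<^sub>R v))" .
    have "integral\<^sup>L M (\<lambda>y. indicator L y * d n y) =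
        integral\<^sup>L M (\<lambda>y. (indicator L y * w (y + \<tau> n *\<^sub>R v) - indicator L y * w y) / \<tau> n)"
      by (simp add: d_def right_diff_distrib)
    also have "\<dots> = 0"
      using eq i int_w by simp
    finally show ?thesis .
  qed
  have "(\<lambda>n. integral\<^sup>L M (\<lambda>y. indicator L y * d n y)) \<longlonglongrightarrow> integral\<^sup>L M (\<lambda>y. indicator L y * w' y v)"
  proof (rule integral_dominated_convergence[where w = "\<lambda>y. B * indicator (K1 \<inter> L) y"])
    show "integrable M (\<lambda>y. B * indicator (K1 \<inter> L) y)"
      by (rule integrableI_bounded_set[where A = "K1 \<inter> L" and B = B])
        (use fin[OF cK1 K1V] B in \<open>auto simp: indicator_def\<close>)
    show "AE y in M. (\<lambda>n. indicator L y * d n y) \<longlonglongrightarrow> indicator L y * w' y v"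
      by (intro AE_I2 tendsto_mult tendsto_const d_lim)
    show "AE y in M. norm (indicator L y * d n y) \<le> B * indicator (K1 \<inter> L) y" for n
    proof (rule AE_I2)
      fix y
      show "norm (indicator L y * d n y) \<le> B * indicator (K1 \<inter> L) y"
        using d_bound[of n y] by (cases "y \<in> L") (auto simp: indicator_inter_arith)
    qed
    show "(\<lambda>y. indicator L y * d n y) \<in> borel_measurable M" for n
      unfolding d_def by measurable
  qed measurable
  then show ?thesis
    unfolding int_d0 by (simp add: LIMSEQ_const_iff)
qed

lemma GDERIV_imp_continuous_on:
  assumes "\<And>x. GDERIV u x :> g x"
  shows "continuous_on S u"
  using assms unfolding gderiv_def by (auto intro!: continuous_at_imp_continuous_on has_derivative_continuous)

lemma test_function_support:
  assumes "test_function V \<phi> \<gamma>"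
  shows "\<exists>K. compact K \<and> K \<subseteq> V \<and> (\<forall>y. y \<notin> K \<longrightarrow> \<phi> y = 0) \<and> (\<forall>y. y \<notin> K \<longrightarrow> \<gamma> y = 0)"
proof -
  obtain K where K: "compact K" "K \<subseteq> V" "\<And>x. x \<notin> K \<Longrightarrow> \<phi> x = 0" and \<phi>: "\<And>x. GDERIV \<phi> x :> \<gamma> x"
    using assms by (auto simp: test_function_def)
  have "\<gamma> y = 0" if "y \<notin> K" for y
  proof -
    have "(\<phi> has_derivative (\<lambda>_. 0)) (at y)"
      by (rule has_derivative_transform_within_open[OF has_derivative_const, of "- K"])
        (use that K in \<open>auto simp: compact_imp_closed open_Compl\<close>)
    then have "(\<lambda>h. h \<bullet> \<gamma> y) = (\<lambda>_. 0)"
      using \<phi>[of y] has_derivative_unique unfolding gderiv_def by blast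
    then have "\<gamma> y \<bullet> \<gamma> y = 0" by (rule fun_cong)
    then show ?thesis by simp
  qed
  with K show ?thesis by blast
qed

section \<open>Measure comparison and integration by parts for ambient functions\<close>

context C1_chart
begin

lemma compact_Int_L: "compact K \<Longrightarrow> compact (K \<inter> L)"
  by (rule compact_Int_closed[OF _ closed_subspace[OF subspace_L]])

lemma L_borel [measurable]: "L \<in> sets borel"
  using closed_subspace[OF subspace_L] by simp

lemma V_borel [measurable]: "V \<in> sets borel"
  using open_V by simp

lemma compact_chart_image:
  assumes "compact K" "K \<subseteq> V"
  shows "compact (\<Phi> ` (K \<inter> L))"
  using assms by (intro compact_continuous_image compact_Int_L continuous_on_subset[OF continuous_on_chart]) auto

text \<open>Nothing is known about \<open>\<Phi>\<close> outside \<open>V\<close>. Multiplying it by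
  the indicator of \<open>V\<close> gives a globally Borel map that agrees with it where the outer
  indicator is nonzero.\<close>

lemma borel_measurable_chart:
  fixes h :: "complex ^ 'N \<Rightarrow> 'b::{real_normed_vector, second_countable_topology}"
  assumes [measurable]: "h \<in> borel_measurable borel"
  shows "(\<lambda>y. indicator (V \<inter> L) y *\<^sub>R h (\<Phi> y)) \<in> borel_measurable borel"
proof -
  have [measurable]: "(\<lambda>y. indicator V y *\<^sub>R \<Phi> y) \<in> borel_measurable borel"
    by (intro borel_measurable_continuous_on_indicator V_borel continuous_on_chart)
  have "(\<lambda>y. indicator (V \<inter> L) y *\<^sub>R h (indicator V y *\<^sub>R \<Phi> y)) \<in> borel_measurable borel"
    by measurable
  moreover have "(\<lambda>y. indicator (V \<inter> L) y *\<^sub>R h (indicator V y *\<^sub>R \<Phi> y)) = (\<lambda>y. indicator (V \<inter> L) y *\<^sub>R h (\<Phi> y))"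
    by (auto simp: indicator_def)
  ultimately show ?thesis by simp
qed

text \<open>The inverse chart is Lipschitz on the compact image of \<open>K\<close>, and it maps the
  trace of \<open>A\<close> on the image of \<open>K \<inter> L\<close> over the preimage of
  \<open>A\<close>. The constant depends on \<open>K\<close> but not on \<open>A\<close>.\<close>

lemma hausdorff_chart_preimage:
  assumes "0 < s" "compact K" "K \<subseteq> V"
  shows "\<exists>c. \<forall>A\<in>sets borel. {y \<in> K \<inter> L. \<Phi> y \<in> A} \<in> sets borel \<and>
    emeasure (hausdorff_measure s) {y \<in> K \<inter> L. \<Phi> y \<in> A} \<le> ennreal c * emeasure (hausdorff_measure s) (A \<inter> \<Phi> ` (K \<inter> L))"
proof -
  have "compact (\<Phi> ` K)" "\<Phi> ` K \<subseteq> \<Phi> ` V"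
    using assms by (auto intro!: compact_continuous_image continuous_on_subset[OF continuous_on_chart])
  then obtain B where B: "B > 0" "B-lipschitz_on (\<Phi> ` K) \<Psi>"
    using C1_imp_lipschitz_on_compact[OF open_image deriv_inv cont_inv] by blast
  have "{y \<in> K \<inter> L. \<Phi> y \<in> A} \<in> sets borel \<and>
    emeasure (hausdorff_measure s) {y \<in> K \<inter> L. \<Phi> y \<in> A} \<le> ennreal (B powr s) * emeasure (hausdorff_measure s) (A \<inter> \<Phi> ` (K \<inter> L))"
    if A: "A \<in> sets borel" for A
  proof
    have "(\<lambda>y. indicator (V \<inter> L) y *\<^sub>R (indicator A (\<Phi> y) :: real)) \<in> borel_measurable borel"
      using A by (intro borel_measurable_chart) auto
    then have "(\<lambda>y. indicator (V \<inter> L) y *\<^sub>R (indicator A (\<Phi> y) :: real)) -` {1} \<in> sets borel"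
      by (rule measurable_sets_borel) auto
    moreover have "K \<inter> L \<in> sets borel" using compact_Int_L assms(2) by (intro borel_compact)
    ultimately have "(K \<inter> L) \<inter> (\<lambda>y. indicator (V \<inter> L) y *\<^sub>R (indicator A (\<Phi> y) :: real)) -` {1} \<in> sets borel"
      by (rule sets.Int[rotated])
    moreover have "(K \<inter> L) \<inter> (\<lambda>y. indicator (V \<inter> L) y *\<^sub>R (indicator A (\<Phi> y) :: real)) -` {1} = {y \<in> K \<inter> L. \<Phi> y \<in> A}"
      using assms(3) by (auto simp: indicator_def split: if_splits)
    ultimately show m: "{y \<in> K \<inter> L. \<Phi> y \<in> A} \<in> sets borel" by simp
    have "{y \<in> K \<inter> L. \<Phi> y \<in> A} \<subseteq> \<Psi> ` (A \<inter> \<Phi> ` (K \<inter> L))"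
    proof
      fix y assume "y \<in> {y \<in> K \<inter> L. \<Phi> y \<in> A}"
      then show "y \<in> \<Psi> ` (A \<inter> \<Phi> ` (K \<inter> L))"
        using assms(3) inverse[of y] by (intro image_eqI[of _ _ "\<Phi> y"]) auto
    qed
    then have "hausdorff_outer s {y \<in> K \<inter> L. \<Phi> y \<in> A} \<le> hausdorff_outer s (\<Psi> ` (A \<inter> \<Phi> ` (K \<inter> L)))"
      by (rule hausdorff_outer_mono)
    also have "\<dots> \<le> ennreal (B powr s) * hausdorff_outer s (A \<inter> \<Phi> ` (K \<inter> L))"
      using B assms(1) by (intro hausdorff_outer_lipschitz_image) (auto intro: lipschitz_on_subset)
    finally show "emeasure (hausdorff_measure s) {y \<in> K \<inter> L. \<Phi> y \<in> A} \<le> ennreal (B powr s) * emeasure (hausdorff_measure s) (A \<inter> \<Phi> ` (K \<inter> L))"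
      using m sets.Int[OF A borel_compact[OF compact_chart_image[OF assms(2,3)]]]
      by (simp only: emeasure_hausdorff_measure)
  qed
  then show ?thesis by blast
qed

text \<open>The comparison of measures of sets says that the pushforward \<open>N1\<close> is at
  most the multiple \<open>N2\<close> of the measure on the image. Monotonicity in the measure
  extends it to all nonnegative Borel functions.\<close>

lemma nn_integral_chart_le:
  assumes "0 < s" "compact K" "K \<subseteq> V"
  shows "\<exists>c. \<forall>h\<in>borel_measurable borel. (\<integral>\<^sup>+y. h (\<Phi> y) * indicator (K \<inter> L) y \<partial>hausdorff_measure s)
    \<le> ennreal c * (\<integral>\<^sup>+x. h x * indicator (\<Phi> ` (K \<inter> L)) x \<partial>hausdorff_measure s)"
proof -
  let ?H = "hausdorff_measure s :: (complex ^ 'N) measure"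
  have [measurable]: "K \<inter> L \<in> sets borel" "\<Phi> ` (K \<inter> L) \<in> sets borel"
    using compact_Int_L compact_chart_image assms by (auto intro: borel_compact)
  have [measurable]: "(\<lambda>y. indicator V y *\<^sub>R \<Phi> y) \<in> borel_measurable borel"
    by (intro borel_measurable_continuous_on_indicator V_borel continuous_on_chart)
  obtain c where c: "\<And>A. A \<in> sets borel \<Longrightarrow> emeasure ?H {y \<in> K \<inter> L. \<Phi> y \<in> A} \<le> ennreal c * emeasure ?H (A \<inter> \<Phi> ` (K \<inter> L))"
    using hausdorff_chart_preimage[OF assms] by blast
  define N1 where "N1 = distr (density ?H (indicator (K \<inter> L))) borel (\<lambda>y. indicator V y *\<^sub>R \<Phi> y)"
  define N2 where "N2 = scale_measure (ennreal c) (density ?H (indicator (\<Phi> ` (K \<inter> L))))"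
  have sets: "sets N1 = sets N2" by (simp add: N1_def N2_def)
  have "N1 \<le> N2"
  proof (subst le_measure[OF sets], intro ballI)
    fix A assume "A \<in> sets N1"
    then have A [measurable]: "A \<in> sets borel" by (simp add: N1_def)
    have pre: "(\<lambda>y. indicator V y *\<^sub>R \<Phi> y) -` A \<in> sets borel"
      by (rule measurable_sets_borel) measurable
    have "emeasure N1 A = emeasure (density ?H (indicator (K \<inter> L))) ((\<lambda>y. indicator V y *\<^sub>R \<Phi> y) -` A)"
      by (simp add: N1_def emeasure_distr)
    also have "\<dots> = emeasure ?H ((K \<inter> L) \<inter> (\<lambda>y. indicator V y *\<^sub>R \<Phi> y) -` A)"
      using pre by (simp add: emeasure_density nn_integral_indicator flip: indicator_inter_arith)
    also have "(K \<inter> L) \<inter> (\<lambda>y. indicator V y *\<^sub>R \<Phi> y) -` A = {y \<in> K \<inter> L. \<Phi> y \<in> A}"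
      using assms(3) by (auto simp: indicator_def)
    also have "emeasure ?H \<dots> \<le> ennreal c * emeasure ?H (A \<inter> \<Phi> ` (K \<inter> L))"
      by (rule c[OF A])
    also have "emeasure ?H (A \<inter> \<Phi> ` (K \<inter> L)) = emeasure (density ?H (indicator (\<Phi> ` (K \<inter> L)))) A"
      by (simp add: emeasure_density nn_integral_indicator Int_commute flip: indicator_inter_arith)
    finally show "emeasure N1 A \<le> emeasure N2 A" by (simp add: N2_def)
  qed
  have "(\<integral>\<^sup>+y. h (\<Phi> y) * indicator (K \<inter> L) y \<partial>?H) \<le> ennreal c * (\<integral>\<^sup>+x. h x * indicator (\<Phi> ` (K \<inter> L)) x \<partial>?H)"
    if [measurable]: "h \<in> borel_measurable borel" for h
  proof -
    have "(\<integral>\<^sup>+y. h (\<Phi> y) * indicator (K \<inter> L) y \<partial>?H) = (\<integral>\<^sup>+y. indicator (K \<inter> L) y * h (indicator V y *\<^sub>R \<Phi> y) \<partial>?H)"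
      using assms(3) by (intro nn_integral_cong) (auto simp: indicator_def)
    also have "\<dots> = (\<integral>\<^sup>+y. h (indicator V y *\<^sub>R \<Phi> y) \<partial>density ?H (indicator (K \<inter> L)))"
      by (subst nn_integral_density) auto
    also have "\<dots> = (\<integral>\<^sup>+x. h x \<partial>N1)"
      unfolding N1_def by (subst nn_integral_distr) auto
    also have "\<dots> \<le> (\<integral>\<^sup>+x. h x \<partial>N2)"
      by (rule nn_integral_mono_measure[OF sets \<open>N1 \<le> N2\<close>])
    also have "\<dots> = ennreal c * (\<integral>\<^sup>+x. h x \<partial>density ?H (indicator (\<Phi> ` (K \<inter> L))))"
      unfolding N2_def by (subst nn_integral_scale_measure) auto
    also have "(\<integral>\<^sup>+x. h x \<partial>density ?H (indicator (\<Phi> ` (K \<inter> L)))) = (\<integral>\<^sup>+x. h x * indicator (\<Phi> ` (K \<inter> L)) x \<partial>?H)"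
      by (subst nn_integral_density) (auto simp: mult.commute)
    finally show ?thesis .
  qed
  then show ?thesis by blast
qed

text \<open>The product of \<open>u \<circ> \<Phi>\<close> and \<open>\<phi>\<close> has compact
  support in \<open>V\<close>, so its extension by 0 is differentiable everywhere, and the integral
  of its derivative along \<open>v\<close> vanishes. The product rule splits this integral into the
  two sides.\<close>

lemma integral_by_parts_C1:
  assumes "0 < s" and u: "\<And>x. GDERIV u x :> g x" and contg: "continuous_on UNIV g"
    and test: "test_function V \<phi> \<gamma>" and v: "v \<in> L"
    and fin: "\<And>C. compact C \<Longrightarrow> C \<subseteq> V \<Longrightarrow> emeasure (hausdorff_measure s) (C \<inter> L) < \<infinity>"
  shows "(LINT y:(V \<inter> L)|hausdorff_measure s. u (\<Phi> y) * (\<gamma> y \<bullet> v)) =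
     - (LINT y:(V \<inter> L)|hausdorff_measure s. (g (\<Phi> y) \<bullet> \<Phi>' y v) * \<phi> y)"
proof -
  let ?H = "hausdorff_measure s :: (complex ^ 'N) measure"
  obtain K where K: "compact K" "K \<subseteq> V" "\<And>y. y \<notin> K \<Longrightarrow> \<phi> y = 0" and \<gamma>0: "\<And>y. y \<notin> K \<Longrightarrow> \<gamma> y = 0"
    using test_function_support[OF test] by blast
  have \<phi>: "\<And>x. GDERIV \<phi> x :> \<gamma> x" and cont\<gamma>: "continuous_on UNIV \<gamma>"
    using test by (auto simp: test_function_def)
  have contu: "continuous_on UNIV u" using u by (rule GDERIV_imp_continuous_on)
  have cont\<phi>: "continuous_on UNIV \<phi>" using \<phi> by (rule GDERIV_imp_continuous_on)
  define w where "w y = (if y \<in> V then u (\<Phi> y) * \<phi> y else 0)" for y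
  \<comment> \<open>\<open>a\<close> and \<open>b\<close> are the two terms of the product rule,
    extended by 0 outside \<open>V\<close>; their values at \<open>h = v\<close> are the two
    integrands up to sign.\<close>
  define a where "a y h = (if y \<in> V then u (\<Phi> y) * (h \<bullet> \<gamma> y) else 0)" for y h
  define b where "b y h = (if y \<in> V then (\<Phi>' y h \<bullet> g (\<Phi> y)) * \<phi> y else 0)" for y h
  have der: "(w has_derivative (\<lambda>h. a y h + b y h)) (at y)" for y
  proof (cases "y \<in> V")
    case True
    have "((\<lambda>y. u (\<Phi> y)) has_derivative (\<lambda>h. \<Phi>' y h \<bullet> g (\<Phi> y))) (at y)"
      using has_derivative_compose[OF deriv[OF True] u[unfolded gderiv_def]] .
    moreover have "(\<phi> has_derivative (\<lambda>h. h \<bullet> \<gamma> y)) (at y)" using \<phi> by (simp add: gderiv_def)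
    ultimately have "((\<lambda>y. u (\<Phi> y) * \<phi> y) has_derivative (\<lambda>h. u (\<Phi> y) * (h \<bullet> \<gamma> y) + (\<Phi>' y h \<bullet> g (\<Phi> y)) * \<phi> y)) (at y)"
      by (rule has_derivative_mult)
    then have "(w has_derivative (\<lambda>h. u (\<Phi> y) * (h \<bullet> \<gamma> y) + (\<Phi>' y h \<bullet> g (\<Phi> y)) * \<phi> y)) (at y)"
      by (rule has_derivative_transform_within_open[OF _ open_V True]) (simp add: w_def)
    then show ?thesis using True by (simp add: a_def b_def)
  next
    case False
    then have "y \<notin> K" using K(2) by blast
    then have "(w has_derivative (\<lambda>_. 0)) (at y)"
      by (intro has_derivative_transform_within_open[OF has_derivative_const, of "- K"])
        (use K in \<open>auto simp: compact_imp_closed open_Compl w_def\<close>)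
    then show ?thesis using False by (simp add: a_def b_def)
  qed
  have cont\<Phi>: "continuous_on V (\<lambda>y. k (\<Phi> y))" if "continuous_on UNIV k" for k :: "complex ^ 'N \<Rightarrow> 'c::topological_space"
    by (rule continuous_on_compose2[OF that continuous_on_chart]) auto
  have cont_a: "continuous_on UNIV (\<lambda>y. a y v)"
  proof (rule continuous_on_UNIV_compact_support[OF open_V K(1,2)])
    have "continuous_on V (\<lambda>y. u (\<Phi> y) * (v \<bullet> \<gamma> y))"
      by (intro continuous_intros cont\<Phi>[OF contu] continuous_on_subset[OF cont\<gamma>]) auto
    then show "continuous_on V (\<lambda>y. a y v)"
      by (rule continuous_on_eq) (simp add: a_def)
  qed (simp add: a_def \<gamma>0)
  have cont_b: "continuous_on UNIV (\<lambda>y. b y v)"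
  proof (rule continuous_on_UNIV_compact_support[OF open_V K(1,2)])
    have "continuous_on V (\<lambda>y. (\<Phi>' y v \<bullet> g (\<Phi> y)) * \<phi> y)"
      by (intro continuous_intros cont\<Phi>[OF contg] continuous_on_deriv continuous_on_subset[OF cont\<phi>]) auto
    then show "continuous_on V (\<lambda>y. b y v)"
      by (rule continuous_on_eq) (simp add: b_def)
  qed (simp add: b_def K(3))
  have int: "integrable ?H (\<lambda>y. indicator L y * k y)" if k: "continuous_on UNIV k" "\<And>y. y \<notin> K \<Longrightarrow> k y = 0" for k :: "complex ^ 'N \<Rightarrow> real"
  proof -
    obtain B where B: "\<And>y. norm (k y) \<le> B"
      using continuous_compact_support_bounded[OF K(1) continuous_on_subset[OF k(1)], of] k(2) by blast
    have [measurable]: "k \<in> borel_measurable borel" using k(1) by (rule borel_measurable_continuous_onI)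
    have [measurable]: "K \<inter> L \<in> sets borel" using compact_Int_L[OF K(1)] by (rule borel_compact)
    show ?thesis
      by (rule integrableI_bounded_set[where A = "K \<inter> L" and B = B])
        (use fin[OF K(1,2)] k(2) B in \<open>auto simp: indicator_def\<close>)
  qed
  have "integral\<^sup>L ?H (\<lambda>y. indicator L y * (a y v + b y v)) = 0"
    by (rule integral_directional_derivative_eq_0[OF sets_hausdorff_measure
        distr_hausdorff_measure_translation[OF \<open>0 < s\<close>] subspace_L v der continuous_on_add[OF cont_a cont_b] K(1,2) open_V _ fin])
      (simp_all add: w_def K(3))
  moreover have "integral\<^sup>L ?H (\<lambda>y. indicator L y * (a y v + b y v)) =
      integral\<^sup>L ?H (\<lambda>y. indicator L y * a y v) + integral\<^sup>L ?H (\<lambda>y. indicator L y * b y v)"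
    unfolding distrib_left
    by (intro Bochner_Integration.integral_add int cont_a cont_b) (simp_all add: a_def b_def \<gamma>0 K(3))
  moreover have "(LINT y:(V \<inter> L)|?H. u (\<Phi> y) * (\<gamma> y \<bullet> v)) = integral\<^sup>L ?H (\<lambda>y. indicator L y * a y v)"
    unfolding set_lebesgue_integral_def
    by (intro Bochner_Integration.integral_cong) (auto simp: a_def indicator_def inner_commute)
  moreover have "(LINT y:(V \<inter> L)|?H. (g (\<Phi> y) \<bullet> \<Phi>' y v) * \<phi> y) = integral\<^sup>L ?H (\<lambda>y. indicator L y * b y v)"
    unfolding set_lebesgue_integral_def
    by (intro Bochner_Integration.integral_cong) (auto simp: b_def indicator_def inner_commute)
  ultimately show ?thesis by linarith
qed

end

section \<open>Integration by parts for dominated limits\<close>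

lemma le_1_plus_power2: "t \<le> 1 + t\<^sup>2" for t :: real
proof -
  have "0 \<le> (t - 1/2)\<^sup>2" by simp
  then show ?thesis by (simp add: power2_diff field_simps)
qed

lemma C1_approx_AE_bounds:
  assumes "C1_approx M f D u g b"
  shows "AE x in M. \<bar>f x\<bar> \<le> b x" "AE x in M. norm (D x) \<le> b x"
proof -
  show "AE x in M. \<bar>f x\<bar> \<le> b x"
    using C1_approxD(7)[OF assms]
  proof eventually_elim
    case (elim x)
    then have "(\<lambda>k. \<bar>u k x\<bar>) \<longlonglongrightarrow> \<bar>f x\<bar>" by (intro tendsto_rabs) simp
    then show ?case by (rule LIMSEQ_le_const2) (use elim in auto)
  qed
  show "AE x in M. norm (D x) \<le> b x"
    using C1_approxD(7)[OF assms]
  proof eventually_elim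
    case (elim x)
    then have "(\<lambda>k. norm (g k x)) \<longlonglongrightarrow> norm (D x)" by (intro tendsto_norm) simp
    then show ?case by (rule LIMSEQ_le_const2) (use elim in auto)
  qed
qed

lemma C1_limit_power2_finite:
  assumes "C1_limit M f D"
  shows "(\<integral>\<^sup>+x. ennreal ((f x)\<^sup>2) \<partial>M) < \<infinity>" "(\<integral>\<^sup>+x. ennreal ((norm (D x))\<^sup>2) \<partial>M) < \<infinity>"
proof -
  obtain u g b where a: "C1_approx M f D u g b"
    using assms unfolding C1_limit_def by blast
  have "(\<integral>\<^sup>+x. ennreal ((f x)\<^sup>2) \<partial>M) \<le> (\<integral>\<^sup>+x. ennreal ((b x)\<^sup>2) \<partial>M)"
  proof (intro nn_integral_mono_AE)
    show "AE x in M. ennreal ((f x)\<^sup>2) \<le> ennreal ((b x)\<^sup>2)"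
      using C1_approx_AE_bounds(1)[OF a]
    proof eventually_elim
      case (elim x)
      then have "\<bar>f x\<bar>\<^sup>2 \<le> (b x)\<^sup>2" by (intro power_mono) auto
      then show ?case by (intro ennreal_leI) simp
    qed
  qed
  then show "(\<integral>\<^sup>+x. ennreal ((f x)\<^sup>2) \<partial>M) < \<infinity>"
    using C1_approxD(6)[OF a] by (rule le_less_trans)
  have "(\<integral>\<^sup>+x. ennreal ((norm (D x))\<^sup>2) \<partial>M) \<le> (\<integral>\<^sup>+x. ennreal ((b x)\<^sup>2) \<partial>M)"
  proof (intro nn_integral_mono_AE)
    show "AE x in M. ennreal ((norm (D x))\<^sup>2) \<le> ennreal ((b x)\<^sup>2)"
      using C1_approx_AE_bounds(2)[OF a]
      by eventually_elim (intro ennreal_leI power_mono, auto)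
  qed
  then show "(\<integral>\<^sup>+x. ennreal ((norm (D x))\<^sup>2) \<partial>M) < \<infinity>"
    using C1_approxD(6)[OF a] by (rule le_less_trans)
qed

context C1_chart
begin

text \<open>Dominated convergence on both sides of the formula for the approximating functions.
  Convergence and domination are known almost everywhere on \<open>\<Omega>\<close> and have to be
  carried back to the chart domain; the test function confines everything to a compact
  \<open>K\<close>, where the measure comparison applies.\<close>

lemma integral_by_parts_limit:
  assumes "0 < s" and \<Omega> [measurable]: "\<Omega> \<in> sets borel" and sub: "\<Phi> ` (V \<inter> L) \<subseteq> \<Omega>"
    and lim: "C1_limit (density (hausdorff_measure s) (indicator \<Omega>)) f D"
    and test: "test_function V \<phi> \<gamma>" and v: "v \<in> L"
    and fin: "\<And>C. compact C \<Longrightarrow> C \<subseteq> \<Omega> \<Longrightarrow> emeasure (hausdorff_measure s) C < \<infinity>"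
  shows "(LINT y:(V \<inter> L)|hausdorff_measure s. f (\<Phi> y) * (\<gamma> y \<bullet> v)) =
     - (LINT y:(V \<inter> L)|hausdorff_measure s. (D (\<Phi> y) \<bullet> \<Phi>' y v) * \<phi> y)"
proof -
  let ?H = "hausdorff_measure s :: (complex ^ 'N) measure"
  let ?M = "density ?H (indicator \<Omega>)"
  obtain u g b where "C1_approx ?M f D u g b"
    using lim unfolding C1_limit_def by blast
  note a = C1_approxD[OF this]
  obtain K where K: "compact K" "K \<subseteq> V" "\<And>y. y \<notin> K \<Longrightarrow> \<phi> y = 0" and \<gamma>0: "\<And>y. y \<notin> K \<Longrightarrow> \<gamma> y = 0"
    using test_function_support[OF test] by blast
  have \<phi>: "\<And>x. GDERIV \<phi> x :> \<gamma> x" and cont\<gamma>: "continuous_on UNIV \<gamma>"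
    using test by (auto simp: test_function_def)
  have cont\<phi>: "continuous_on UNIV \<phi>" using \<phi> by (rule GDERIV_imp_continuous_on)
  have [measurable]: "\<phi> \<in> borel_measurable borel" "\<gamma> \<in> borel_measurable borel"
    using cont\<phi> cont\<gamma> by (auto intro: borel_measurable_continuous_onI)
  have [measurable]: "K \<in> sets borel" using K(1) by (rule borel_compact)
  \<comment> \<open>Local finiteness of the measure on \<open>L\<close> is inherited from
    \<open>\<Omega>\<close> through the inverse chart.\<close>
  have finKL: "emeasure ?H (C \<inter> L) < \<infinity>" if C: "compact C" "C \<subseteq> V" for C
  proof -
    obtain c where "\<forall>A\<in>sets borel. {y \<in> C \<inter> L. \<Phi> y \<in> A} \<in> sets borel \<and>
        emeasure ?H {y \<in> C \<inter> L. \<Phi> y \<in> A} \<le> ennreal c * emeasure ?H (A \<inter> \<Phi> ` (C \<inter> L))"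
      using hausdorff_chart_preimage[OF \<open>0 < s\<close> C] by (elim exE)
    from bspec[OF this, of UNIV] have c: "emeasure ?H {y \<in> C \<inter> L. \<Phi> y \<in> UNIV} \<le> ennreal c * emeasure ?H (UNIV \<inter> \<Phi> ` (C \<inter> L))"
      by simp
    have "\<Phi> ` (C \<inter> L) \<subseteq> \<Omega>" using sub C by blast
    then have "emeasure ?H (\<Phi> ` (C \<inter> L)) < \<infinity>"
      by (rule fin[OF compact_chart_image[OF C]])
    then have "ennreal c * emeasure ?H (\<Phi> ` (C \<inter> L)) < \<infinity>"
      by (simp add: ennreal_mult_less_top)
    moreover have "emeasure ?H (C \<inter> L) \<le> ennreal c * emeasure ?H (\<Phi> ` (C \<inter> L))"
      using c by (simp add: Int_def)
    ultimately show ?thesis by (rule le_less_trans[rotated])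
  qed
  have KL\<Omega>: "\<Phi> ` (K \<inter> L) \<subseteq> \<Omega>" using sub K(2) by blast
  \<comment> \<open>The preimage of a null set is null, by the comparison constant on
    \<open>K\<close>.\<close>
  have transfer: "AE y in ?H. y \<in> K \<inter> L \<longrightarrow> P (\<Phi> y)" if P: "AE x in ?M. P x" for P
  proof -
    have "AE x in ?H. x \<in> \<Omega> \<longrightarrow> P x"
      using P by (subst (asm) AE_density) (auto elim!: AE_mp simp: indicator_def)
    then obtain N where N: "{x \<in> space ?H. \<not> (x \<in> \<Omega> \<longrightarrow> P x)} \<subseteq> N" "emeasure ?H N = 0" "N \<in> sets ?H"
      by (rule AE_E)
    then have Nb: "N \<in> sets borel" by simp
    obtain c where "\<forall>A\<in>sets borel. {y \<in> K \<inter> L. \<Phi> y \<in> A} \<in> sets borel \<and>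
        emeasure ?H {y \<in> K \<inter> L. \<Phi> y \<in> A} \<le> ennreal c * emeasure ?H (A \<inter> \<Phi> ` (K \<inter> L))"
      using hausdorff_chart_preimage[OF \<open>0 < s\<close> K(1,2)] by (elim exE)
    from bspec[OF this Nb] have c: "{y \<in> K \<inter> L. \<Phi> y \<in> N} \<in> sets borel"
      "emeasure ?H {y \<in> K \<inter> L. \<Phi> y \<in> N} \<le> ennreal c * emeasure ?H (N \<inter> \<Phi> ` (K \<inter> L))"
      by (rule conjunct1, rule conjunct2)
    have "emeasure ?H (N \<inter> \<Phi> ` (K \<inter> L)) \<le> emeasure ?H N"
      using N(3) by (intro emeasure_mono) auto
    then have "emeasure ?H (N \<inter> \<Phi> ` (K \<inter> L)) = 0" using N(2) by simp
    then have "emeasure ?H {y \<in> K \<inter> L. \<Phi> y \<in> N} = 0" using c(2) by simp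
    then have "{y \<in> K \<inter> L. \<Phi> y \<in> N} \<in> null_sets ?H" using c(1) by (simp add: null_sets_def)
    then show ?thesis
    proof (rule AE_I')
      show "{y \<in> space ?H. \<not> (y \<in> K \<inter> L \<longrightarrow> P (\<Phi> y))} \<subseteq> {y \<in> K \<inter> L. \<Phi> y \<in> N}"
        using N(1) KL\<Omega> by auto
    qed
  qed
  \<comment> \<open>Only the square of \<open>b\<close> is integrable. Since t \<le> 1 +
    \<open>t\<^sup>2\<close>, this majorant dominates \<open>b\<close> itself, and the constant 1 is
    integrable because \<open>K \<inter> L\<close> has finite measure.\<close>
  define W where "W y = indicator (K \<inter> L) y * (1 + (b (\<Phi> y))\<^sup>2)" for y
  have W_meas: "W \<in> borel_measurable borel"
  proof -
    have [measurable]: "(\<lambda>y. indicator (V \<inter> L) y *\<^sub>R (1 + (b (\<Phi> y))\<^sup>2)) \<in> borel_measurable borel"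
      using a(5) by (intro borel_measurable_chart[of "\<lambda>x. 1 + (b x)\<^sup>2"]) measurable
    have "indicator (K \<inter> L) \<in> borel_measurable (borel :: (complex ^ 'N) measure)" by measurable
    then have "(\<lambda>y. indicator (K \<inter> L) y * (indicator (V \<inter> L) y *\<^sub>R (1 + (b (\<Phi> y))\<^sup>2))) \<in> borel_measurable borel"
      by (rule borel_measurable_times) fact
    moreover have "(\<lambda>y. indicator (K \<inter> L) y * (indicator (V \<inter> L) y *\<^sub>R (1 + (b (\<Phi> y))\<^sup>2))) = W"
      using K(2) by (intro ext) (auto simp: W_def indicator_def)
    ultimately show ?thesis by simp
  qed
  have W_int: "integrable ?H W"
  proof (rule integrableI_bounded)
    obtain c where c: "\<And>h. h \<in> borel_measurable borel \<Longrightarrow> (\<integral>\<^sup>+y. h (\<Phi> y) * indicator (K \<inter> L) y \<partial>?H)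
        \<le> ennreal c * (\<integral>\<^sup>+x. h x * indicator (\<Phi> ` (K \<inter> L)) x \<partial>?H)"
      using nn_integral_chart_le[OF \<open>0 < s\<close> K(1,2)] by blast
    have "(\<integral>\<^sup>+x. (1 + ennreal ((b x)\<^sup>2)) * indicator (\<Phi> ` (K \<inter> L)) x \<partial>?H) \<le>
        (\<integral>\<^sup>+x. indicator (\<Phi> ` (K \<inter> L)) x + indicator \<Omega> x * ennreal ((b x)\<^sup>2) \<partial>?H)"
      using KL\<Omega> by (intro nn_integral_mono) (auto simp: indicator_def)
    also have "\<dots> = emeasure ?H (\<Phi> ` (K \<inter> L)) + (\<integral>\<^sup>+x. ennreal ((b x)\<^sup>2) \<partial>?M)"
      using a(5) borel_compact[OF compact_chart_image[OF K(1,2)]]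
      by (subst nn_integral_add) (auto simp: nn_integral_density)
    also have "\<dots> < \<infinity>"
      using a(6) fin[OF compact_chart_image[OF K(1,2)] KL\<Omega>] by simp
    finally have "ennreal c * (\<integral>\<^sup>+x. (1 + ennreal ((b x)\<^sup>2)) * indicator (\<Phi> ` (K \<inter> L)) x \<partial>?H) < \<infinity>"
      by (simp add: ennreal_mult_less_top)
    moreover have "(\<integral>\<^sup>+y. ennreal (norm (W y)) \<partial>?H) = (\<integral>\<^sup>+y. (1 + ennreal ((b (\<Phi> y))\<^sup>2)) * indicator (K \<inter> L) y \<partial>?H)"
      by (intro nn_integral_cong) (auto simp: W_def indicator_def)
    moreover have "\<dots> \<le> ennreal c * (\<integral>\<^sup>+x. (1 + ennreal ((b x)\<^sup>2)) * indicator (\<Phi> ` (K \<inter> L)) x \<partial>?H)"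
      using a(5) by (intro c[of "\<lambda>x. 1 + ennreal ((b x)\<^sup>2)"]) measurable
    ultimately show "(\<integral>\<^sup>+y. ennreal (norm (W y)) \<partial>?H) < \<infinity>" by simp
  qed (use W_meas in simp)
  have contu: "continuous_on UNIV (u k)" for k using a(4) by (rule GDERIV_imp_continuous_on)
  have um: "u k \<in> borel_measurable borel" "g k \<in> borel_measurable borel" for k
    using contu a(3) by (auto intro: borel_measurable_continuous_onI)
  have m1: "(\<lambda>y. indicator (V \<inter> L) y *\<^sub>R (h (\<Phi> y) * (\<gamma> y \<bullet> v))) \<in> borel_measurable ?H"
    if "h \<in> borel_measurable borel" for h :: "complex ^ 'N \<Rightarrow> real"
  proof -
    have [measurable]: "(\<lambda>y. indicator (V \<inter> L) y *\<^sub>R h (\<Phi> y)) \<in> borel_measurable borel"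
      by (rule borel_measurable_chart[OF that])
    have "(\<lambda>y. (indicator (V \<inter> L) y *\<^sub>R h (\<Phi> y)) * (\<gamma> y \<bullet> v)) \<in> borel_measurable ?H" by measurable
    then show ?thesis by (simp add: mult.assoc)
  qed
  have m2: "(\<lambda>y. indicator (V \<inter> L) y *\<^sub>R ((h (\<Phi> y) \<bullet> \<Phi>' y v) * \<phi> y)) \<in> borel_measurable ?H"
    if "h \<in> borel_measurable borel" for h :: "complex ^ 'N \<Rightarrow> complex ^ 'N"
  proof -
    have [measurable]: "(\<lambda>y. indicator (V \<inter> L) y *\<^sub>R h (\<Phi> y)) \<in> borel_measurable borel"
      by (rule borel_measurable_chart[OF that])
    have [measurable]: "(\<lambda>y. indicator V y *\<^sub>R \<Phi>' y v) \<in> borel_measurable borel"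
      by (intro borel_measurable_continuous_on_indicator V_borel continuous_on_deriv)
    have "(\<lambda>y. ((indicator (V \<inter> L) y *\<^sub>R h (\<Phi> y)) \<bullet> (indicator V y *\<^sub>R \<Phi>' y v)) * \<phi> y) \<in> borel_measurable ?H" by measurable
    moreover have "(\<lambda>y. ((indicator (V \<inter> L) y *\<^sub>R h (\<Phi> y)) \<bullet> (indicator V y *\<^sub>R \<Phi>' y v)) * \<phi> y) =
        (\<lambda>y. indicator (V \<inter> L) y *\<^sub>R ((h (\<Phi> y) \<bullet> \<Phi>' y v) * \<phi> y))"
      by (intro ext) (auto simp: indicator_def)
    ultimately show ?thesis by simp
  qed
  obtain B1 where B1: "0 \<le> B1" "\<And>y. norm (\<gamma> y \<bullet> v) \<le> B1"
  proof -
    have "continuous_on K (\<lambda>y. \<gamma> y \<bullet> v)"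
      by (intro continuous_on_inner continuous_on_const continuous_on_subset[OF cont\<gamma>]) auto
    from continuous_compact_support_bounded[OF K(1) this] \<gamma>0
    show thesis using that by auto
  qed
  obtain B2 where B2: "0 \<le> B2" "\<And>y. norm (\<phi> y *\<^sub>R \<Phi>' y v) \<le> B2"
  proof -
    have "continuous_on K (\<lambda>y. \<phi> y *\<^sub>R \<Phi>' y v)"
      using K(2) by (intro continuous_on_scaleR continuous_on_subset[OF cont\<phi>] continuous_on_subset[OF continuous_on_deriv]) auto
    from continuous_compact_support_bounded[OF K(1) this] K(3)
    show thesis using that by auto
  qed
  have AE_K: "AE y in ?H. y \<in> K \<inter> L \<longrightarrow> (\<forall>k. \<bar>u k (\<Phi> y)\<bar> \<le> b (\<Phi> y) \<and> norm (g k (\<Phi> y)) \<le> b (\<Phi> y)) \<and>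
        (\<lambda>k. u k (\<Phi> y)) \<longlonglongrightarrow> f (\<Phi> y) \<and> (\<lambda>k. g k (\<Phi> y)) \<longlonglongrightarrow> D (\<Phi> y)"
    by (rule transfer[OF a(7)])
  have "(\<lambda>k. LINT y:(V \<inter> L)|?H. u k (\<Phi> y) * (\<gamma> y \<bullet> v)) \<longlonglongrightarrow> (LINT y:(V \<inter> L)|?H. f (\<Phi> y) * (\<gamma> y \<bullet> v))"
    unfolding set_lebesgue_integral_def
  proof (rule integral_dominated_convergence[where w = "\<lambda>y. B1 * W y"])
    show "AE y in ?H. (\<lambda>k. indicator (V \<inter> L) y *\<^sub>R (u k (\<Phi> y) * (\<gamma> y \<bullet> v))) \<longlonglongrightarrow> indicator (V \<inter> L) y *\<^sub>R (f (\<Phi> y) * (\<gamma> y \<bullet> v))"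
      using AE_K
    proof eventually_elim
      case (elim y)
      show ?case
      proof (cases "y \<in> K \<inter> L")
        case True
        then show ?thesis using elim by (intro tendsto_scaleR tendsto_mult tendsto_const) auto
      next
        case False
        then show ?thesis using \<gamma>0[of y] by (auto simp: indicator_def)
      qed
    qed
    show "AE y in ?H. norm (indicator (V \<inter> L) y *\<^sub>R (u k (\<Phi> y) * (\<gamma> y \<bullet> v))) \<le> B1 * W y" for k
      using AE_K
    proof eventually_elim
      case (elim y)
      show ?case
      proof (cases "y \<in> K \<inter> L")
        case True
        then have "\<bar>u k (\<Phi> y)\<bar> \<le> 1 + (b (\<Phi> y))\<^sup>2" using elim le_1_plus_power2[of "b (\<Phi> y)"] by (blast intro: order_trans)
        then have "\<bar>u k (\<Phi> y)\<bar> * \<bar>\<gamma> y \<bullet> v\<bar> \<le> (1 + (b (\<Phi> y))\<^sup>2) * B1"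
          using B1(2)[of y] by (intro mult_mono) auto
        then show ?thesis using True K(2) by (auto simp: W_def abs_mult mult.commute)
      next
        case False
        then show ?thesis using \<gamma>0[of y] by (auto simp: indicator_def W_def)
      qed
    qed
  qed (use W_int um a(1) m1 in auto)
  moreover have "(\<lambda>k. LINT y:(V \<inter> L)|?H. (g k (\<Phi> y) \<bullet> \<Phi>' y v) * \<phi> y) \<longlonglongrightarrow> (LINT y:(V \<inter> L)|?H. (D (\<Phi> y) \<bullet> \<Phi>' y v) * \<phi> y)"
    unfolding set_lebesgue_integral_def
  proof (rule integral_dominated_convergence[where w = "\<lambda>y. B2 * W y"])
    show "AE y in ?H. (\<lambda>k. indicator (V \<inter> L) y *\<^sub>R ((g k (\<Phi> y) \<bullet> \<Phi>' y v) * \<phi> y)) \<longlonglongrightarrow> indicator (V \<inter> L) y *\<^sub>R ((D (\<Phi> y) \<bullet> \<Phi>' y v) * \<phi> y)"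
      using AE_K
    proof eventually_elim
      case (elim y)
      show ?case
      proof (cases "y \<in> K \<inter> L")
        case True
        then show ?thesis using elim by (intro tendsto_scaleR tendsto_mult tendsto_inner tendsto_const) auto
      next
        case False
        then show ?thesis using K(3)[of y] by (auto simp: indicator_def)
      qed
    qed
    show "AE y in ?H. norm (indicator (V \<inter> L) y *\<^sub>R ((g k (\<Phi> y) \<bullet> \<Phi>' y v) * \<phi> y)) \<le> B2 * W y" for k
      using AE_K
    proof eventually_elim
      case (elim y)
      show ?case
      proof (cases "y \<in> K \<inter> L")
        case True
        then have le: "norm (g k (\<Phi> y)) \<le> 1 + (b (\<Phi> y))\<^sup>2" using elim le_1_plus_power2[of "b (\<Phi> y)"] by (blast intro: order_trans)
        have "\<bar>(g k (\<Phi> y) \<bullet> \<Phi>' y v) * \<phi> y\<bar> = \<bar>g k (\<Phi> y) \<bullet> (\<phi> y *\<^sub>R \<Phi>' y v)\<bar>" by (simp add: abs_mult)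
        also have "\<dots> \<le> norm (g k (\<Phi> y)) * norm (\<phi> y *\<^sub>R \<Phi>' y v)" by (rule Cauchy_Schwarz_ineq2)
        also have "\<dots> \<le> (1 + (b (\<Phi> y))\<^sup>2) * B2" using le B2(2)[of y] by (intro mult_mono) auto
        finally show ?thesis using True K(2) by (auto simp: W_def mult.commute)
      next
        case False
        then show ?thesis using K(3)[of y] by (auto simp: indicator_def W_def)
      qed
    qed
  qed (use W_int um a(2) m2 in auto)
  then have "(\<lambda>k. - (LINT y:(V \<inter> L)|?H. (g k (\<Phi> y) \<bullet> \<Phi>' y v) * \<phi> y)) \<longlonglongrightarrow> - (LINT y:(V \<inter> L)|?H. (D (\<Phi> y) \<bullet> \<Phi>' y v) * \<phi> y)"
    by (rule tendsto_minus)
  moreover have "(LINT y:(V \<inter> L)|?H. u k (\<Phi> y) * (\<gamma> y \<bullet> v)) = - (LINT y:(V \<inter> L)|?H. (g k (\<Phi> y) \<bullet> \<Phi>' y v) * \<phi> y)" for k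
    by (rule integral_by_parts_C1[OF \<open>0 < s\<close> a(4) a(3) test v finKL])
  ultimately show ?thesis
    by (simp only:) (rule LIMSEQ_unique)
qed

end

text \<open>Every point of \<open>\<Omega>\<close> is the centre of some ball of
  \<open>\<Omega>\<close>, which has finite measure by the growth condition; finitely many of them
  cover \<open>C\<close>.\<close>

lemma volume_growth_compact_finite:
  assumes "openin (top_of_set X) \<Omega>" "volume_growth_bounded X n \<Omega>" "compact C" "C \<subseteq> \<Omega>"
  shows "hausdorff_outer (2 * real n) C < \<infinity>"
proof -
  obtain k where k: "\<And>q \<rho>. q \<in> \<Omega> \<Longrightarrow> 0 < \<rho> \<Longrightarrow> X \<inter> ball q \<rho> \<subseteq> \<Omega> \<Longrightarrow>
      hausdorff_outer (2 * real n) (X \<inter> ball q \<rho>) \<le> ennreal (k * \<rho> ^ (2 * n))"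
    using assms(2) unfolding volume_growth_bounded_def by blast
  have "\<forall>q\<in>\<Omega>. \<exists>\<rho>>0. ball q \<rho> \<inter> X \<subseteq> \<Omega>" and \<Omega>X: "\<Omega> \<subseteq> X"
    using assms(1) by (auto simp: openin_contains_ball)
  then obtain \<rho> where \<rho>: "\<And>q. q \<in> \<Omega> \<Longrightarrow> 0 < \<rho> q \<and> ball q (\<rho> q) \<inter> X \<subseteq> \<Omega>"
    by metis
  have "C \<subseteq> (\<Union>q\<in>C. ball q (\<rho> q))" using assms(4) \<rho> by fastforce
  then obtain Q where Q: "Q \<subseteq> C" "finite Q" "C \<subseteq> (\<Union>q\<in>Q. ball q (\<rho> q))"
    using compactE_image[OF assms(3), of C "\<lambda>q. ball q (\<rho> q)"] by auto
  have "hausdorff_outer (2 * real n) (\<Union>q\<in>Q. X \<inter> ball q (\<rho> q)) < \<infinity>"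
    using Q(2,1)
  proof (induction Q rule: finite_induct)
    case (insert q Q)
    have q: "q \<in> \<Omega>" using insert assms(4) by auto
    have "hausdorff_outer (2 * real n) (X \<inter> ball q (\<rho> q)) \<le> ennreal (k * \<rho> q ^ (2 * n))"
      using \<rho>[OF q] q by (intro k) auto
    also have "\<dots> < \<infinity>" by simp
    finally have "hausdorff_outer (2 * real n) (X \<inter> ball q (\<rho> q)) + hausdorff_outer (2 * real n) (\<Union>q\<in>Q. X \<inter> ball q (\<rho> q)) < \<infinity>"
      using insert by simp
    then show ?case
      using hausdorff_outer_Un[of "2 * real n" "X \<inter> ball q (\<rho> q)" "\<Union>q\<in>Q. X \<inter> ball q (\<rho> q)"]
      by (simp add: le_less_trans)
  qed simp
  moreover have "C \<subseteq> (\<Union>q\<in>Q. X \<inter> ball q (\<rho> q))"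
    using Q(3) assms(4) \<Omega>X by blast
  ultimately show ?thesis
    using hausdorff_outer_mono by (metis le_less_trans)
qed

section \<open>Vanishing of the capacity\<close>

definition tangential :: "(complex ^ 'N) set \<Rightarrow> (complex ^ 'N \<Rightarrow> complex ^ 'N) \<Rightarrow> complex ^ 'N \<Rightarrow> complex ^ 'N" where
  "tangential X D x = closest_point (tangent_space X x) (D x)"

lemma tangential_in: "x \<in> reg X \<Longrightarrow> tangential X D x \<in> tangent_space X x"
  by (simp add: tangential_def closest_point_subspace_in subspace_tangent_space_reg)

lemma norm_tangential_le: "x \<in> reg X \<Longrightarrow> norm (tangential X D x) \<le> norm (D x)"
  by (simp add: tangential_def norm_closest_point_subspace_le subspace_tangent_space_reg)

lemma tangential_inner: "x \<in> reg X \<Longrightarrow> t \<in> tangent_space X x \<Longrightarrow> tangential X D x \<bullet> t = D x \<bullet> t"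
  using closest_point_subspace_orthogonal[OF subspace_tangent_space_reg, of x X t "D x"]
  by (simp add: tangential_def inner_diff_left)

text \<open>The projection is linear in the vector and, for each fixed basis vector, continuous in
  the base point on \<open>reg X\<close>. Expanding \<open>D x\<close> in the basis combines the
  two.\<close>

lemma tangential_measurable:
  assumes D: "D \<in> borel_measurable borel"
  shows "tangential X D \<in> borel_measurable (restrict_space borel (reg X))"
proof -
  have [measurable]: "D \<in> borel_measurable (restrict_space borel (reg X))"
    using D by (rule measurable_restrict_space1)
  have [measurable]: "(\<lambda>x. closest_point (tangent_space X x) b) \<in> borel_measurable (restrict_space borel (reg X))" for b
    by (rule borel_measurable_continuous_on_restrict[OF continuous_on_tangential_reg])
  have "(\<lambda>x. \<Sum>b\<in>Basis. (D x \<bullet> b) *\<^sub>R closest_point (tangent_space X x) b) \<in> borel_measurable (restrict_space borel (reg X))"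
    by measurable
  then show ?thesis
    by (rule measurable_cong[THEN iffD1, rotated])
      (simp add: tangential_def space_restrict_space closest_point_subspace_sum_Basis[OF subspace_tangent_space_reg, symmetric])
qed

lemma L2_onI:
  fixes g :: "complex ^ 'N \<Rightarrow> 'b::{real_normed_vector, second_countable_topology}"
  assumes "U \<in> sets borel" and g: "g \<in> borel_measurable (restrict_space borel U)"
    and fin: "(\<integral>\<^sup>+x\<in>U. ennreal ((norm (g x))\<^sup>2) \<partial>hausdorff_measure (2 * real n)) < \<infinity>"
  shows "L2_on n U g"
proof -
  have m: "g \<in> borel_measurable (restrict_space (hausdorff_measure (2 * real n)) U)"
    using g by (simp add: measurable_cong_sets[OF sets_restrict_space_cong[OF sets_hausdorff_measure] refl])
  have "integrable (restrict_space (hausdorff_measure (2 * real n)) U) (\<lambda>x. (norm (g x))\<^sup>2)"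
  proof (rule integrableI_bounded)
    show "(\<lambda>x. (norm (g x))\<^sup>2) \<in> borel_measurable (restrict_space (hausdorff_measure (2 * real n)) U)"
      using m by measurable
    show "(\<integral>\<^sup>+x. ennreal (norm ((norm (g x))\<^sup>2)) \<partial>restrict_space (hausdorff_measure (2 * real n)) U) < \<infinity>"
      using fin assms(1) by (subst nn_integral_restrict_space) auto
  qed
  then show ?thesis using m by (simp add: L2_on_def)
qed

lemma set_integrable_compact:
  fixes g :: "complex ^ 'N \<Rightarrow> 'b::euclidean_space"
  assumes "K \<in> sets borel" "K \<subseteq> U" and g: "g \<in> borel_measurable (restrict_space borel U)"
    and K: "emeasure (hausdorff_measure s) K < \<infinity>"
    and fin: "(\<integral>\<^sup>+x\<in>U. ennreal ((norm (g x))\<^sup>2) \<partial>hausdorff_measure s) < \<infinity>" and U: "U \<in> sets borel"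
  shows "set_integrable (hausdorff_measure s) K g"
  unfolding set_integrable_def
proof (rule integrableI_bounded)
  have "g \<in> borel_measurable (restrict_space borel K)"
    using g assms(2) by (rule measurable_restrict_mono)
  then show "(\<lambda>x. indicator K x *\<^sub>R g x) \<in> borel_measurable (hausdorff_measure s)"
    using assms(1) by (simp add: borel_measurable_restrict_space_iff measurable_cong_sets[OF sets_hausdorff_measure refl])
  have gU: "(\<lambda>x. indicator U x *\<^sub>R g x) \<in> borel_measurable borel"
    using g U by (simp add: borel_measurable_restrict_space_iff)
  have gU2: "(\<lambda>x. ennreal ((norm (g x))\<^sup>2) * indicator U x) \<in> borel_measurable borel"
  proof -
    have "(\<lambda>x. ennreal ((norm (indicator U x *\<^sub>R g x))\<^sup>2)) \<in> borel_measurable borel"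
      using gU by measurable
    moreover have "(\<lambda>x. ennreal ((norm (indicator U x *\<^sub>R g x))\<^sup>2)) = (\<lambda>x. ennreal ((norm (g x))\<^sup>2) * indicator U x)"
      by (auto simp: indicator_def)
    ultimately show ?thesis by (simp only:)
  qed
  have "(\<integral>\<^sup>+x. ennreal (norm (indicator K x *\<^sub>R g x)) \<partial>hausdorff_measure s) \<le>
      (\<integral>\<^sup>+x. indicator K x + ennreal ((norm (g x))\<^sup>2) * indicator U x \<partial>hausdorff_measure s)"
  proof (rule nn_integral_mono)
    fix x
    have "ennreal (norm (g x)) \<le> ennreal (1 + (norm (g x))\<^sup>2)"
      by (intro ennreal_leI le_1_plus_power2)
    then show "ennreal (norm (indicator K x *\<^sub>R g x)) \<le> indicator K x + ennreal ((norm (g x))\<^sup>2) * indicator U x"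
      using assms(2) by (auto simp: indicator_def)
  qed
  also have "\<dots> = emeasure (hausdorff_measure s) K + (\<integral>\<^sup>+x\<in>U. ennreal ((norm (g x))\<^sup>2) \<partial>hausdorff_measure s)"
    using assms(1) gU2 by (subst nn_integral_add) (auto simp: measurable_cong_sets[OF sets_hausdorff_measure refl])
  also have "\<dots> < \<infinity>" using K fin by simp
  finally show "(\<integral>\<^sup>+x. ennreal (norm (indicator K x *\<^sub>R g x)) \<partial>hausdorff_measure s) < \<infinity>" .
qed

text \<open>\<open>U\<close> is an arbitrary Borel part of the regular set, so one statement serves
  both \<open>\<Omega> \<inter> reg X\<close> and its relatively compact open subsets. Integration
  by parts first yields the ambient limit \<open>D\<close>; it is tested only against tangent
  vectors and may therefore be projected.\<close>

lemma C1_limit_imp_weak_gradient: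
  fixes X \<Omega> :: "(complex ^ 'N) set"
  assumes n: "1 \<le> n" and X: "analytic_set X" and \<Omega>: "openin (top_of_set X) \<Omega>" and growth: "volume_growth_bounded X n \<Omega>"
    and lim: "C1_limit (density (hausdorff_measure (2 * real n)) (indicator \<Omega>)) f D"
    and U: "U \<in> sets borel" "U \<subseteq> \<Omega> \<inter> reg X"
  shows "weak_gradient X n U f (tangential X D)" "L2_on n U f" "L2_on n U (tangential X D)"
proof -
  let ?H = "hausdorff_measure (2 * real n) :: (complex ^ 'N) measure"
  have \<Omega>b [measurable]: "\<Omega> \<in> sets borel"
    using openin_borel[OF analytic_set_borel[OF X] \<Omega>] .
  have fb: "f \<in> borel_measurable borel" and Db: "D \<in> borel_measurable borel"
    using lim by (auto simp: C1_limit_def C1_approx_def)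
  have f: "f \<in> borel_measurable (restrict_space borel U)"
    using fb by (rule measurable_restrict_space1)
  have G: "tangential X D \<in> borel_measurable (restrict_space borel U)"
    using tangential_measurable[OF Db] by (rule measurable_restrict_mono) (use U in auto)
  have finf: "(\<integral>\<^sup>+x\<in>U. ennreal ((norm (f x))\<^sup>2) \<partial>?H) < \<infinity>"
  proof -
    have "(\<integral>\<^sup>+x\<in>U. ennreal ((norm (f x))\<^sup>2) \<partial>?H) \<le> (\<integral>\<^sup>+x. indicator \<Omega> x * ennreal ((f x)\<^sup>2) \<partial>?H)"
      using U by (intro nn_integral_mono) (auto simp: indicator_def)
    also have "\<dots> < \<infinity>"
      using C1_limit_power2_finite(1)[OF lim] fb by (subst (asm) nn_integral_density) auto
    finally show ?thesis .
  qed
  have finG: "(\<integral>\<^sup>+x\<in>U. ennreal ((norm (tangential X D x))\<^sup>2) \<partial>?H) < \<infinity>"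
  proof -
    have "(\<integral>\<^sup>+x\<in>U. ennreal ((norm (tangential X D x))\<^sup>2) \<partial>?H) \<le> (\<integral>\<^sup>+x. indicator \<Omega> x * ennreal ((norm (D x))\<^sup>2) \<partial>?H)"
      using U by (intro nn_integral_mono) (auto simp: indicator_def intro!: ennreal_leI power_mono norm_tangential_le)
    also have "\<dots> < \<infinity>"
      using C1_limit_power2_finite(2)[OF lim] Db by (subst (asm) nn_integral_density) auto
    finally show ?thesis .
  qed
  show "L2_on n U f" by (rule L2_onI[OF U(1) f finf])
  show "L2_on n U (tangential X D)" by (rule L2_onI[OF U(1) G finG])
  have cfin: "emeasure ?H C < \<infinity>" if "compact C" "C \<subseteq> \<Omega>" for C
    using volume_growth_compact_finite[OF \<Omega> growth that] borel_compact[OF that(1)]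
    by (simp add: emeasure_hausdorff_measure)
  have meas: "borel_measurable (restrict_space ?H U) = borel_measurable (restrict_space borel U)"
    by (rule measurable_cong_sets[OF sets_restrict_space_cong[OF sets_hausdorff_measure] refl])
  show "weak_gradient X n U f (tangential X D)"
    unfolding weak_gradient_def
  proof (intro conjI allI impI)
    show "f \<in> borel_measurable (restrict_space ?H U)" "tangential X D \<in> borel_measurable (restrict_space ?H U)"
      using f G by (simp_all add: meas)
    show "AE x in restrict_space ?H U. tangential X D x \<in> tangent_space X x"
      using U(2) by (intro AE_I2) (auto simp: space_restrict_space intro: tangential_in)
  next
    fix K assume "compact K \<and> K \<subseteq> U"
    then have K: "K \<in> sets borel" "K \<subseteq> U" "emeasure ?H K < \<infinity>"
      using U(2) cfin[of K] by (auto intro: borel_compact)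
    show "set_integrable ?H K f" by (rule set_integrable_compact[OF K(1,2) f K(3) finf U(1)])
    show "set_integrable ?H K (tangential X D)" by (rule set_integrable_compact[OF K(1,2) G K(3) finG U(1)])
  next
    fix L V \<Phi> \<phi> \<gamma> v
    assume c: "chart X n L V \<Phi> \<and> \<Phi> ` (V \<inter> L) \<subseteq> U" and t: "test_function V \<phi> \<gamma> \<and> v \<in> L"
    obtain \<Psi> \<Phi>' \<Psi>' where "C1_chart X L V \<Phi> \<Psi> \<Phi>' \<Psi>'"
      using chart_imp_C1_chart[OF conjunct1[OF c]] by (elim exE)
    then interpret C1_chart X L V \<Phi> \<Psi> \<Phi>' \<Psi>' .
    have "(LINT y:(V \<inter> L)|?H. f (\<Phi> y) * (\<gamma> y \<bullet> v)) = - (LINT y:(V \<inter> L)|?H. (D (\<Phi> y) \<bullet> \<Phi>' y v) * \<phi> y)"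
      using c t U(2) n by (intro integral_by_parts_limit[OF _ \<Omega>b _ lim _ _ cfin]) auto
    \<comment> \<open>At points of \<open>V \<inter> L\<close> the vector \<open>\<Phi>' y v\<close>
      is tangent to \<open>X\<close>, so the normal part of \<open>D\<close> does not
      contribute.\<close>
    also have "(LINT y:(V \<inter> L)|?H. (D (\<Phi> y) \<bullet> \<Phi>' y v) * \<phi> y) =
        (LINT y:(V \<inter> L)|?H. (tangential X D (\<Phi> y) \<bullet> frechet_derivative \<Phi> (at y) v) * \<phi> y)"
    proof (rule set_lebesgue_integral_cong)
      show "V \<inter> L \<in> sets ?H" using V_borel L_borel by simp
      show "\<forall>y. y \<in> V \<inter> L \<longrightarrow> (D (\<Phi> y) \<bullet> \<Phi>' y v) * \<phi> y = (tangential X D (\<Phi> y) \<bullet> frechet_derivative \<Phi> (at y) v) * \<phi> y"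
      proof (intro allI impI)
        fix y assume y: "y \<in> V \<inter> L"
        have fr: "frechet_derivative \<Phi> (at y) = \<Phi>' y"
          using frechet_derivative_at[OF deriv[of y]] y by simp
        have "\<Phi> y \<in> reg X" using c U(2) y by blast
        moreover have "\<Phi>' y v \<in> tangent_space X (\<Phi> y)"
          using tangent_space_eq[OF y] t by blast
        ultimately have "tangential X D (\<Phi> y) \<bullet> \<Phi>' y v = D (\<Phi> y) \<bullet> \<Phi>' y v"
          by (rule tangential_inner)
        then show "(D (\<Phi> y) \<bullet> \<Phi>' y v) * \<phi> y = (tangential X D (\<Phi> y) \<bullet> frechet_derivative \<Phi> (at y) v) * \<phi> y"
          by (simp add: fr)
      qed
    qed
    finally show "(LINT y:(V \<inter> L)|?H. f (\<Phi> y) * (\<gamma> y \<bullet> v)) =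
        - (LINT y:(V \<inter> L)|?H. (tangential X D (\<Phi> y) \<bullet> frechet_derivative \<Phi> (at y) v) * \<phi> y)" .
  qed
qed

lemma C1_limit_imp_W12:
  fixes X \<Omega> :: "(complex ^ 'N) set"
  assumes n: "1 \<le> n" and X: "analytic_set X" and \<Omega>: "openin (top_of_set X) \<Omega>" and growth: "volume_growth_bounded X n \<Omega>"
    and lim: "C1_limit (density (hausdorff_measure (2 * real n)) (indicator \<Omega>)) f D"
  shows "W12_with_gradient X n \<Omega> f (tangential X D)"
    "gradient_energy X n \<Omega> (tangential X D) \<le> (\<integral>\<^sup>+x. ennreal ((norm (D x))\<^sup>2) \<partial>density (hausdorff_measure (2 * real n)) (indicator \<Omega>))"
proof -
  let ?H = "hausdorff_measure (2 * real n) :: (complex ^ 'N) measure"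
  have Xb: "X \<in> sets borel" by (rule analytic_set_borel[OF X])
  have \<Omega>b [measurable]: "\<Omega> \<in> sets borel" by (rule openin_borel[OF Xb \<Omega>])
  have Rb: "\<Omega> \<inter> reg X \<in> sets borel" using openin_borel[OF Xb openin_reg] \<Omega>b by blast
  have fb: "f \<in> borel_measurable borel" and Db: "D \<in> borel_measurable borel"
    using lim by (auto simp: C1_limit_def C1_approx_def)
  note wg = C1_limit_imp_weak_gradient[OF n X \<Omega> growth lim]
  have "L2_on n \<Omega> f"
  proof (rule L2_onI[OF \<Omega>b])
    show "f \<in> borel_measurable (restrict_space borel \<Omega>)" using fb by (rule measurable_restrict_space1)
    have "(\<integral>\<^sup>+x. indicator \<Omega> x * ennreal ((f x)\<^sup>2) \<partial>?H) < \<infinity>"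
      using C1_limit_power2_finite(1)[OF lim] fb by (subst (asm) nn_integral_density) auto
    then show "(\<integral>\<^sup>+x\<in>\<Omega>. ennreal ((norm (f x))\<^sup>2) \<partial>?H) < \<infinity>" by (simp add: mult.commute)
  qed
  moreover have "W12_manifold X n U f" if "openin (top_of_set (\<Omega> \<inter> reg X)) U" for U
  proof -
    have "U \<in> sets borel" "U \<subseteq> \<Omega> \<inter> reg X"
      using openin_borel[OF Rb that] openin_imp_subset[OF that] by auto
    then show ?thesis using wg by (auto simp: W12_manifold_def)
  qed
  ultimately show "W12_with_gradient X n \<Omega> f (tangential X D)"
    using wg(1,3)[OF Rb order_refl] by (simp add: W12_with_gradient_def)
  have "gradient_energy X n \<Omega> (tangential X D) \<le> (\<integral>\<^sup>+x. indicator \<Omega> x * ennreal ((norm (D x))\<^sup>2) \<partial>?H)"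
    unfolding gradient_energy_def
    by (intro nn_integral_mono) (auto simp: indicator_def intro!: ennreal_leI power_mono norm_tangential_le)
  also have "\<dots> = (\<integral>\<^sup>+x. ennreal ((norm (D x))\<^sup>2) \<partial>density ?H (indicator \<Omega>))"
    using Db by (subst nn_integral_density) auto
  finally show "gradient_energy X n \<Omega> (tangential X D) \<le> (\<integral>\<^sup>+x. ennreal ((norm (D x))\<^sup>2) \<partial>density ?H (indicator \<Omega>))" .
qed

section \<open>Covers of bounded energy with small total measure\<close>

lemma closed_inner_points: "closed {x :: 'a::metric_space. X \<inter> ball x h \<subseteq> \<Omega>}"
proof -
  have "{x. X \<inter> ball x h \<subseteq> \<Omega>} = - (\<Union>y\<in>X - \<Omega>. ball y h)"
    by (auto simp: dist_commute)
  then show ?thesis by (simp only:) (intro closed_Compl open_UN ballI open_ball)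
qed

text \<open>By volume growth a ball of radius \<open>r\<close> contributes
  \<open>r\<^sup>-\<^sup>2\<close> times a multiple of \<open>r ^ (2 * n)\<close>, hence a multiple
  of its covering cost for dimension \<open>2 * n - 2\<close>; so \<open>C\<close> does not depend
  on the fineness of the cover. Without the weight the same sum is smaller by the factor
  \<open>\<delta>\<^sup>2\<close>, which makes the total measure of the doubled balls as small as
  desired.\<close>

lemma small_energy_ball_cover:
  fixes X \<Omega> E :: "(complex ^ 'N) set"
  assumes n: "1 \<le> n" and X: "analytic_set X" and \<Omega>: "openin (top_of_set X) \<Omega>" and growth: "volume_growth_bounded X n \<Omega>"
    and E: "E \<subseteq> \<Omega>" "hausdorff_outer (2 * real n - 2) E < \<infinity>"
  defines "M \<equiv> density (hausdorff_measure (2 * real n)) (indicator \<Omega>)"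
  shows "\<exists>C<\<infinity>. \<forall>\<eta>::real. 0 < \<eta> \<longrightarrow> (\<exists>q r. E \<subseteq> (\<Union>i::nat. ball (q i) (r i)) \<and> (\<forall>i. 0 \<le> r i \<and> r i \<le> 1) \<and>
      (\<Sum>i. ennreal (1 / (r i)\<^sup>2) * emeasure M (ball (q i) (2 * r i))) \<le> C \<and>
      emeasure M (\<Union>i. ball (q i) (2 * r i)) \<le> ennreal \<eta>)"
proof -
  have Xb: "X \<in> sets borel" by (rule analytic_set_borel[OF X])
  have \<Omega>b [measurable]: "\<Omega> \<in> sets borel" by (rule openin_borel[OF Xb \<Omega>])
  have \<Omega>X: "\<Omega> \<subseteq> X" using \<Omega> by (rule openin_imp_subset)
  obtain k where k: "\<And>q \<rho>. q \<in> \<Omega> \<Longrightarrow> 0 < \<rho> \<Longrightarrow> X \<inter> ball q \<rho> \<subseteq> \<Omega> \<Longrightarrow>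
      hausdorff_outer (2 * real n) (X \<inter> ball q \<rho>) \<le> ennreal (k * \<rho> ^ (2 * n))"
    using growth unfolding volume_growth_bounded_def by blast
  \<comment> \<open>The subtraction of naturals is exact because \<open>1 \<le> n\<close>; for
    \<open>n = 1\<close> the dimension \<open>m\<close> is 0.\<close>
  define m where "m = 2 * n - 2"
  have m: "real m = 2 * real n - 2" "2 * n = m + 2" using n by (auto simp: m_def of_nat_diff)
  define Z where "Z = ennreal (2 ^ m / unit_ball_vol (real m)) * hausdorff_outer (real m) E + 1"
  have "Z < \<infinity>" using E(2) by (simp add: Z_def m(1) ennreal_mult_less_top)
  \<comment> \<open>The power of 2 comes from the doubled radius. The growth constant
    \<open>k\<close> is an arbitrary real number, hence the absolute value.\<close>
  define c where "c = 2 ^ (2 * n) * \<bar>k\<bar>"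
  have "0 \<le> c" by (simp add: c_def)
  define C where "C = ennreal c * Z"
  have Cfin: "C < \<infinity>" using \<open>Z < \<infinity>\<close> by (simp add: C_def ennreal_mult_less_top)
  \<comment> \<open>Strata of points by their room in \<open>\<Omega>\<close>. They are closed,
    since the complement is a union of balls around the points of \<open>X - \<Omega>\<close>, and
    they exhaust \<open>\<Omega>\<close>.\<close>
  define B where "B j = {x. X \<inter> ball x (1 / real (Suc j)) \<subseteq> \<Omega>}" for j
  \<comment> \<open>Half of the room on the stratum \<open>B j\<close>, so that also the doubled
    balls are balls of \<open>\<Omega>\<close>.\<close>
  define h where "h j = 1 / (2 * real (Suc j))" for j
  have Bb: "B j \<in> sets borel" for j
    unfolding B_def by (intro borel_closed closed_inner_points)
  have EB: "E \<subseteq> (\<Union>j. B j)"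
  proof
    fix x assume "x \<in> E"
    then have "x \<in> \<Omega>" using E(1) by blast
    then obtain e where e: "e > 0" "ball x e \<inter> X \<subseteq> \<Omega>"
      using \<Omega> unfolding openin_contains_ball by blast
    obtain j where "1 / real (Suc j) < e" using e(1) by (rule nat_approx_posE)
    then have "x \<in> B j" using e(2) by (force simp: B_def)
    then show "x \<in> (\<Union>j. B j)" by blast
  qed
  have "\<exists>q r. E \<subseteq> (\<Union>i::nat. ball (q i) (r i)) \<and> (\<forall>i. 0 \<le> r i \<and> r i \<le> 1) \<and>
      (\<Sum>i. ennreal (1 / (r i)\<^sup>2) * emeasure M (ball (q i) (2 * r i))) \<le> C \<and>
      emeasure M (\<Union>i. ball (q i) (2 * r i)) \<le> ennreal \<eta>" if \<eta>: "0 < \<eta>" for \<eta>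
  proof -
    define C' where "C' = enn2real C"
    have C': "C = ennreal C'" "0 \<le> C'" using Cfin by (auto simp: C'_def)
    \<comment> \<open>Chosen so that \<open>\<delta>\<^sup>2 * C'\<close> \<le>
      \<open>\<delta> * C'\<close> \<le> \<open>\<eta>\<close>; adding 1 in the denominator covers
      \<open>C' = 0\<close>.\<close>
    define \<delta> where "\<delta> = min 1 (\<eta> / (C' + 1))"
    have \<delta>: "0 < \<delta>" "\<delta> \<le> 1" using \<eta> C'(2) by (auto simp: \<delta>_def)
    have \<delta>C: "\<delta>\<^sup>2 * C' \<le> \<eta>"
    proof -
      have "\<delta>\<^sup>2 \<le> \<delta>" using \<delta> by (simp add: power2_eq_square mult_left_le)
      also have "\<dots> \<le> \<eta> / (C' + 1)" by (simp add: \<delta>_def)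
      finally have "\<delta>\<^sup>2 * C' \<le> \<eta> / (C' + 1) * C'" using C'(2) by (rule mult_right_mono)
      also have "\<dots> \<le> \<eta>" using \<eta> C'(2) by (simp add: field_simps)
      finally show ?thesis .
    qed
    have hpos: "0 < h j" for j by (simp add: h_def)
    have "hausdorff_outer (real m) E < \<infinity>" using E(2) by (simp add: m(1))
    from hausdorff_outer_fine_ball_cover[where h = h, OF this Bb EB hpos \<delta>(1)]
    obtain q r where cover: "E \<subseteq> (\<Union>i::nat. ball (q i) (r i))"
      and r_all: "\<forall>i. 0 \<le> r i \<and> r i \<le> \<delta> \<and> (0 < r i \<longrightarrow> q i \<in> E \<and> (\<exists>j. q i \<in> B j \<and> r i \<le> h j))"
      and r_sum: "(\<Sum>i. if 0 < r i then ennreal (r i ^ m) else 0) \<le> Z"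
      by (elim exE conjE) (rule that, assumption+, unfold Z_def, assumption)
    have r: "0 \<le> r i" "r i \<le> \<delta>" for i using r_all by auto
    have ball_le: "ennreal (1 / (r i)\<^sup>2) * emeasure M (ball (q i) (2 * r i)) \<le> ennreal c * (if 0 < r i then ennreal (r i ^ m) else 0)" for i
    proof (cases "0 < r i")
      case True
      obtain j where j: "q i \<in> E" "q i \<in> B j" "r i \<le> h j" using r_all True by blast
      have "2 * r i \<le> 1 / real (Suc j)" using j(3) by (simp add: h_def field_simps)
      then have in\<Omega>: "X \<inter> ball (q i) (2 * r i) \<subseteq> \<Omega>" using j(2) by (force simp: B_def)
      have "emeasure M (ball (q i) (2 * r i)) = emeasure (hausdorff_measure (2 * real n)) (\<Omega> \<inter> ball (q i) (2 * r i))"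
        unfolding M_def by (subst emeasure_density) (auto simp: nn_integral_indicator simp flip: indicator_inter_arith)
      also have "\<dots> = hausdorff_outer (2 * real n) (\<Omega> \<inter> ball (q i) (2 * r i))"
        by (rule emeasure_hausdorff_measure) simp
      also have "\<dots> \<le> hausdorff_outer (2 * real n) (X \<inter> ball (q i) (2 * r i))"
        using \<Omega>X by (intro hausdorff_outer_mono) auto
      also have "\<dots> \<le> ennreal (k * (2 * r i) ^ (2 * n))"
        using in\<Omega> j(1) E(1) True by (intro k) auto
      also have "\<dots> \<le> ennreal (c * (r i ^ m * (r i)\<^sup>2))"
      proof (rule ennreal_leI)
        have "k * (2 * r i) ^ (2 * n) \<le> \<bar>k\<bar> * (2 * r i) ^ (2 * n)"
          using True by (intro mult_right_mono) auto
        also have "\<dots> = c * r i ^ (2 * n)" by (simp add: c_def power_mult_distrib)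
        also have "\<dots> = c * (r i ^ m * (r i)\<^sup>2)" unfolding m(2) power_add ..
        finally show "k * (2 * r i) ^ (2 * n) \<le> c * (r i ^ m * (r i)\<^sup>2)" .
      qed
      finally have "ennreal (1 / (r i)\<^sup>2) * emeasure M (ball (q i) (2 * r i)) \<le> ennreal (1 / (r i)\<^sup>2) * ennreal (c * (r i ^ m * (r i)\<^sup>2))"
        by (rule mult_left_mono) simp
      also have "\<dots> = ennreal (1 / (r i)\<^sup>2 * (c * (r i ^ m * (r i)\<^sup>2)))"
        by (rule ennreal_mult'[symmetric]) simp
      also have "1 / (r i)\<^sup>2 * (c * (r i ^ m * (r i)\<^sup>2)) = c * r i ^ m" using True by simp
      also have "ennreal (c * r i ^ m) = ennreal c * ennreal (r i ^ m)" using \<open>0 \<le> c\<close> by (rule ennreal_mult')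
      finally show ?thesis using True by simp
    next
      case False
      then have "r i = 0" using r(1)[of i] by simp
      then show ?thesis by simp
    qed
    have energy: "(\<Sum>i. ennreal (1 / (r i)\<^sup>2) * emeasure M (ball (q i) (2 * r i))) \<le> C"
    proof -
      have "(\<Sum>i. ennreal (1 / (r i)\<^sup>2) * emeasure M (ball (q i) (2 * r i))) \<le> (\<Sum>i. ennreal c * (if 0 < r i then ennreal (r i ^ m) else 0))"
        by (intro suminf_le ball_le) auto
      also have "\<dots> = ennreal c * (\<Sum>i. if 0 < r i then ennreal (r i ^ m) else 0)" by (rule ennreal_suminf_cmult)
      also have "\<dots> \<le> C" unfolding C_def by (intro mult_left_mono r_sum) simp
      finally show ?thesis .
    qed
    have "emeasure M (\<Union>i. ball (q i) (2 * r i)) \<le> (\<Sum>i. emeasure M (ball (q i) (2 * r i)))"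
      by (intro emeasure_subadditive_countably) (auto simp: M_def)
    also have "\<dots> \<le> (\<Sum>i. ennreal (\<delta>\<^sup>2) * (ennreal (1 / (r i)\<^sup>2) * emeasure M (ball (q i) (2 * r i))))"
    proof (intro suminf_le)
      fix i
      show "emeasure M (ball (q i) (2 * r i)) \<le> ennreal (\<delta>\<^sup>2) * (ennreal (1 / (r i)\<^sup>2) * emeasure M (ball (q i) (2 * r i)))"
      proof (cases "0 < r i")
        case True
        have "(r i)\<^sup>2 \<le> \<delta>\<^sup>2" using r by (intro power_mono) auto
        then have "1 \<le> \<delta>\<^sup>2 * (1 / (r i)\<^sup>2)" using True by (simp add: pos_le_divide_eq)
        then have "ennreal 1 \<le> ennreal (\<delta>\<^sup>2 * (1 / (r i)\<^sup>2))" by (rule ennreal_leI)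
        also have "\<dots> = ennreal (\<delta>\<^sup>2) * ennreal (1 / (r i)\<^sup>2)" by (rule ennreal_mult') simp
        finally have "ennreal 1 * emeasure M (ball (q i) (2 * r i)) \<le> ennreal (\<delta>\<^sup>2) * ennreal (1 / (r i)\<^sup>2) * emeasure M (ball (q i) (2 * r i))"
          by (rule mult_right_mono) simp
        then show ?thesis by (simp add: mult.assoc)
      next
        case False
        then have "r i = 0" using r(1)[of i] by simp
        then show ?thesis by simp
      qed
    qed auto
    also have "\<dots> = ennreal (\<delta>\<^sup>2) * (\<Sum>i. ennreal (1 / (r i)\<^sup>2) * emeasure M (ball (q i) (2 * r i)))"
      by (rule ennreal_suminf_cmult)
    also have "\<dots> \<le> ennreal (\<delta>\<^sup>2) * C" by (intro mult_left_mono energy) simp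
    also have "\<dots> = ennreal (\<delta>\<^sup>2 * C')" unfolding C'(1) by (rule ennreal_mult'[symmetric]) simp
    also have "\<dots> \<le> ennreal \<eta>" using \<delta>C by (rule ennreal_leI)
    finally have "emeasure M (\<Union>i. ball (q i) (2 * r i)) \<le> ennreal \<eta>" .
    moreover have "\<forall>i. 0 \<le> r i \<and> r i \<le> 1" using r \<delta>(2) by (meson order_trans)
    ultimately show ?thesis using cover energy by (intro exI[of _ q] exI[of _ r] conjI)
  qed
  then show ?thesis using Cfin by (intro exI[of _ C]) simp
qed

theorem theorem3p1p6:
  fixes X \<Omega> E :: "(complex ^ 'N) set" and n :: nat
  assumes "analytic_set X"
    and "1 \<le> n"
    and "reg_has_dim X n"
    and "openin (top_of_set X) \<Omega>"
    and "volume_growth_bounded X n \<Omega>"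
    and "E \<subseteq> \<Omega>"
    and "hausdorff_outer (2 * real n - 2) E < \<infinity>"
  shows "capacity12 X n \<Omega> E = 0"
proof -
  \<comment> \<open>Carrying the restriction to \<open>\<Omega>\<close> in the measure allows balls,
    cutoffs and neighbourhoods of \<open>E\<close> to be taken in the ambient space.\<close>
  define M :: "(complex ^ 'N) measure" where "M = density (hausdorff_measure (2 * real n)) (indicator \<Omega>)"
  have M: "sets M = sets borel" by (simp add: M_def)
  obtain C where C: "C < \<infinity>" and cover: "\<And>\<eta>::real. 0 < \<eta> \<Longrightarrow> \<exists>q r. E \<subseteq> (\<Union>i::nat. ball (q i) (r i)) \<and> (\<forall>i. 0 \<le> r i \<and> r i \<le> 1) \<and>
      (\<Sum>i. ennreal (1 / (r i)\<^sup>2) * emeasure M (ball (q i) (2 * r i))) \<le> C \<and>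
      emeasure M (\<Union>i. ball (q i) (2 * r i)) \<le> ennreal \<eta>"
    using small_energy_ball_cover[OF assms(2,1,4,5,6,7)] unfolding M_def[symmetric]
    by (elim exE conjE) (rule that, assumption, blast)
  \<comment> \<open>Scaling by \<open>1 / m\<close> multiplies the energy by the square of this
    factor, against a linear growth in \<open>m\<close> for the sum of \<open>m\<close> cutoffs that
    is at least \<open>m\<close> near \<open>E\<close>.\<close>
  have bound: "capacity12 X n \<Omega> E \<le> ennreal (1 / real m) * (1 + 32 * C)" if m: "0 < m" for m :: nat
  proof -
    have "\<exists>f D U. C1_limit M f D \<and> open U \<and> E \<subseteq> U \<and> (\<forall>x\<in>U. real m \<le> f x) \<and>
        (\<integral>\<^sup>+x. ennreal ((norm (D x))\<^sup>2) \<partial>M) \<le> of_nat m * (1 + 32 * C)"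
      by (rule C1_limit_multiple[OF M C]) (rule cover)
    then obtain f D U where f: "C1_limit M f D" "open U" "E \<subseteq> U" "\<And>x. x \<in> U \<Longrightarrow> real m \<le> f x"
      "(\<integral>\<^sup>+x. ennreal ((norm (D x))\<^sup>2) \<partial>M) \<le> of_nat m * (1 + 32 * C)"
      by (elim exE conjE) (rule that, assumption+, rule bspec, assumption+)
    define f' D' where "f' = (\<lambda>x. (1 / real m) * f x)" and "D' = (\<lambda>x. (1 / real m) *\<^sub>R D x)"
    have lim: "C1_limit M f' D'" unfolding f'_def D'_def by (rule C1_limit_scale[OF M f(1)])
    have Db: "D \<in> borel_measurable borel"
      using f(1) by (auto simp: C1_limit_def C1_approx_def)
    have "E \<subseteq> (top_of_set \<Omega>) interior_of {x \<in> \<Omega>. 1 \<le> f' x}"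
    proof (rule order_trans)
      show "E \<subseteq> \<Omega> \<inter> U" using assms(6) f(3) by blast
      show "\<Omega> \<inter> U \<subseteq> (top_of_set \<Omega>) interior_of {x \<in> \<Omega>. 1 \<le> f' x}"
      proof (rule interior_of_maximal)
        show "\<Omega> \<inter> U \<subseteq> {x \<in> \<Omega>. 1 \<le> f' x}" using f(4) m by (auto simp: f'_def)
        show "openin (top_of_set \<Omega>) (\<Omega> \<inter> U)" using f(2) by (rule openin_open_Int)
      qed
    qed
    then have "capacity12 X n \<Omega> E \<le> gradient_energy X n \<Omega> (tangential X D')"
      unfolding capacity12_def using C1_limit_imp_W12(1)[OF assms(2,1,4,5) lim[unfolded M_def]]
      by (intro INF_lower2[of "(f', tangential X D')"]) auto
    also have "\<dots> \<le> (\<integral>\<^sup>+x. ennreal ((norm (D' x))\<^sup>2) \<partial>M)"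
      unfolding M_def by (rule C1_limit_imp_W12(2)[OF assms(2,1,4,5) lim[unfolded M_def]])
    also have "\<dots> = (\<integral>\<^sup>+x. ennreal (1 / (real m)\<^sup>2) * ennreal ((norm (D x))\<^sup>2) \<partial>M)"
      by (intro nn_integral_cong) (simp add: D'_def power_divide ennreal_mult'[symmetric])
    also have "\<dots> = ennreal (1 / (real m)\<^sup>2) * (\<integral>\<^sup>+x. ennreal ((norm (D x))\<^sup>2) \<partial>M)"
      using Db by (intro nn_integral_cmult) (simp add: measurable_cong_sets[OF M refl])
    also have "\<dots> \<le> ennreal (1 / (real m)\<^sup>2) * (of_nat m * (1 + 32 * C))"
      by (intro mult_left_mono f(5)) simp
    also have "\<dots> = ennreal (1 / (real m)\<^sup>2 * real m) * (1 + 32 * C)"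
      by (subst ennreal_mult') (simp_all add: mult.assoc ennreal_of_nat_eq_real_of_nat)
    also have "1 / (real m)\<^sup>2 * real m = 1 / real m" using m by (simp add: power2_eq_square)
    finally show ?thesis .
  qed
  obtain c where c: "1 + 32 * C = ennreal c" "0 \<le> c"
    using C by (cases "1 + 32 * C") (auto simp: ennreal_mult_eq_top_iff ennreal_add_eq_top)
  have "capacity12 X n \<Omega> E \<le> ennreal (c / real (Suc m))" for m
    using bound[of "Suc m"] c by (simp add: ennreal_mult'[symmetric])
  moreover have "(\<lambda>m. ennreal (c / real (Suc m))) \<longlonglongrightarrow> ennreal 0"
    by (intro tendsto_ennrealI LIMSEQ_Suc lim_const_over_n)
  ultimately have "capacity12 X n \<Omega> E \<le> ennreal 0"
    by (intro LIMSEQ_le_const) auto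
  then show ?thesis by simp
qed

end
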